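(* Let $\alpha_1=1/2$, $\rho>\rho_c$, $n\ge1$, and let $k$ be the index with $E_k(V)=\epsilon_{(n,1,1),V}$. Then for $\lambda>0$, $$\lim_{V\to\infty}\big\langle\exp\{-\lambda N_k/V\}\big\rangle^C_V(\rho)=\frac{\displaystyle\sum_{m\ge1,\,m\neq n}b_{m,n}\frac{\eta_{m,n}^2}{\eta_{m,n}-\lambda}\Big\{\exp[-\lambda(\rho-\rho_c)]-\exp[-\eta_{m,n}(\rho-\rho_c)]\Big\}}{\displaystyle\sum_{m\ge1,\,m\neq n}b_{m,n}\eta_{m,n}\Big\{1-\exp[-\eta_{m,n}(\rho-\rho_c)]\Big\}}.$$
   Context: Fix exponents $\alpha_1\ge\alpha_2\ge\alpha_3>0$ with $\alpha_1+\alpha_2+\alpha_3=1$ and $\Lambda_V=\{x\in\mathbb{R}^3:0\le x_j\le V^{\alpha_j}\}$. The one-particle Hamiltonian $-\Delta/2$ on $L^2(\Lambda_V)$ with Dirichlet boundary conditions has eigenvalues $\epsilon_{\mathbf{n},V}=\frac{\pi^2}{2}\sum_jn_j^2V^{-2\alpha_j}$, $n_j\ge1$, ordered as $E_1(V)<E_2(V)\le\dots$; $N_k$ is the occupation number of the $k$-th eigenstate. Perfect Bose gas at inverse temperature $\beta>0$; canonical state at density $\rho=N/V$: $\langle\cdot\rangle^C_V(\rho)=Z_V(N)^{-1}\mathrm{Tr}(\cdot\,e^{-\beta T_V^{(N)}})$ on the symmetric $N$-particle space; the limit at fixed $\rho$ means $N$ particles in volume $V=N/\rho$, $N\to\infty$.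 Let $\epsilon_m=\pi^2m^2/2$, $\eta_{m,n}=\beta(\epsilon_m-\epsilon_n)$ and for $m\neq n$, $b_{m,n}=\eta_{m,n}^{-1}\prod_{m'\neq n,\,m'\neq m}(1-\eta_{m,n}/\eta_{m',n})^{-1}$. $F(\eta)=\frac{\sqrt2}{3\pi^2}\eta^{3/2}$, $\rho_c=\int_0^\infty(e^{\beta\eta}-1)^{-1}F(d\eta)$.
   Formalization: Since b_{m,n}η_{m,n} = (−1)^{m+n+1}m²/n², both series diverge in the ordinary sense; they are read as Abel sums, whose existence is proved. Values λ = η_{m,n}, where a term of the numerator is 0/0, are excluded. *)

theory Defs
  imports "HOL-Analysis.Analysis" "HOL-Library.Multiset"
begin

(* One-particle Dirichlet eigenvalue eps_{q,V} of -Delta/2 in the box with sides V^a1, V^a2, V^a3 *)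
definition eps_box :: "real \<Rightarrow> real \<Rightarrow> real \<Rightarrow> real \<Rightarrow> nat \<times> nat \<times> nat \<Rightarrow> real" where
  "eps_box a1 a2 a3 V q = (case q of (n1, n2, n3) \<Rightarrow>
      pi^2 / 2 * (real n1 ^ 2 * V powr (-2 * a1) + real n2 ^ 2 * V powr (-2 * a2)
                  + real n3 ^ 2 * V powr (-2 * a3)))"

definition modes :: "(nat \<times> nat \<times> nat) set" where
  "modes = {(a, b, c). 1 \<le> a \<and> 1 \<le> b \<and> 1 \<le> c}"

(* occupation-number basis of the symmetric N-particle space: multisets of modes of size N;
   count M q is the occupation number of the one-particle eigenstate q *)
definition nstates :: "nat \<Rightarrow> (nat \<times> nat \<times> nat) multiset set" where
  "nstates N = {M. size M = N \<and> set_mset M \<subseteq> modes}"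

(* eigenvalue of T_V^(N) on the basis vector M *)
definition energy :: "real \<Rightarrow> real \<Rightarrow> real \<Rightarrow> real \<Rightarrow> (nat \<times> nat \<times> nat) multiset \<Rightarrow> real" where
  "energy a1 a2 a3 V M = sum_mset (image_mset (eps_box a1 a2 a3 V) M)"

definition gibbs :: "real \<Rightarrow> real \<Rightarrow> real \<Rightarrow> real \<Rightarrow> real \<Rightarrow> (nat \<times> nat \<times> nat) multiset \<Rightarrow> real" where
  "gibbs \<beta> a1 a2 a3 V M = exp (- \<beta> * energy a1 a2 a3 V M)"

(* canonical partition function Z_V(N) = Tr exp(-beta T_V^(N)) *)
definition canon_Z :: "real \<Rightarrow> real \<Rightarrow> real \<Rightarrow> real \<Rightarrow> real \<Rightarrow> nat \<Rightarrow> real" where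
  "canon_Z \<beta> a1 a2 a3 V N = infsum (gibbs \<beta> a1 a2 a3 V) (nstates N)"

(* canonical expectation of an observable diagonal in the occupation-number basis *)
definition canon_state :: "real \<Rightarrow> real \<Rightarrow> real \<Rightarrow> real \<Rightarrow> real \<Rightarrow> nat
      \<Rightarrow> ((nat \<times> nat \<times> nat) multiset \<Rightarrow> real) \<Rightarrow> real" where
  "canon_state \<beta> a1 a2 a3 V N A =
     infsum (\<lambda>M. A M * gibbs \<beta> a1 a2 a3 V M) (nstates N) / canon_Z \<beta> a1 a2 a3 V N"

definition canon_at_density :: "real \<Rightarrow> real \<Rightarrow> real \<Rightarrow> real \<Rightarrow> real \<Rightarrow> nat
      \<Rightarrow> ((nat \<times> nat \<times> nat) multiset \<Rightarrow> real) \<Rightarrow> real" where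
  "canon_at_density \<beta> a1 a2 a3 \<rho> N A = canon_state \<beta> a1 a2 a3 (real N / \<rho>) N A"

definition eps1 :: "nat \<Rightarrow> real" where
  "eps1 m = pi^2 * real m ^ 2 / 2"

definition eta :: "real \<Rightarrow> nat \<Rightarrow> nat \<Rightarrow> real" where
  "eta \<beta> m n = \<beta> * (eps1 m - eps1 n)"

definition bcoef :: "real \<Rightarrow> nat \<Rightarrow> nat \<Rightarrow> real" where
  "bcoef \<beta> m n = inverse (eta \<beta> m n) *
     prodinf (\<lambda>m'. if m' = 0 \<or> m' = n \<or> m' = m then 1
                    else inverse (1 - eta \<beta> m n / eta \<beta> m' n))"

(* integrated density of states F(eta) = sqrt 2/(3 pi^2) eta^(3/2), extended by 0 for eta <= 0 *)
definition Fdos :: "real \<Rightarrow> real" where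
  "Fdos x = sqrt 2 / (3 * pi^2) * (max 0 x) powr (3/2)"

definition rho_c :: "real \<Rightarrow> real" where
  "rho_c \<beta> = set_lebesgue_integral (interval_measure Fdos) {0<..}
               (\<lambda>x. inverse (exp (\<beta> * x) - 1))"

(* Abel summation of a series sum_m a m (regular: agrees with the ordinary sum when it converges) *)
definition abel_sums :: "(nat \<Rightarrow> real) \<Rightarrow> real \<Rightarrow> bool" where
  "abel_sums a s \<longleftrightarrow> (\<forall>t\<in>{0<..<1}. summable (\<lambda>m. a m * t ^ m)) \<and>
      ((\<lambda>t. \<Sum>m. a m * t ^ m) \<longlongrightarrow> s) (at_left 1)"

end

theory Submission
  imports Defs "HOL-Probability.Distributions" "HOL-Probability.Weak_Convergence"
    "HOL-Probability.Product_PMF" "HOL-Real_Asymp.Real_Asymp"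
begin

text \<open>
  Write \<open>\<kappa> = \<beta> \<pi>\<^sup>2 / 2\<close>. After subtracting the transverse ground state energy, which does not change
  canonical expectations, the canonical weights are those of independent geometric occupation
  numbers conditioned on their sum; the soft mode \<open>(m,1,1)\<close> has parameter \<open>exp (- \<kappa> m\<^sup>2 / V)\<close>. The total
  number \<open>N\<close> determines the occupation of the observed mode \<open>(n,1,1)\<close> from the others, so the
  conditioning turns into the integral of \<open>y \<mapsto> exp (- \<mu> (\<rho> - y))\<close>, cut off at \<open>y = \<rho>\<close>, against the law
  of the density \<open>Y\<^sub>V\<close> of all other particles, with \<open>\<mu> = \<lambda> + \<kappa> n\<^sup>2\<close> in the numerator and \<open>\<mu> = \<kappa> n\<^sup>2\<close> in
  the denominator. The geometric variable of the observed mode thus does the smoothing that a local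
  limit theorem would need, and only the weak limit of \<open>Y\<^sub>V\<close> is required.

  The Laplace transform of \<open>Y\<^sub>V\<close> is an explicit product. The modes with excited transverse part
  contribute the constant \<open>\<rho>\<^sub>c\<close>, because their mean density converges to \<open>\<rho>\<^sub>c\<close> and none of them is
  macroscopically occupied (here the larger transverse exponent is below 1/2). The soft modes
  contribute a sum of independent exponential variables with rates \<open>\<kappa> m\<^sup>2\<close>, \<open>m \<noteq> n\<close>.

  The density of this sum is a limit of finite partial fraction expansions whose coefficients
  carry factors \<open>(2 M choose (M + m)) / (2 M choose M)\<close>, which tend to 1. Integrating these expansions
  gives the series of the theorem summed by the corresponding method, which assigns the values 0
  and 1/2 to the divergent series of \<open>(-1)\<^sup>m m\<^sup>2\<close> and \<open>(-1)\<^sup>m\<close>, exactly as Abel summation does.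
\<close>

subsection \<open>Sums and integrals\<close>

lemma tendsto_suminf_dominated:
  fixes a :: "nat \<Rightarrow> 'b \<Rightarrow> real"
  assumes "\<And>k. ((\<lambda>x. a k x) \<longlongrightarrow> b k) F" "eventually (\<lambda>x. \<forall>k. \<bar>a k x\<bar> \<le> B k) F" "summable B" "F \<noteq> bot"
  shows "((\<lambda>x. \<Sum>k. a k x) \<longlongrightarrow> (\<Sum>k. b k)) F"
proof -
  have "eventually (\<lambda>(k,x). norm (a k x) \<le> B k) (at_top \<times>\<^sub>F F)"
    unfolding eventually_prod_filter
    by (rule exI[of _ "\<lambda>_. True"], rule exI[of _ "\<lambda>x. \<forall>k. \<bar>a k x\<bar> \<le> B k"]) (use assms(2) in auto)
  from tannerys_theorem[OF assms(1) this assms(3,4)] show ?thesis by blast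
qed

lemma summable_inverse_squares_real: "summable (\<lambda>m. 1 / real m ^ 2)"
  using inverse_power_summable[of 2, where ?'a = real] by (simp add: inverse_eq_divide)

lemma has_sum_Times_nonneg:
  fixes f :: "'a \<Rightarrow> real" and g :: "'b \<Rightarrow> real"
  assumes f: "(f has_sum a) A" "\<And>x. x \<in> A \<Longrightarrow> f x \<ge> 0" and g: "(g has_sum b) B" "\<And>y. y \<in> B \<Longrightarrow> g y \<ge> 0"
  shows "((\<lambda>(x, y). f x * g y) has_sum (a * b)) (A \<times> B)"
proof (rule has_sum_SigmaI)
  show row_sums: "((\<lambda>x. f x * b) has_sum a * b) A" by (rule has_sum_cmult_left[OF f(1)])
  show rows: "((\<lambda>y. (\<lambda>(x, y). f x * g y) (x, y)) has_sum f x * b) B" for x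
    using has_sum_cmult_right[OF g(1), of "f x"] by simp
  show "(\<lambda>(x, y). f x * g y) summable_on A \<times> B"
    by (rule summable_on_SigmaI[where g = "\<lambda>x. f x * b"])
       (use rows row_sums f g in \<open>auto dest: has_sum_imp_summable\<close>)
qed

lemma has_bochner_integral_density_lborel:
  fixes f g :: "real \<Rightarrow> real"
  assumes [measurable]: "f \<in> borel_measurable borel" "g \<in> borel_measurable borel" "S \<in> sets borel"
    and nonneg: "\<And>x. 0 \<le> f x" "\<And>x. x \<in> S \<Longrightarrow> 0 \<le> g x"
    and integral: "((\<lambda>x. g x * f x) has_integral I) S"
  shows "has_bochner_integral (density lborel f) (\<lambda>x. indicator S x * g x) I"
proof (rule has_bochner_integral_nn_integral)
  show "(\<integral>\<^sup>+x. ennreal (indicator S x * g x) \<partial>density lborel f) = ennreal I"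
    using nn_integral_has_integral_lebesgue[OF _ integral] nonneg
    by (simp add: nn_integral_density ennreal_mult'[symmetric] mult_ac)
  show "0 \<le> I" by (rule has_integral_nonneg[OF integral]) (use nonneg in auto)
qed (use nonneg in \<open>auto simp: indicator_def\<close>)

subsection \<open>Partial fractions and hypoexponential densities\<close>

definition pf_coeff :: "('i \<Rightarrow> 'a::field) \<Rightarrow> 'i set \<Rightarrow> 'i \<Rightarrow> 'a" where
  "pf_coeff a I i = (\<Prod>j\<in>I - {i}. a j / (a j - a i))"

definition hypoexp_density :: "('i \<Rightarrow> real) \<Rightarrow> 'i set \<Rightarrow> real \<Rightarrow> real" where
  "hypoexp_density a I y = (\<Sum>i\<in>I. pf_coeff a I i * a i * exp (- a i * y))"

lemma pf_coeff_insert_member: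
  assumes "finite F" "x \<notin> F" "i \<in> F"
  shows "pf_coeff a (insert x F) i = pf_coeff a F i * (a x / (a x - a i))"
proof -
  have "insert x F - {i} = insert x (F - {i})" using assms by auto
  then show ?thesis using assms by (simp add: pf_coeff_def mult.commute)
qed

lemma partial_fractions:
  assumes "finite I" "I \<noteq> {}" "inj_on a I" "\<And>i. i \<in> I \<Longrightarrow> a i \<noteq> 0"
    and "\<And>i. i \<in> I \<Longrightarrow> a i + s \<noteq> 0"
  shows "(\<Sum>i\<in>I. pf_coeff a I i * (a i / (a i + s))) = (\<Prod>i\<in>I. a i / (a i + s))"
  using assms
proof (induction I arbitrary: s rule: finite_ne_induct)
  case (singleton x)
  then show ?case by (simp add: pf_coeff_def)
next
  case (insert x F)
  have rates_neq: "a i \<noteq> a x" if "i \<in> F" for i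
    using insert.prems(1) insert.hyps that by (auto simp: inj_on_def)
  have coeff_x: "pf_coeff a (insert x F) x = (\<Sum>i\<in>F. pf_coeff a F i * (a i / (a i - a x)))"
    using insert.IH[of "- a x"] insert.prems insert.hyps rates_neq by (simp add: pf_coeff_def)
  have split: "a x / (a x - a i) * (a i / (a i + s)) + a i / (a i - a x) * (a x / (a x + s))
      = a i / (a i + s) * (a x / (a x + s))" if "i \<in> F" for i
  proof -
    have "a i + s \<noteq> 0" "a x + s \<noteq> 0" "a x - a i \<noteq> 0" "a i - a x \<noteq> 0"
      using insert.prems(3) rates_neq[OF that] that by auto
    then show ?thesis by (simp add: divide_simps) (simp add: algebra_simps)
  qed
  have "(\<Sum>i\<in>insert x F. pf_coeff a (insert x F) i * (a i / (a i + s)))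
      = (\<Sum>i\<in>F. pf_coeff a F i * (a i / (a i - a x))) * (a x / (a x + s))
        + (\<Sum>i\<in>F. pf_coeff a F i * (a x / (a x - a i)) * (a i / (a i + s)))"
    using insert.hyps by (simp add: coeff_x pf_coeff_insert_member)
  also have "\<dots> = (\<Sum>i\<in>F. pf_coeff a F i * (a x / (a x - a i) * (a i / (a i + s))
        + a i / (a i - a x) * (a x / (a x + s))))"
    by (simp add: sum_distrib_right sum_distrib_left sum.distrib[symmetric] algebra_simps)
  also have "\<dots> = (\<Sum>i\<in>F. pf_coeff a F i * (a i / (a i + s))) * (a x / (a x + s))"
    unfolding sum_distrib_right by (intro sum.cong refl) (simp only: split mult.assoc)
  also have "\<dots> = (\<Prod>i\<in>F. a i / (a i + s)) * (a x / (a x + s))"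
    using insert.prems by (subst insert.IH) (auto simp: inj_on_def)
  finally show ?case using insert.hyps by (simp add: mult.commute)
qed

lemma pf_coeff_insert_new:
  assumes "finite F" "F \<noteq> {}" "x \<notin> F" "inj_on a (insert x F)" "\<And>i. i \<in> F \<Longrightarrow> a i \<noteq> 0"
  shows "pf_coeff a (insert x F) x = (\<Sum>i\<in>F. pf_coeff a F i * (a i / (a i - a x)))"
proof -
  have "(\<Sum>i\<in>F. pf_coeff a F i * (a i / (a i + - a x))) = (\<Prod>i\<in>F. a i / (a i + - a x))"
    using assms by (intro partial_fractions) (auto simp: inj_on_def)
  then show ?thesis using assms by (simp add: pf_coeff_def)
qed

lemma hypoexp_density_0:
  assumes "finite I" "card I \<ge> 2" "inj_on a I" "\<And>i. i \<in> I \<Longrightarrow> a i \<noteq> 0"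
  shows "hypoexp_density a I 0 = 0"
proof -
  obtain x where x: "x \<in> I" using assms(2) by fastforce
  define F where "F = I - {x}"
  have "card F \<ge> 1" using assms(1,2) x by (simp add: F_def)
  then have "F \<noteq> {}" by auto
  then have F: "finite F" "F \<noteq> {}" "x \<notin> F" "I = insert x F"
    using x assms(1) by (auto simp: F_def)
  have "pf_coeff a F i * (a i / (a i - a x)) * a x + pf_coeff a F i * (a x / (a x - a i)) * a i = 0"
    if "i \<in> F" for i
  proof -
    have "a i \<noteq> a x" using assms(3) F that by (auto simp: inj_on_def)
    then show ?thesis by (simp add: divide_simps) (simp add: algebra_simps)
  qed
  moreover have "hypoexp_density a I 0 =
      (\<Sum>i\<in>F. pf_coeff a F i * (a i / (a i - a x)) * a x + pf_coeff a F i * (a x / (a x - a i)) * a i)"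
    using assms F by (simp add: hypoexp_density_def pf_coeff_insert_new pf_coeff_insert_member
        sum_distrib_right sum.distrib)
  ultimately show ?thesis by simp
qed

lemma hypoexp_density_insert_deriv:
  assumes "finite F" "x \<notin> F" "inj_on a (insert x F)"
  shows "(hypoexp_density a (insert x F) has_real_derivative
    a x * (hypoexp_density a F y - hypoexp_density a (insert x F) y)) (at y)"
proof -
  let ?t = "\<lambda>i. pf_coeff a (insert x F) i * a i * exp (- a i * y)"
  have "((\<lambda>y. \<Sum>i\<in>insert x F. pf_coeff a (insert x F) i * a i * exp (- a i * y)) has_real_derivative
      (\<Sum>i\<in>insert x F. - a i * ?t i)) (at y)"
    by (rule DERIV_sum) (auto intro!: derivative_eq_intros)
  moreover have "a x * (pf_coeff a F i * a i * exp (- a i * y)) = (a x - a i) * ?t i" if "i \<in> F" for i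
  proof -
    have "a x \<noteq> a i" using assms that by (auto simp: inj_on_def)
    then show ?thesis using assms that by (simp add: pf_coeff_insert_member)
  qed
  then have "a x * hypoexp_density a F y = (\<Sum>i\<in>F. (a x - a i) * ?t i)"
    unfolding hypoexp_density_def sum_distrib_left by (rule sum.cong[OF refl])
  then have "a x * hypoexp_density a F y = (\<Sum>i\<in>insert x F. (a x - a i) * ?t i)"
    using assms(1,2) by simp
  then have "a x * (hypoexp_density a F y - hypoexp_density a (insert x F) y) =
      (\<Sum>i\<in>insert x F. - a i * ?t i)"
    unfolding right_diff_distrib hypoexp_density_def sum_distrib_left
    by (simp add: algebra_simps flip: sum_subtractf)
  ultimately show ?thesis by (simp add: hypoexp_density_def[abs_def])
qed

lemma relaxation_ode_nonneg:
  fixes D F :: "real \<Rightarrow> real"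
  assumes D: "\<And>z. (D has_real_derivative c * (F z - D z)) (at z)" "0 \<le> D 0"
    and F: "\<And>z. z \<ge> 0 \<Longrightarrow> 0 \<le> F z" and "c \<ge> 0" "y \<ge> 0"
  shows "0 \<le> D y"
proof -
  have "exp (c * 0) * D 0 \<le> exp (c * y) * D y"
  proof (rule DERIV_nonneg_imp_nondecreasing[OF \<open>y \<ge> 0\<close>])
    fix z :: real assume "0 \<le> z"
    have "((\<lambda>z. exp (c * z) * D z) has_real_derivative c * exp (c * z) * F z) (at z)"
      by (auto intro!: derivative_eq_intros D(1) simp: algebra_simps)
    then show "\<exists>d. ((\<lambda>z. exp (c * z) * D z) has_real_derivative d) (at z) \<and> 0 \<le> d"
      using F[OF \<open>0 \<le> z\<close>] \<open>c \<ge> 0\<close> by (auto intro!: mult_nonneg_nonneg)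
  qed
  then have "0 \<le> exp (c * y) * D y" using D(2) by simp
  then show ?thesis by (simp add: zero_le_mult_iff)
qed

lemma relaxation_ode_bounds:
  fixes D F :: "real \<Rightarrow> real"
  assumes D: "\<And>z. (D has_real_derivative c * (F z - D z)) (at z)" "0 \<le> D 0" "D 0 \<le> K"
    and F: "\<And>z. z \<ge> 0 \<Longrightarrow> 0 \<le> F z" "\<And>z. z \<ge> 0 \<Longrightarrow> F z \<le> K" and "c \<ge> 0" "y \<ge> 0"
  shows "0 \<le> D y" "D y \<le> K"
proof -
  show "0 \<le> D y" by (rule relaxation_ode_nonneg[OF D(1,2) F(1) \<open>c \<ge> 0\<close> \<open>y \<ge> 0\<close>])
  have "((\<lambda>z. K - D z) has_real_derivative c * ((K - F z) - (K - D z))) (at z)" for z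
    by (auto intro!: derivative_eq_intros D(1) simp: algebra_simps)
  from relaxation_ode_nonneg[OF this _ _ \<open>c \<ge> 0\<close> \<open>y \<ge> 0\<close>] show "D y \<le> K" using D(3) F(2) by simp
qed

text \<open>Convolution with an exponential density is the relaxation equation above, so any of the rates
  bounds the density.\<close>

lemma hypoexp_density_bounds:
  assumes "finite J" "l \<notin> J" "inj_on a (insert l J)" "\<And>i. i \<in> insert l J \<Longrightarrow> a i > 0" "y \<ge> 0"
  shows "0 \<le> hypoexp_density a (insert l J) y \<and> hypoexp_density a (insert l J) y \<le> a l"
  using assms
proof (induction J arbitrary: y rule: finite_induct)
  case empty
  then show ?case by (simp add: hypoexp_density_def pf_coeff_def mult_le_cancel_left1)
next
  case (insert x J)
  define F where "F = insert l J"
  have swap: "insert l (insert x J) = insert x F" and F: "finite F" "x \<notin> F" "inj_on a (insert x F)"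
    using insert.hyps insert.prems by (auto simp: F_def insert_commute)
  have pos: "a i > 0" if "i \<in> insert x F" for i
    using insert.prems(3)[of i] that by (auto simp: F_def)
  have IH: "0 \<le> hypoexp_density a F z" "hypoexp_density a F z \<le> a l" if "z \<ge> 0" for z
    unfolding F_def using insert.prems that insert.IH[of z] by (auto simp: inj_on_def)
  have "card F \<ge> 1" using F(1) by (simp add: F_def Suc_le_eq card_gt_0_iff)
  then have "hypoexp_density a (insert x F) 0 = 0"
    using F pos by (intro hypoexp_density_0) (auto simp: less_imp_neq[THEN not_sym])
  moreover have "0 \<le> a l" "0 \<le> a x" using pos[of l] pos[of x] by (simp_all add: F_def)
  ultimately show ?case
    unfolding swap using relaxation_ode_bounds[OF hypoexp_density_insert_deriv[OF F] _ _ IH] \<open>y \<ge> 0\<close>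
    by simp
qed

lemma hypoexp_density_laplace:
  assumes "finite I" "I \<noteq> {}" "inj_on a I" "\<And>i. i \<in> I \<Longrightarrow> a i > 0" "s \<ge> 0"
  shows "((\<lambda>y. exp (- s * y) * hypoexp_density a I y) has_integral (\<Prod>i\<in>I. a i / (a i + s))) {0..}"
proof -
  have pos: "a i + s > 0" if "i \<in> I" for i using assms that by (simp add: add_pos_nonneg)
  have "((\<lambda>y. \<Sum>i\<in>I. pf_coeff a I i * a i * exp (- (a i + s) * y))
      has_integral (\<Sum>i\<in>I. pf_coeff a I i * a i * (exp (- (a i + s) * 0) / (a i + s)))) {0..}"
    by (intro has_integral_sum has_integral_mult_right has_integral_exp_minus_to_infinity assms pos)
  also have "(\<lambda>y. \<Sum>i\<in>I. pf_coeff a I i * a i * exp (- (a i + s) * y)) =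
      (\<lambda>y. exp (- s * y) * hypoexp_density a I y)"
    unfolding hypoexp_density_def sum_distrib_left
    by (intro ext sum.cong refl) (simp add: algebra_simps flip: exp_add)
  also have "(\<Sum>i\<in>I. pf_coeff a I i * a i * (exp (- (a i + s) * 0) / (a i + s))) =
      (\<Sum>i\<in>I. pf_coeff a I i * (a i / (a i + s)))"
    by simp
  also have "\<dots> = (\<Prod>i\<in>I. a i / (a i + s))"
    using assms pos by (intro partial_fractions) (auto simp: less_imp_neq[THEN not_sym])
  finally show ?thesis .
qed

subsection \<open>Quadratic rates\<close>

definition rate :: "real \<Rightarrow> nat \<Rightarrow> real" where
  "rate \<kappa> m = \<kappa> * real m ^ 2"

lemma rate_pos: "\<kappa> > 0 \<Longrightarrow> m \<ge> 1 \<Longrightarrow> rate \<kappa> m > 0"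
  by (simp add: rate_def)

lemma rate_eq_iff [simp]: "\<kappa> \<noteq> 0 \<Longrightarrow> rate \<kappa> i = rate \<kappa> j \<longleftrightarrow> i = j"
  by (simp add: rate_def power2_eq_iff_nonneg)

lemma inj_on_rate: "\<kappa> \<noteq> 0 \<Longrightarrow> inj_on (rate \<kappa>) A"
  by (simp add: inj_on_def)

definition cutoff :: "nat \<Rightarrow> nat \<Rightarrow> real" where
  "cutoff M m = real (2 * M choose (M + m)) / real (2 * M choose M)"

lemma cutoff_eq_0: "M < m \<Longrightarrow> cutoff M m = 0"
  by (simp add: cutoff_def binomial_eq_0)

lemma cutoff_0 [simp]: "cutoff M 0 = 1"
  by (simp add: cutoff_def)

lemma cutoff_bounds: "0 \<le> cutoff M m" "cutoff M m \<le> 1"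
  using binomial_maximum'[of M "M + m"] by (auto simp: cutoff_def divide_le_eq)

lemma cutoff_fact:
  assumes "m \<le> M"
  shows "cutoff M m = (fact M)\<^sup>2 / (fact (M - m) * fact (M + m))"
proof -
  have "real (2 * M choose (M + m)) = fact (2 * M) / (fact (M + m) * fact (M - m))"
    using binomial_fact[of "M + m" "2 * M"] assms by (simp add: mult_2)
  moreover have "real (2 * M choose M) = fact (2 * M) / (fact M)\<^sup>2"
    using binomial_fact[of M "2 * M"] by (simp add: power2_eq_square)
  ultimately show ?thesis by (simp add: cutoff_def mult.commute)
qed

lemma cutoff_Suc: "cutoff M (Suc m) = cutoff M m * ((real M - real m) / (real M + real m + 1))"
proof (cases "m \<le> M")
  case True
  have "Suc (M + m) * (2 * M choose Suc (M + m)) = (2 * M - (M + m)) * (2 * M choose (M + m))"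
    by (simp only: binomial_absorption binomial_absorb_comp)
  then have "real (Suc (M + m)) * real (2 * M choose Suc (M + m)) =
      real (M - m) * real (2 * M choose (M + m))"
    by (metis of_nat_mult diff_add_inverse diff_diff_left mult_2)
  then have "real (2 * M choose (M + Suc m)) =
      real (2 * M choose (M + m)) * ((real M - real m) / (real M + real m + 1))"
    using True by (simp add: field_simps of_nat_diff)
  then show ?thesis by (simp only: cutoff_def times_divide_eq_left)
qed (simp add: cutoff_eq_0)

lemma cutoff_tendsto: "(\<lambda>M. cutoff M m) \<longlonglongrightarrow> 1"
proof (induction m)
  case (Suc m)
  have "(\<lambda>M. (real M - real m) / (real M + real m + 1)) \<longlonglongrightarrow> 1" by real_asymp
  from tendsto_mult[OF Suc this] show ?case by (simp add: cutoff_Suc)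
qed simp

lemma prod_diff_const_eq_fact:
  assumes "1 \<le> m" "m \<le> M"
  shows "(\<Prod>j\<in>{1..M} - {m}. real j - real m) = (-1) ^ (m - 1) * fact (m - 1) * fact (M - m)"
proof -
  have "(\<Prod>j\<in>{1..<m}. real j - real m) = (\<Prod>i\<in>{1..m - 1}. - real i)"
    using assms by (intro prod.reindex_bij_witness[of _ "\<lambda>i. m - i" "\<lambda>i. m - i"])
       (auto simp: of_nat_diff)
  also have "\<dots> = (-1) ^ (m - 1) * fact (m - 1)"
    by (simp add: prod_uminus fact_prod)
  finally have below: "(\<Prod>j\<in>{1..<m}. real j - real m) = (-1) ^ (m - 1) * fact (m - 1)" .
  have "(\<Prod>j\<in>{m<..M}. real j - real m) = (\<Prod>i\<in>{1..M - m}. real i)"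
    using assms by (intro prod.reindex_bij_witness[of _ "\<lambda>i. i + m" "\<lambda>i. i - m"])
       (auto simp: of_nat_diff)
  then have above: "(\<Prod>j\<in>{m<..M}. real j - real m) = fact (M - m)" by (simp add: fact_prod)
  have "{1..M} - {m} = {1..<m} \<union> {m<..M}" using assms by auto
  moreover have "(\<Prod>j\<in>{1..<m} \<union> {m<..M}. real j - real m) =
      (\<Prod>j\<in>{1..<m}. real j - real m) * (\<Prod>j\<in>{m<..M}. real j - real m)"
    by (rule prod.union_disjoint) auto
  ultimately show ?thesis by (simp only: below above mult.assoc)
qed

lemma prod_add_const_eq_fact: "(\<Prod>j\<in>{1..M}. real j + real m) = fact (M + m) / fact m"
proof (induction M)
  case (Suc M)
  then show ?case by (simp add: add.commute)
qed simp

lemma pf_coeff_rate: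
  assumes "\<kappa> \<noteq> 0" "1 \<le> m" "m \<le> M"
  shows "pf_coeff (rate \<kappa>) {1..M} m = 2 * (-1) ^ Suc m * cutoff M m"
proof -
  let ?I = "{1..M} - {m}"
  have m: "m \<in> {1..M}" "real m \<noteq> 0" "(fact m :: real) = real m * fact (m - 1)"
    using assms by (auto simp: fact_reduce)
  have sign: "(-1 :: real) ^ Suc m = 1 / (-1) ^ (m - 1)"
    using assms by (cases m) (auto simp: divide_simps simp flip: power_add)
  have squares: "(\<Prod>j\<in>?I. real j ^ 2) = (fact M / real m) ^ 2"
    using prod.remove[OF _ m(1), of real] m by (simp add: prod_power_distrib fact_prod field_simps)
  have "fact (M + m) / fact m = 2 * real m * (\<Prod>j\<in>?I. real j + real m)"
    using prod.remove[OF _ m(1), of "\<lambda>j. real j + real m"]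
    by (simp only: prod_add_const_eq_fact[symmetric] finite_atLeastAtMost mult_2)
  then have sums: "(\<Prod>j\<in>?I. real j + real m) = fact (M + m) / (fact m * (2 * real m))"
    using m(2) by (simp add: field_simps)
  have factor: "rate \<kappa> j - rate \<kappa> m = \<kappa> * ((real j - real m) * (real j + real m))" for j
    by (simp add: rate_def power2_eq_square algebra_simps)
  have "pf_coeff (rate \<kappa>) {1..M} m = (\<Prod>j\<in>?I. real j ^ 2 / ((real j - real m) * (real j + real m)))"
    unfolding pf_coeff_def factor using assms(1) by (simp add: rate_def)
  also have "\<dots> = (fact M / real m) ^ 2 /
      ((-1) ^ (m - 1) * fact (m - 1) * fact (M - m) * (fact (M + m) / (fact m * (2 * real m))))"
    by (simp only: prod_dividef prod.distrib squares sums prod_diff_const_eq_fact[OF assms(2,3)])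
  also have "\<dots> = 2 * (-1) ^ Suc m * cutoff M m"
    unfolding cutoff_fact[OF assms(3)] m(3) sign using m(2) by (simp add: field_simps power2_eq_square)
  finally show ?thesis .
qed

lemma pf_coeff_rate_remove:
  assumes "\<kappa> \<noteq> 0" "m \<in> {1..M} - {n}" "n \<in> {1..M}"
  shows "pf_coeff (rate \<kappa>) ({1..M} - {n}) m =
      2 * (-1) ^ Suc m * cutoff M m * (1 - real m ^ 2 / real n ^ 2)"
proof -
  have "{1..M} = insert n ({1..M} - {n})" using assms by auto
  then have "pf_coeff (rate \<kappa>) {1..M} m =
      pf_coeff (rate \<kappa>) ({1..M} - {n}) m * (rate \<kappa> n / (rate \<kappa> n - rate \<kappa> m))"
    using pf_coeff_insert_member[of "{1..M} - {n}" n m "rate \<kappa>"] assms(2) by simp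
  moreover have "rate \<kappa> n / (rate \<kappa> n - rate \<kappa> m) * (1 - real m ^ 2 / real n ^ 2) = 1"
  proof -
    have "rate \<kappa> n \<noteq> rate \<kappa> m" "real n \<noteq> 0" using assms by auto
    then show ?thesis using assms(1) by (simp add: rate_def divide_simps) (simp add: algebra_simps)
  qed
  ultimately show ?thesis
    using pf_coeff_rate[of \<kappa> m M] assms
    by (metis DiffD1 atLeastAtMost_iff mult.assoc mult.right_neutral)
qed

lemma sum_pf_coeff_rate:
  "(\<Sum>m\<in>{1..M}. pf_coeff (rate 1) {1..M} m * x m) = - 2 * (\<Sum>m=1..M. (-1) ^ m * cutoff M m * x m)"
  unfolding sum_distrib_left by (intro sum.cong refl) (simp add: pf_coeff_rate[of 1, simplified])

lemma sum_alternating_cutoff: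
  assumes "M \<ge> 1"
  shows "(\<Sum>m\<le>M. (-1) ^ m * cutoff M m) = 1 / 2"
proof -
  have "(\<Sum>m\<in>{1..M}. pf_coeff (rate 1) {1..M} m * (rate 1 m / (rate 1 m + 0))) =
      (\<Prod>m\<in>{1..M}. rate 1 m / (rate 1 m + 0))"
    using assms by (intro partial_fractions inj_on_rate) (auto simp: rate_def)
  also have "\<dots> = 1" by (intro prod.neutral) (auto simp: rate_def)
  also have "(\<Sum>m\<in>{1..M}. pf_coeff (rate 1) {1..M} m * (rate 1 m / (rate 1 m + 0)))
      = (\<Sum>m\<in>{1..M}. pf_coeff (rate 1) {1..M} m * 1)"
    by (intro sum.cong) (auto simp: rate_def)
  finally have "(\<Sum>m=1..M. (-1) ^ m * cutoff M m) = - 1 / 2"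
    using sum_pf_coeff_rate[of M "\<lambda>_. 1"] by simp
  then show ?thesis by (simp add: atMost_atLeast0 sum.atLeast_Suc_atMost)
qed

lemma sum_alternating_cutoff_squares:
  assumes "M \<ge> 2"
  shows "(\<Sum>m\<le>M. (-1) ^ m * cutoff M m * real m ^ 2) = 0"
proof -
  have "hypoexp_density (rate 1) {1..M} 0 = 0"
    using assms by (intro hypoexp_density_0 inj_on_rate) (auto simp: rate_def)
  then have "(\<Sum>m=1..M. (-1) ^ m * cutoff M m * real m ^ 2) = 0"
    using sum_pf_coeff_rate[of M "\<lambda>m. real m ^ 2"] by (simp add: hypoexp_density_def rate_def)
  then show ?thesis by (simp add: atMost_atLeast0 sum.atLeast_Suc_atMost)
qed

lemma cutoff_weighted_suminf_tendsto:
  assumes "summable (\<lambda>m. \<bar>a m\<bar>)"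
  shows "(\<lambda>M. \<Sum>m\<le>M. cutoff M m * a m) \<longlonglongrightarrow> (\<Sum>m. a m)"
proof -
  have "(\<lambda>M. \<Sum>m. cutoff M m * a m) \<longlonglongrightarrow> (\<Sum>m. 1 * a m)"
  proof (rule tendsto_suminf_dominated)
    show "eventually (\<lambda>M. \<forall>m. \<bar>cutoff M m * a m\<bar> \<le> \<bar>a m\<bar>) sequentially"
      using cutoff_bounds by (intro always_eventually allI) (auto simp: abs_mult mult_left_le_one_le)
    show "(\<lambda>M. cutoff M m * a m) \<longlonglongrightarrow> 1 * a m" for m
      by (rule tendsto_mult[OF cutoff_tendsto tendsto_const])
  qed (use assms in auto)
  moreover have "(\<Sum>m. cutoff M m * a m) = (\<Sum>m\<le>M. cutoff M m * a m)" for M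
    by (rule suminf_finite) (auto simp: cutoff_eq_0)
  ultimately show ?thesis by simp
qed

subsection \<open>The law of the soft modes other than the observed one\<close>

locale energy_scale =
  fixes \<kappa> :: real
  assumes \<kappa>: "\<kappa> > 0"

locale soft_modes = energy_scale +
  fixes n :: nat
  assumes n: "n \<ge> 1"
begin

definition soft_weight :: "nat \<Rightarrow> real" where
  "soft_weight m = 2 * (-1) ^ Suc m * (1 - real m ^ 2 / real n ^ 2) * rate \<kappa> m"

lemma soft_weight_eq_0: "m = 0 \<or> m = n \<Longrightarrow> soft_weight m = 0"
  using n by (auto simp: soft_weight_def rate_def)

text \<open>The series diverges at \<open>y = 0\<close>, where the limit of the finite densities is 0.\<close>

definition soft_density :: "real \<Rightarrow> real" where
  "soft_density y = (if y \<le> 0 then 0 else \<Sum>m. soft_weight m * exp (- rate \<kappa> m * y))"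

definition soft_density_upto :: "nat \<Rightarrow> real \<Rightarrow> real" where
  "soft_density_upto M = hypoexp_density (rate \<kappa>) ({1..M} - {n})"

lemma soft_density_upto_eq:
  assumes "n \<le> M"
  shows "soft_density_upto M y = (\<Sum>m\<le>M. cutoff M m * (soft_weight m * exp (- rate \<kappa> m * y)))"
proof -
  have "(\<Sum>m\<le>M. cutoff M m * (soft_weight m * exp (- rate \<kappa> m * y)))
      = (\<Sum>m\<in>{1..M} - {n}. cutoff M m * (soft_weight m * exp (- rate \<kappa> m * y)))"
    by (intro sum.mono_neutral_right) (auto simp: soft_weight_eq_0 Suc_le_eq)
  also have "\<dots> = soft_density_upto M y"
    unfolding soft_density_upto_def hypoexp_density_def
    using assms \<kappa> n by (intro sum.cong refl, subst pf_coeff_rate_remove) (auto simp: soft_weight_def)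
  finally show ?thesis ..
qed

lemma summable_soft_weight_exp:
  assumes "y > 0"
  shows "summable (\<lambda>m. \<bar>soft_weight m * exp (- rate \<kappa> m * y)\<bar>)"
proof -
  define c where "c = \<kappa> * y"
  define d where "d = real n ^ 2"
  have pos: "c > 0" "d > 0" using assms \<kappa> n by (simp_all add: c_def d_def)
  have "(\<lambda>m. 2 * \<bar>1 - real m ^ 2 / d\<bar> * (\<kappa> * real m ^ 2) * exp (- c * real m ^ 2))
      \<in> O(\<lambda>m. 1 / real m ^ 2)"
    using pos \<kappa> by real_asymp
  then have "summable (\<lambda>m. 2 * \<bar>1 - real m ^ 2 / d\<bar> * (\<kappa> * real m ^ 2) * exp (- c * real m ^ 2))"
    by (rule summable_comparison_test_bigo[rotated]) (use summable_inverse_squares_real in simp)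
  then show ?thesis
    using \<kappa> by (simp add: soft_weight_def rate_def abs_mult c_def d_def power_abs mult_ac)
qed

lemma soft_density_upto_tendsto:
  assumes "y \<ge> 0"
  shows "(\<lambda>M. soft_density_upto M y) \<longlonglongrightarrow> soft_density y"
proof (cases "y = 0")
  case True
  have "soft_density_upto M y = 0" if "M \<ge> 3" for M
    unfolding soft_density_upto_def True
  proof (rule hypoexp_density_0)
    have "card {1..M} - card {n} \<le> card ({1..M} - {n})" by (rule diff_card_le_card_Diff) auto
    then show "2 \<le> card ({1..M} - {n})" using that by simp
  qed (use \<kappa> in \<open>auto simp: rate_def intro: inj_on_rate\<close>)
  then have "eventually (\<lambda>M. soft_density_upto M y = 0) sequentially"
    by (auto simp: eventually_at_top_linorder)
  then show ?thesis using True by (auto simp: soft_density_def intro: tendsto_eventually)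
next
  case False
  then have y: "y > 0" using assms by simp
  have "eventually (\<lambda>M. (\<Sum>m\<le>M. cutoff M m * (soft_weight m * exp (- rate \<kappa> m * y))) =
      soft_density_upto M y) sequentially"
    using eventually_ge_at_top[of n] by eventually_elim (simp add: soft_density_upto_eq)
  with cutoff_weighted_suminf_tendsto[OF summable_soft_weight_exp[OF y]]
  have "(\<lambda>M. soft_density_upto M y) \<longlonglongrightarrow> (\<Sum>m. soft_weight m * exp (- rate \<kappa> m * y))"
    by (rule Lim_transform_eventually)
  then show ?thesis using y by (simp add: soft_density_def)
qed

text \<open>One of the first two modes is not the observed one, and its rate bounds the density.\<close>

lemma soft_density_upto_bounds:
  assumes "M \<ge> 2" "y \<ge> 0"
  shows "0 \<le> soft_density_upto M y" "soft_density_upto M y \<le> 4 * \<kappa>"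
proof -
  define l where "l = (if n = 1 then 2 else 1 :: nat)"
  define J where "J = {1..M} - {n} - {l}"
  have I: "{1..M} - {n} = insert l J" using assms by (auto simp: J_def l_def)
  have "0 \<le> hypoexp_density (rate \<kappa>) (insert l J) y \<and>
      hypoexp_density (rate \<kappa>) (insert l J) y \<le> rate \<kappa> l"
    using assms \<kappa> by (intro hypoexp_density_bounds inj_on_rate rate_pos) (auto simp: J_def l_def)
  moreover have "rate \<kappa> l \<le> 4 * \<kappa>" using \<kappa> by (auto simp: l_def rate_def)
  ultimately show "0 \<le> soft_density_upto M y" "soft_density_upto M y \<le> 4 * \<kappa>"
    unfolding soft_density_upto_def I by linarith+
qed

lemma soft_density_nonneg: "0 \<le> soft_density y"
proof (cases "y \<le> 0")
  case False
  show ?thesis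
  proof (rule tendsto_lowerbound[OF soft_density_upto_tendsto])
    show "eventually (\<lambda>M. 0 \<le> soft_density_upto M y) sequentially"
      using eventually_ge_at_top[of 2] by eventually_elim (use soft_density_upto_bounds False in auto)
  qed (use False in auto)
qed (simp add: soft_density_def)

lemma soft_density_measurable [measurable]: "soft_density \<in> borel_measurable borel"
  unfolding soft_density_def[abs_def] by measurable

lemma has_integral_soft_density_limit:
  assumes S: "S \<subseteq> {0..}" and g: "g integrable_on S" "\<And>y. y \<in> S \<Longrightarrow> g y \<ge> 0"
    and I: "\<And>M. M \<ge> n + 2 \<Longrightarrow> ((\<lambda>y. g y * soft_density_upto M y) has_integral I M) S"
    and L: "I \<longlonglongrightarrow> L"
  shows "((\<lambda>y. g y * soft_density y) has_integral L) S"
proof -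
  let ?f = "\<lambda>k y. g y * soft_density_upto (k + (n + 2)) y"
  show ?thesis
  proof (rule has_integral_dominated_convergence)
    show "(?f k has_integral I (k + (n + 2))) S" for k
      by (rule I) simp
    show "(\<lambda>y. g y * (4 * \<kappa>)) integrable_on S"
      using g(1) by (rule integrable_on_mult_left)
    show "\<forall>y\<in>S. norm (?f k y) \<le> g y * (4 * \<kappa>)" for k
      using soft_density_upto_bounds[of "k + (n + 2)"] S g(2)
      by (auto simp: abs_mult intro!: mult_left_mono)
    show "\<forall>y\<in>S. (\<lambda>k. ?f k y) \<longlonglongrightarrow> g y * soft_density y"
      using S by (intro ballI tendsto_mult tendsto_const LIMSEQ_ignore_initial_segment
          soft_density_upto_tendsto) auto
    show "(\<lambda>k. I (k + (n + 2))) \<longlonglongrightarrow> L"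
      using L by (rule LIMSEQ_ignore_initial_segment)
  qed
qed

definition soft_exponent_term :: "real \<Rightarrow> nat \<Rightarrow> real" where
  "soft_exponent_term s m = (if m = 0 \<or> m = n then 0 else ln (1 + s / rate \<kappa> m))"

definition soft_exponent :: "real \<Rightarrow> real" where
  "soft_exponent s = (\<Sum>m. soft_exponent_term s m)"

lemma soft_exponent_term_bounds:
  assumes "s \<ge> 0"
  shows "0 \<le> soft_exponent_term s m" "soft_exponent_term s m \<le> s / \<kappa> * (1 / real m ^ 2)"
proof -
  have "0 \<le> s / rate \<kappa> m" using assms \<kappa> by (simp add: rate_def)
  then show "0 \<le> soft_exponent_term s m" "soft_exponent_term s m \<le> s / \<kappa> * (1 / real m ^ 2)"
    using assms \<kappa> ln_add_one_self_le_self[of "s / rate \<kappa> m"]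
    by (auto simp: soft_exponent_term_def rate_def)
qed

lemma exp_soft_exponent_term:
  assumes "m \<ge> 1" "m \<noteq> n" "s \<ge> 0"
  shows "exp (- soft_exponent_term s m) = rate \<kappa> m / (rate \<kappa> m + s)"
proof -
  have pos: "rate \<kappa> m > 0" using \<kappa> assms(1) by (rule rate_pos)
  then have "1 + s / rate \<kappa> m = (rate \<kappa> m + s) / rate \<kappa> m" by (simp add: add_divide_distrib)
  then show ?thesis using assms pos by (simp add: soft_exponent_term_def exp_minus)
qed

lemma summable_soft_exponent_term: "s \<ge> 0 \<Longrightarrow> summable (soft_exponent_term s)"
  by (rule summable_comparison_test[OF _ summable_mult[OF summable_inverse_squares_real, of "s / \<kappa>"]])
     (use soft_exponent_term_bounds in auto)

lemma soft_exponent_0 [simp]: "soft_exponent 0 = 0"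
proof -
  have "soft_exponent_term 0 = (\<lambda>m. 0)" by (auto simp: soft_exponent_term_def)
  then show ?thesis by (simp add: soft_exponent_def)
qed

lemma soft_exponent_tendsto_0: "(soft_exponent \<longlongrightarrow> 0) (at_right 0)"
proof (rule tendsto_sandwich)
  have eventually_pos: "eventually (\<lambda>s::real. s > 0) (at_right 0)"
    by (simp add: eventually_at_right_less)
  show "eventually (\<lambda>s. 0 \<le> soft_exponent s) (at_right 0)"
    using eventually_pos unfolding soft_exponent_def
    by eventually_elim (intro suminf_nonneg summable_soft_exponent_term soft_exponent_term_bounds; simp)
  show "eventually (\<lambda>s. soft_exponent s \<le> s / \<kappa> * (\<Sum>m. 1 / real m ^ 2)) (at_right 0)"
    using eventually_pos unfolding soft_exponent_def
    by eventually_elim (subst suminf_mult[symmetric, OF summable_inverse_squares_real],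
        intro suminf_le summable_soft_exponent_term soft_exponent_term_bounds
          summable_mult summable_inverse_squares_real; simp)
  have "((\<lambda>s. s / \<kappa> * (\<Sum>m. 1 / real m ^ 2)) \<longlongrightarrow> 0 / \<kappa> * (\<Sum>m. 1 / real m ^ 2)) (at_right 0)"
    using \<kappa> by (intro tendsto_intros) auto
  then show "((\<lambda>s. s / \<kappa> * (\<Sum>m. 1 / real m ^ 2)) \<longlongrightarrow> 0) (at_right 0)" by simp
qed auto

lemma soft_exponent_sublinear: "((\<lambda>s. soft_exponent s / s) \<longlongrightarrow> 0) at_top"
proof -
  have "((\<lambda>s. \<Sum>m. soft_exponent_term s m / s) \<longlongrightarrow> (\<Sum>m. 0)) at_top"
  proof (rule tendsto_suminf_dominated)
    fix m
    have "((\<lambda>s. ln (1 + s / c) / s) \<longlongrightarrow> 0) at_top" if "c > 0" for c :: real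
      using that by real_asymp
    then show "((\<lambda>s. soft_exponent_term s m / s) \<longlongrightarrow> 0) at_top"
      using rate_pos[OF \<kappa>, of m] by (cases "m = 0 \<or> m = n") (auto simp: soft_exponent_term_def)
  next
    show "\<forall>\<^sub>F s in at_top. \<forall>m. \<bar>soft_exponent_term s m / s\<bar> \<le> 1 / \<kappa> * (1 / real m ^ 2)"
      using eventually_gt_at_top[of 0]
    proof eventually_elim
      case (elim s)
      then show ?case using soft_exponent_term_bounds[of s] by (auto simp: field_simps)
    qed
    show "summable (\<lambda>m. 1 / \<kappa> * (1 / real m ^ 2))"
      by (rule summable_mult[OF summable_inverse_squares_real])
  qed auto
  moreover have "eventually (\<lambda>s. (\<Sum>m. soft_exponent_term s m / s) = soft_exponent s / s) at_top"
    using eventually_gt_at_top[of 0]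
    by eventually_elim (simp add: soft_exponent_def suminf_divide summable_soft_exponent_term)
  ultimately show ?thesis by (simp add: Lim_transform_eventually)
qed

lemma has_integral_exp_soft_density:
  assumes s: "s > 0"
  shows "((\<lambda>y. exp (- s * y) * soft_density y) has_integral exp (- soft_exponent s)) {0..}"
proof (rule has_integral_soft_density_limit)
  show "(\<lambda>y. exp (- s * y)) integrable_on {0..}"
    using has_integral_exp_minus_to_infinity[OF s, of 0] by (auto simp: integrable_on_def)
  show "((\<lambda>y. exp (- s * y) * soft_density_upto M y)
      has_integral exp (- (\<Sum>m\<le>M. soft_exponent_term s m))) {0..}"
    if "M \<ge> n + 2" for M
  proof -
    have "M \<in> {1..M} - {n}" using that by auto
    then have "((\<lambda>y. exp (- s * y) * soft_density_upto M y) has_integral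
        (\<Prod>m\<in>{1..M} - {n}. rate \<kappa> m / (rate \<kappa> m + s))) {0..}"
      unfolding soft_density_upto_def
      using \<kappa> s by (intro hypoexp_density_laplace inj_on_rate rate_pos) auto
    also have "(\<Prod>m\<in>{1..M} - {n}. rate \<kappa> m / (rate \<kappa> m + s)) =
        (\<Prod>m\<in>{1..M} - {n}. exp (- soft_exponent_term s m))"
      using s by (intro prod.cong) (auto simp: exp_soft_exponent_term)
    also have "\<dots> = exp (- (\<Sum>m\<in>{1..M} - {n}. soft_exponent_term s m))"
      by (simp add: exp_sum flip: sum_negf)
    also have "(\<Sum>m\<in>{1..M} - {n}. soft_exponent_term s m) = (\<Sum>m\<le>M. soft_exponent_term s m)"
      by (intro sum.mono_neutral_left) (auto simp: soft_exponent_term_def)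
    finally show ?thesis .
  qed
  show "(\<lambda>M. exp (- (\<Sum>m\<le>M. soft_exponent_term s m))) \<longlonglongrightarrow> exp (- soft_exponent s)"
    unfolding soft_exponent_def using s
    by (intro tendsto_intros summable_LIMSEQ' summable_soft_exponent_term) auto
qed auto

lemma has_integral_soft_density: "(soft_density has_integral 1) {0..}"
proof (rule has_integral_monotone_convergence_increasing)
  let ?f = "\<lambda>k y. exp (- (1 / real (Suc k)) * y) * soft_density y"
  show "(?f k has_integral exp (- soft_exponent (1 / real (Suc k)))) {0..}" for k
    by (rule has_integral_exp_soft_density) simp
  show "?f k y \<le> ?f (Suc k) y" if "y \<in> {0..}" for k y
  proof -
    have "1 / real (Suc (Suc k)) * y \<le> 1 / real (Suc k) * y"
      using that by (intro mult_right_mono divide_left_mono) auto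
    then show ?thesis by (intro mult_right_mono soft_density_nonneg) auto
  qed
  show "(\<lambda>k. ?f k y) \<longlonglongrightarrow> soft_density y" for y
  proof -
    have "(\<lambda>k. exp (- (1 / real (Suc k)) * y)) \<longlonglongrightarrow> 1" by real_asymp
    from tendsto_mult[OF this tendsto_const] show ?thesis by simp
  qed
  have "filterlim (\<lambda>k. 1 / real (Suc k)) (at_right 0) sequentially" by real_asymp
  from filterlim_compose[OF soft_exponent_tendsto_0 this]
  have "(\<lambda>k. exp (- soft_exponent (1 / real (Suc k)))) \<longlonglongrightarrow> exp (- 0)"
    by (intro tendsto_exp tendsto_minus)
  then show "(\<lambda>k. exp (- soft_exponent (1 / real (Suc k)))) \<longlonglongrightarrow> 1" by simp
qed

definition soft_law :: "real measure" where
  "soft_law = density lborel (\<lambda>y. ennreal (soft_density y))"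

lemma sets_soft_law [simp, measurable_cong]: "sets soft_law = sets borel"
  by (simp add: soft_law_def)

lemma AE_soft_law_pos: "AE y in soft_law. y > 0"
  unfolding soft_law_def by (subst AE_density) (auto simp: soft_density_def)

lemma has_bochner_integral_soft_law:
  assumes [measurable]: "g \<in> borel_measurable borel" "S \<in> sets borel"
    and "\<And>y. y \<in> S \<Longrightarrow> 0 \<le> g y" "((\<lambda>y. g y * soft_density y) has_integral I) S"
  shows "has_bochner_integral soft_law (\<lambda>y. indicator S y * g y) I"
  unfolding soft_law_def using assms(3,4)
  by (intro has_bochner_integral_density_lborel soft_density_nonneg) auto

lemma soft_law_laplace:
  assumes "s \<ge> 0"
  shows "has_bochner_integral soft_law (\<lambda>y. exp (- s * y)) (exp (- soft_exponent s))"
proof -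
  have "((\<lambda>y. exp (- s * y) * soft_density y) has_integral exp (- soft_exponent s)) {0..}"
  proof (cases "s = 0")
    case True
    then show ?thesis using has_integral_soft_density by simp
  qed (use has_integral_exp_soft_density assms in simp)
  then have "has_bochner_integral soft_law
      (\<lambda>y. indicator {0..} y * exp (- s * y)) (exp (- soft_exponent s))"
    by (intro has_bochner_integral_soft_law) auto
  moreover have "AE y in soft_law. indicator {0..} y * exp (- s * y) = exp (- s * y)"
    using AE_soft_law_pos by eventually_elim auto
  ultimately show ?thesis
    by (subst (asm) has_bochner_integral_cong_AE) auto
qed

lemma prob_space_soft_law: "prob_space soft_law"
proof
  have "has_bochner_integral soft_law (\<lambda>y. 1 :: real) 1" using soft_law_laplace[of 0] by simp
  then have "(\<integral>\<^sup>+y. ennreal 1 \<partial>soft_law) = ennreal 1"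
    by (subst nn_integral_eq_integral) (auto simp: has_bochner_integral_iff)
  then show "emeasure soft_law (space soft_law) = 1" by simp
qed

sublocale soft_law: prob_space soft_law
  by (rule prob_space_soft_law)

text \<open>If \<open>[0, r]\<close> had no mass, the Laplace transform would be at most \<open>exp (- s r)\<close>; but its logarithm
  is \<open>o(s)\<close>.\<close>

lemma soft_law_atMost_pos:
  assumes r: "r > 0"
  shows "measure soft_law {..r} > 0"
proof (rule ccontr)
  assume "\<not> measure soft_law {..r} > 0"
  then have "soft_law.prob {..r} = 0" using measure_nonneg[of soft_law "{..r}"] by linarith
  then have large: "AE y in soft_law. y > r"
    by (intro AE_I'[of "{..r}"]) (auto simp: null_sets_def soft_law.emeasure_eq_measure)
  have "r \<le> soft_exponent s / s" if s: "s > 0" for s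
  proof -
    note laplace = soft_law_laplace[OF less_imp_le[OF s], unfolded has_bochner_integral_iff]
    have "exp (- soft_exponent s) = (\<integral>y. exp (- s * y) \<partial>soft_law)" using laplace by simp
    also have "\<dots> \<le> (\<integral>y. exp (- s * r) \<partial>soft_law)"
      using laplace large s by (intro integral_mono_AE) auto
    finally have "exp (- soft_exponent s) \<le> exp (- s * r)"
      by (simp add: soft_law.prob_space[simplified])
    then show ?thesis using s by (simp add: pos_le_divide_eq mult.commute)
  qed
  then have "eventually (\<lambda>s. r \<le> soft_exponent s / s) at_top"
    using eventually_gt_at_top[of 0] by (rule eventually_mono[rotated])
  from tendsto_lowerbound[OF soft_exponent_sublinear this] show False using r by simp
qed

end

subsection \<open>Abel summation\<close>

lemma eventually_at_left_1: "eventually (\<lambda>t::real. 0 < t \<and> t < 1) (at_left 1)"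
  by (rule eventually_at_leftI[of 0]) auto

lemma abel_sumsI:
  assumes "\<And>t. 0 < t \<Longrightarrow> t < 1 \<Longrightarrow> (\<lambda>m. a m * t ^ m) sums F t" "(F \<longlongrightarrow> s) (at_left 1)"
  shows "abel_sums a s"
proof -
  have "eventually (\<lambda>t. F t = (\<Sum>m. a m * t ^ m)) (at_left 1)"
    using eventually_at_left_1 by eventually_elim (simp add: sums_unique[OF assms(1)])
  with assms(2) have "((\<lambda>t. \<Sum>m. a m * t ^ m) \<longlongrightarrow> s) (at_left 1)"
    by (rule Lim_transform_eventually)
  then show ?thesis using sums_summable[OF assms(1)] by (auto simp: abel_sums_def)
qed

lemma abel_sums_add:
  assumes "abel_sums a s" "abel_sums b t"
  shows "abel_sums (\<lambda>m. a m + b m) (s + t)"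
  using assms unfolding abel_sums_def
  by (intro abel_sumsI[where F = "\<lambda>x. (\<Sum>m. a m * x ^ m) + (\<Sum>m. b m * x ^ m)", unfolded abel_sums_def])
     (auto simp: distrib_right intro!: sums_add summable_sums tendsto_add)

lemma abel_sums_cmult:
  assumes "abel_sums a s"
  shows "abel_sums (\<lambda>m. c * a m) (c * s)"
  using assms unfolding abel_sums_def
  by (intro abel_sumsI[where F = "\<lambda>x. c * (\<Sum>m. a m * x ^ m)", unfolded abel_sums_def])
     (auto simp: mult.assoc intro!: sums_mult summable_sums tendsto_mult_left)

lemma abel_sums_absolutely_summable:
  assumes "summable (\<lambda>m. \<bar>a m\<bar>)"
  shows "abel_sums a (\<Sum>m. a m)"
proof (rule abel_sumsI)
  show "(\<lambda>m. a m * t ^ m) sums (\<Sum>m. a m * t ^ m)" if "0 < t" "t < 1" for t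
  proof (rule summable_sums, rule summable_comparison_test[OF _ assms], intro exI[of _ 0] allI impI)
    show "norm (a m * t ^ m) \<le> \<bar>a m\<bar>" for m
      using that by (simp add: abs_mult power_abs mult_left_le power_le_one)
  qed
  have "\<forall>\<^sub>F t in at_left 1. \<forall>m. \<bar>a m * t ^ m\<bar> \<le> \<bar>a m\<bar>"
    using eventually_at_left_1
    by eventually_elim (auto simp: abs_mult power_abs mult_left_le power_le_one)
  then have "((\<lambda>t. \<Sum>m. a m * t ^ m) \<longlongrightarrow> (\<Sum>m. a m * 1 ^ m)) (at_left 1)"
    using assms by (intro tendsto_suminf_dominated tendsto_intros) auto
  then show "((\<lambda>t. \<Sum>m. a m * t ^ m) \<longlongrightarrow> (\<Sum>m. a m)) (at_left 1)" by simp
qed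

lemma abel_sums_alternating: "abel_sums (\<lambda>m. (-1) ^ m) (1 / 2)"
proof (rule abel_sumsI)
  show "(\<lambda>m. (-1) ^ m * t ^ m) sums (1 / (1 + t))" if "0 < t" "t < 1" for t :: real
    using geometric_sums[of "- t"] that by (simp flip: power_mult_distrib)
  have "((\<lambda>t::real. 1 / (1 + t)) \<longlongrightarrow> 1 / (1 + 1)) (at_left 1)"
    by (intro tendsto_intros) auto
  then show "((\<lambda>t::real. 1 / (1 + t)) \<longlongrightarrow> 1 / 2) (at_left 1)" by simp
qed

lemma alternating_squares_eq_gbinomial:
  "(-1) ^ m * real m ^ 2 = 2 * (- 3 gchoose m) - 3 * (- 2 gchoose m) + (- 1 gchoose m :: real)"
proof -
  have two: "(real m + 1 gchoose m) = real m + 1"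
    using binomial_gbinomial[of "Suc m" m, where ?'a = real] by (simp add: add.commute)
  have "2 * (m + 2 choose m) = (m + 2) * (m + 1)"
    using binomial_symmetric[of m "m + 2"] by (simp add: choose_two)
  from arg_cong[OF this, of real]
  have "2 * real (m + 2 choose m) = (real m + 2) * (real m + 1)"
    by (simp only: of_nat_mult of_nat_add of_nat_numeral of_nat_1)
  then have three: "2 * (real m + 2 gchoose m) = (real m + 2) * (real m + 1)"
    using binomial_gbinomial[of "m + 2" m, where ?'a = real] by (simp add: add.commute)
  have "2 * (- 3 gchoose m) - 3 * (- 2 gchoose m) + (- 1 gchoose m) =
      (-1) ^ m * (2 * (real m + 2 gchoose m) - 3 * (real m + 1 gchoose m) + (real m gchoose m))"
    using gbinomial_minus[of "3 :: real" m] gbinomial_minus[of "2 :: real" m]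
      gbinomial_minus[of "1 :: real" m]
    by (simp add: algebra_simps)
  also have "\<dots> = (-1) ^ m * ((real m + 2) * (real m + 1) - 3 * (real m + 1) + 1)"
    unfolding two three using binomial_gbinomial[of m m, where ?'a = real] by simp
  finally show ?thesis by (simp add: power2_eq_square algebra_simps)
qed

lemma abel_sums_alternating_squares: "abel_sums (\<lambda>m. (-1) ^ m * real m ^ 2) 0"
proof (rule abel_sumsI)
  let ?F = "\<lambda>t::real. 2 * (1 + t) powr (- 3) - 3 * (1 + t) powr (- 2) + (1 + t) powr (- 1)"
  show "(\<lambda>m. (-1) ^ m * real m ^ 2 * t ^ m) sums ?F t" if "0 < t" "t < 1" for t
  proof -
    have "(\<lambda>m. 2 * ((- 3 gchoose m) * t ^ m) - 3 * ((- 2 gchoose m) * t ^ m) + (- 1 gchoose m) * t ^ m)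
        sums ?F t"
      using that by (intro sums_add sums_diff sums_mult gen_binomial_real) auto
    then show ?thesis unfolding alternating_squares_eq_gbinomial by (simp add: algebra_simps)
  qed
  have "(?F \<longlongrightarrow> ?F 1) (at_left 1)" by (intro tendsto_intros) auto
  then show "(?F \<longlongrightarrow> 0) (at_left 1)" by (simp add: powr_minus_divide)
qed

subsection \<open>Exponential integrals of the soft density as Abel sums\<close>

context soft_modes
begin

definition rate_gap :: "nat \<Rightarrow> real" where
  "rate_gap m = rate \<kappa> m - rate \<kappa> n"

definition soft_term :: "real \<Rightarrow> real \<Rightarrow> nat \<Rightarrow> real" where
  "soft_term lam r m = soft_weight m * exp (- rate \<kappa> n * r) *
     ((exp (- lam * r) - exp (- rate_gap m * r)) / (rate_gap m - lam))"

lemma soft_weight_eq_rate_gap: "soft_weight m = 2 / real n ^ 2 * ((-1) ^ m * (real m ^ 2 * rate_gap m))"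
  using n by (simp add: soft_weight_def rate_gap_def rate_def field_simps)

lemma has_integral_soft_term:
  assumes "r \<ge> 0" "rate_gap m \<noteq> lam"
  shows "((\<lambda>y. soft_weight m * (exp (- (lam + rate \<kappa> n) * (r - y)) * exp (- rate \<kappa> m * y))) has_integral
    soft_term lam r m) {0..r}"
proof -
  define d where "d = rate_gap m - lam"
  have d: "d \<noteq> 0" "rate \<kappa> m = d + lam + rate \<kappa> n" using assms(2) by (simp_all add: d_def rate_gap_def)
  let ?f = "\<lambda>y. exp (- (lam + rate \<kappa> n) * (r - y)) * exp (- rate \<kappa> m * y)"
  let ?G = "\<lambda>y. - ?f y / d"
  have "(?f has_integral (?G r - ?G 0)) {0..r}"
  proof (rule fundamental_theorem_of_calculus[OF assms(1)])
    fix y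
    have "(?G has_real_derivative ?f y) (at y within {0..r})"
      using d by (auto intro!: derivative_eq_intros simp: field_simps)
    then show "(?G has_vector_derivative ?f y) (at y within {0..r})"
      by (simp add: has_real_derivative_iff_has_vector_derivative)
  qed
  also have "?G r - ?G 0 = exp (- rate \<kappa> n * r) * ((exp (- lam * r) - exp (- rate_gap m * r)) / d)"
    using d(1) by (simp add: rate_gap_def divide_simps) (simp add: algebra_simps flip: exp_add)
  finally show ?thesis
    unfolding soft_term_def d_def mult.assoc by (rule has_integral_mult_right)
qed

lemma soft_term_expansion:
  assumes "rate_gap m \<noteq> lam"
  shows "soft_term lam r m = 2 * exp (- rate \<kappa> n * r) / real n ^ 2 * (-1) ^ m *
    (exp (- lam * r) * (real m ^ 2 + lam / \<kappa> + lam * (lam + rate \<kappa> n) / \<kappa> / (rate_gap m - lam))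
     - real m ^ 2 * rate_gap m / (rate_gap m - lam) * exp (- rate_gap m * r))"
proof -
  define d where "d = rate_gap m - lam"
  have d: "d \<noteq> 0" "real m ^ 2 = (d + lam + rate \<kappa> n) / \<kappa>" "rate_gap m = d + lam"
    using assms \<kappa> by (simp_all add: d_def rate_gap_def rate_def)
  have quotient: "real m ^ 2 + lam / \<kappa> + lam * (lam + rate \<kappa> n) / \<kappa> / d = real m ^ 2 * (d + lam) / d"
    unfolding d(2) using d(1) \<kappa> by (simp add: field_simps)
  then show ?thesis
    unfolding soft_term_def soft_weight_eq_rate_gap d_def[symmetric] unfolding quotient unfolding d(3)
    by (simp add: algebra_simps diff_divide_distrib add_divide_distrib)
qed

lemma rate_gap_quotient_bigo:
  shows "(\<lambda>m. 1 / (rate_gap m - lam)) \<in> O(\<lambda>m. 1 / real m ^ 2)"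
    and "r > 0 \<Longrightarrow> (\<lambda>m. real m ^ 2 * rate_gap m / (rate_gap m - lam) * exp (- rate_gap m * r))
      \<in> O(\<lambda>m. 1 / real m ^ 2)"
  unfolding rate_gap_def rate_def[of \<kappa> m for m] using \<kappa> by real_asymp+

text \<open>Up to an absolutely summable remainder, the terms are a combination of the two divergent series
  to which Abel summation and the cutoff method assign the same values.\<close>

lemma soft_term_remainder_summable:
  assumes r: "r > 0"
  obtains A B where "summable (\<lambda>m. \<bar>soft_term lam r m - (A * ((-1) ^ m * real m ^ 2) + B * (-1) ^ m)\<bar>)"
proof -
  define K where "K = 2 * exp (- rate \<kappa> n * r) / real n ^ 2"
  define A where "A = K * exp (- lam * r)"
  define B where "B = A * lam / \<kappa>"
  define q where "q = lam * (lam + rate \<kappa> n) / \<kappa>"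
  define tail where "tail m = A * q * (1 / (rate_gap m - lam))
    - K * (real m ^ 2 * rate_gap m / (rate_gap m - lam) * exp (- rate_gap m * r))" for m
  have cmult: "(\<lambda>m. c * f m) \<in> O(\<lambda>m. 1 / real m ^ 2)"
    if "f \<in> O(\<lambda>m. 1 / real m ^ 2)" for c :: real and f :: "nat \<Rightarrow> real"
    using that by (cases "c = 0") auto
  have tail: "tail \<in> O(\<lambda>m. 1 / real m ^ 2)"
    unfolding tail_def[abs_def] by (intro sum_in_bigo cmult rate_gap_quotient_bigo r)
  have "eventually (\<lambda>m. rate_gap m > lam) sequentially"
    unfolding rate_gap_def rate_def[of \<kappa> m for m] using \<kappa> by real_asymp
  then have "eventually (\<lambda>m. \<bar>soft_term lam r m - (A * ((-1) ^ m * real m ^ 2) + B * (-1) ^ m)\<bar>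
      = \<bar>tail m\<bar>) sequentially"
  proof eventually_elim
    case (elim m)
    then have "rate_gap m \<noteq> lam" by simp
    note expansion = soft_term_expansion[OF this]
    have "soft_term lam r m - (A * ((-1) ^ m * real m ^ 2) + B * (-1) ^ m) =
        (-1) ^ m * tail m"
      unfolding expansion K_def[symmetric] q_def[symmetric] tail_def B_def A_def
      by (simp add: algebra_simps)
    then show ?case by (simp add: abs_mult)
  qed
  moreover have "summable (\<lambda>m. \<bar>tail m\<bar>)"
    by (rule summable_comparison_test_bigo[where g = "\<lambda>m. 1 / real m ^ 2"])
       (use tail summable_inverse_squares_real in simp_all)
  ultimately have "summable (\<lambda>m. \<bar>soft_term lam r m - (A * ((-1) ^ m * real m ^ 2) + B * (-1) ^ m)\<bar>)"
    using summable_cong by fast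
  then show thesis by (rule that)
qed

lemma soft_term_abel_and_cutoff_sums:
  assumes "r > 0"
  obtains S where "abel_sums (soft_term lam r) S" "(\<lambda>M. \<Sum>m\<le>M. cutoff M m * soft_term lam r m) \<longlonglongrightarrow> S"
proof -
  obtain A B where remainder_summable:
    "summable (\<lambda>m. \<bar>soft_term lam r m - (A * ((-1) ^ m * real m ^ 2) + B * (-1) ^ m)\<bar>)"
    using soft_term_remainder_summable[OF assms] .
  define R where "R m = soft_term lam r m - (A * ((-1) ^ m * real m ^ 2) + B * (-1) ^ m)" for m
  have R: "summable (\<lambda>m. \<bar>R m\<bar>)" using remainder_summable by (simp add: R_def)
  have decomposition: "soft_term lam r = (\<lambda>m. A * ((-1) ^ m * real m ^ 2) + B * (-1) ^ m + R m)"
    by (simp add: R_def)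
  have "abel_sums (soft_term lam r) (A * 0 + B * (1 / 2) + (\<Sum>m. R m))"
    unfolding decomposition by (intro abel_sums_add abel_sums_cmult abel_sums_alternating
        abel_sums_alternating_squares abel_sums_absolutely_summable R)
  moreover have "(\<lambda>M. \<Sum>m\<le>M. cutoff M m * soft_term lam r m) \<longlonglongrightarrow> A * 0 + B * (1 / 2) + (\<Sum>m. R m)"
  proof (rule Lim_transform_eventually)
    show "(\<lambda>M. A * 0 + B * (1 / 2) + (\<Sum>m\<le>M. cutoff M m * R m)) \<longlonglongrightarrow> A * 0 + B * (1 / 2) + (\<Sum>m. R m)"
      by (intro tendsto_add tendsto_const cutoff_weighted_suminf_tendsto R)
    show "eventually (\<lambda>M. A * 0 + B * (1 / 2) + (\<Sum>m\<le>M. cutoff M m * R m) =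
        (\<Sum>m\<le>M. cutoff M m * soft_term lam r m)) sequentially"
      using eventually_ge_at_top[of 2]
    proof eventually_elim
      case (elim M)
      have "(\<Sum>m\<le>M. cutoff M m * soft_term lam r m) =
          A * (\<Sum>m\<le>M. (-1) ^ m * cutoff M m * real m ^ 2) + B * (\<Sum>m\<le>M. (-1) ^ m * cutoff M m)
          + (\<Sum>m\<le>M. cutoff M m * R m)"
        unfolding decomposition sum_distrib_left sum.distrib[symmetric]
        by (intro sum.cong refl) (simp add: algebra_simps)
      then show ?case
        using elim by (simp add: sum_alternating_cutoff sum_alternating_cutoff_squares)
    qed
  qed
  ultimately show thesis by (rule that)
qed

definition truncated_exp :: "real measure \<Rightarrow> real \<Rightarrow> real \<Rightarrow> real" where
  "truncated_exp M c lam = (\<integral>x. indicator {..c} x * exp (- (lam + rate \<kappa> n) * (c - x)) \<partial>M)"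

theorem truncated_exp_soft_law_abel_sums:
  assumes r: "r > 0" and lam: "lam \<ge> 0" and nonresonant: "\<And>m. m \<ge> 1 \<Longrightarrow> m \<noteq> n \<Longrightarrow> rate_gap m \<noteq> lam"
  shows "abel_sums (soft_term lam r) (truncated_exp soft_law r lam)"
proof -
  let ?e = "\<lambda>y. exp (- (lam + rate \<kappa> n) * (r - y))"
  obtain S where S: "abel_sums (soft_term lam r) S" "(\<lambda>M. \<Sum>m\<le>M. cutoff M m * soft_term lam r m) \<longlonglongrightarrow> S"
    using soft_term_abel_and_cutoff_sums[OF r] .
  have "((\<lambda>y. ?e y * soft_density y) has_integral S) {0..r}"
  proof (rule has_integral_soft_density_limit[OF _ _ _ _ S(2)])
    show "?e integrable_on {0..r}"
      by (intro integrable_continuous_interval continuous_intros)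
    fix M assume M: "M \<ge> n + 2"
    have "((\<lambda>y. soft_weight m * (?e y * exp (- rate \<kappa> m * y))) has_integral soft_term lam r m) {0..r}"
      for m
    proof (cases "m = 0 \<or> m = n")
      case True
      then show ?thesis by (simp add: soft_term_def soft_weight_eq_0)
    qed (use has_integral_soft_term nonresonant r in auto)
    then have "((\<lambda>y. \<Sum>m\<le>M. cutoff M m * (soft_weight m * (?e y * exp (- rate \<kappa> m * y)))) has_integral
        (\<Sum>m\<le>M. cutoff M m * soft_term lam r m)) {0..r}"
      by (intro has_integral_sum has_integral_mult_right) auto
    moreover have "?e y * soft_density_upto M y =
        (\<Sum>m\<le>M. cutoff M m * (soft_weight m * (?e y * exp (- rate \<kappa> m * y))))" for y
      using M by (subst soft_density_upto_eq) (auto simp: sum_distrib_left mult_ac)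
    ultimately show "((\<lambda>y. ?e y * soft_density_upto M y)
        has_integral (\<Sum>m\<le>M. cutoff M m * soft_term lam r m)) {0..r}"
      by simp
  qed auto
  then have "has_bochner_integral soft_law (\<lambda>y. indicator {0..r} y * ?e y) S"
    by (intro has_bochner_integral_soft_law) auto
  moreover have "AE y in soft_law. indicator {..r} y * ?e y = indicator {0..r} y * ?e y"
    using AE_soft_law_pos by eventually_elim (simp add: indicator_def)
  then have "truncated_exp soft_law r lam = (\<integral>y. indicator {0..r} y * ?e y \<partial>soft_law)"
    unfolding truncated_exp_def by (rule integral_cong_AE[rotated 2]) auto
  ultimately show ?thesis using S(1) by (simp add: has_bochner_integral_iff)
qed

lemma truncated_exp_integrand_le_1:
  assumes "lam \<ge> 0" "x \<le> c"
  shows "exp (- (lam + rate \<kappa> n) * (c - x)) \<le> 1"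
  using assms rate_pos[OF \<kappa> n] by (simp add: mult_nonpos_nonneg)

lemma truncated_exp_soft_law_pos:
  assumes r: "r > 0" and lam: "lam \<ge> 0"
  shows "truncated_exp soft_law r lam > 0"
proof -
  let ?\<mu> = "lam + rate \<kappa> n"
  have \<mu>: "?\<mu> > 0" using lam rate_pos[OF \<kappa> n] by simp
  have "0 < exp (- ?\<mu> * r) * measure soft_law {..r}"
    using soft_law_atMost_pos[OF r] by simp
  also have "\<dots> = (\<integral>y. indicator {..r} y * exp (- ?\<mu> * r) \<partial>soft_law)"
    by simp
  also have "\<dots> \<le> truncated_exp soft_law r lam"
    unfolding truncated_exp_def
  proof (rule integral_mono_AE)
    show "integrable soft_law (\<lambda>y. indicator {..r} y * exp (- ?\<mu> * (r - y)))"
      by (rule soft_law.integrable_const_bound[where B = 1])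
         (use truncated_exp_integrand_le_1[OF lam] in \<open>auto simp: indicator_def\<close>)
    show "AE y in soft_law. indicator {..r} y * exp (- ?\<mu> * r) \<le>
        indicator {..r} y * exp (- ?\<mu> * (r - y))"
      using AE_soft_law_pos by eventually_elim (use \<mu> in \<open>auto simp: indicator_def mult_left_mono\<close>)
  qed (simp add: soft_law.emeasure_eq_measure)
  finally show ?thesis .
qed

end

subsection \<open>The coefficients of the theorem\<close>

lemma eta_eq_rate: "eta \<beta> m n = rate (\<beta> * pi\<^sup>2 / 2) m - rate (\<beta> * pi\<^sup>2 / 2) n"
  by (simp add: eta_def eps1_def rate_def field_simps)

lemma bcoef_factor_eq:
  fixes x y z :: real
  assumes "z \<noteq> 0" "z \<noteq> y" "z \<noteq> x"
  shows "inverse (1 - (x - y) / (z - y)) = (z / (z - x)) / (z / (z - y))"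
proof -
  have "1 - (x - y) / (z - y) = (z - x) / (z - y)" using assms by (simp add: field_simps)
  then show ?thesis using assms by simp
qed

lemma prod_bcoef_factors:
  assumes \<kappa>: "\<kappa> \<noteq> 0" and mn: "m \<in> {1..M}" "n \<in> {1..M}" "m \<noteq> n"
  shows "(\<Prod>j\<le>M. if j = 0 \<or> j = n \<or> j = m then 1
      else inverse (1 - (rate \<kappa> m - rate \<kappa> n) / (rate \<kappa> j - rate \<kappa> n))) =
    (-1) ^ (m + n + 1) * real m ^ 2 / real n ^ 2 * (cutoff M m / cutoff M n)"
proof -
  let ?I = "{1..M} - {n} - {m}"
  let ?f = "\<lambda>j. inverse (1 - (rate \<kappa> m - rate \<kappa> n) / (rate \<kappa> j - rate \<kappa> n))"
  have squares: "real m ^ 2 \<noteq> real n ^ 2" "real m ^ 2 \<noteq> 0" "real n ^ 2 \<noteq> 0"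
    using mn by (auto simp: power2_eq_iff_nonneg)
  have I: "{1..M} - {m} - {n} = ?I" by auto
  have "(\<Prod>j\<le>M. if j = 0 \<or> j = n \<or> j = m then 1 else ?f j) = (\<Prod>j\<in>?I. ?f j)"
    by (intro prod.mono_neutral_cong_right) auto
  also have "\<dots> = (\<Prod>j\<in>?I. (rate \<kappa> j / (rate \<kappa> j - rate \<kappa> m)) / (rate \<kappa> j / (rate \<kappa> j - rate \<kappa> n)))"
    using \<kappa> by (intro prod.cong refl bcoef_factor_eq) (auto simp: rate_def[of \<kappa> j for j])
  also have "\<dots> = pf_coeff (rate \<kappa>) ({1..M} - {n}) m / pf_coeff (rate \<kappa>) ({1..M} - {m}) n"
    unfolding pf_coeff_def prod_dividef I ..
  also have "\<dots> = (2 * (-1) ^ Suc m * cutoff M m * (1 - real m ^ 2 / real n ^ 2)) /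
      (2 * (-1) ^ Suc n * cutoff M n * (1 - real n ^ 2 / real m ^ 2))"
    using \<kappa> mn by (subst (1 2) pf_coeff_rate_remove) auto
  also have "\<dots> = (-1) ^ (m + n) * ((1 - real m ^ 2 / real n ^ 2) / (1 - real n ^ 2 / real m ^ 2)) *
      (cutoff M m / cutoff M n)"
    by (simp add: power_add) (simp add: divide_simps)
  also have "(1 - real m ^ 2 / real n ^ 2) / (1 - real n ^ 2 / real m ^ 2) =
      - (real m ^ 2 / real n ^ 2)"
    using squares by (simp add: divide_simps) (simp add: algebra_simps)
  finally show ?thesis by simp
qed

lemma bcoef_times_eta:
  assumes \<beta>: "\<beta> > 0" and mn: "m \<ge> 1" "n \<ge> 1" "m \<noteq> n"
  shows "bcoef \<beta> m n * eta \<beta> m n = (-1) ^ (m + n + 1) * real m ^ 2 / real n ^ 2"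
proof -
  let ?p = "(-1) ^ (m + n + 1) * real m ^ 2 / real n ^ 2 :: real"
  define f where "f = (\<lambda>m'. if m' = 0 \<or> m' = n \<or> m' = m then 1
    else inverse (1 - eta \<beta> m n / eta \<beta> m' n))"
  have \<kappa>: "\<beta> * pi\<^sup>2 / 2 \<noteq> 0" using \<beta> by simp
  have partial: "prod f {..M} = ?p * (cutoff M m / cutoff M n)" if "M \<ge> max m n" for M
    unfolding f_def eta_eq_rate using prod_bcoef_factors[OF \<kappa>, of m M n] mn that by simp
  have "(\<lambda>M. ?p * (cutoff M m / cutoff M n)) \<longlonglongrightarrow> ?p * (1 / 1)"
    by (intro tendsto_intros cutoff_tendsto) auto
  moreover have "eventually (\<lambda>M. ?p * (cutoff M m / cutoff M n) = prod f {..M}) sequentially"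
    using eventually_ge_at_top[of "max m n"] by eventually_elim (simp add: partial)
  ultimately have "(\<lambda>M. prod f {..M}) \<longlonglongrightarrow> ?p"
    by (auto intro: Lim_transform_eventually)
  then have "f has_prod ?p" using mn by (simp add: has_prod_def raw_has_prod_def)
  then have "prodinf f = ?p" by (rule has_prod_unique[symmetric])
  moreover have "eta \<beta> m n \<noteq> 0" using rate_eq_iff[OF \<kappa>, of m n] mn by (simp add: eta_eq_rate)
  ultimately show ?thesis unfolding bcoef_def f_def[symmetric] by simp
qed

context soft_modes
begin

lemma eta_eq_rate_gap:
  assumes "\<kappa> = \<beta> * pi\<^sup>2 / 2"
  shows "eta \<beta> m n = rate_gap m"
  unfolding eta_eq_rate assms[symmetric] rate_gap_def ..

lemma rate_gap_neq_0: "m \<noteq> n \<Longrightarrow> rate_gap m \<noteq> 0"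
  using \<kappa> by (simp add: rate_gap_def)

definition series_factor :: "real \<Rightarrow> real" where
  "series_factor r = (-1) ^ (n + 1) * exp (rate \<kappa> n * r) / 2"

lemma numerator_series_eq_soft_term:
  assumes \<beta>: "\<beta> > 0" "\<kappa> = \<beta> * pi\<^sup>2 / 2"
  shows "(if m = 0 \<or> m = n then 0 else bcoef \<beta> m n * (eta \<beta> m n)\<^sup>2 / (eta \<beta> m n - lam) *
      (exp (- lam * r) - exp (- eta \<beta> m n * r))) = series_factor r * soft_term lam r m"
proof (cases "m = 0 \<or> m = n")
  case True
  then show ?thesis by (simp add: soft_term_def soft_weight_eq_0)
next
  case False
  define E where "E = (exp (- lam * r) - exp (- rate_gap m * r)) / (rate_gap m - lam)"
  note eta = eta_eq_rate_gap[OF \<beta>(2)]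
  have coeff: "bcoef \<beta> m n * rate_gap m = (-1) ^ (m + n + 1) * real m ^ 2 / real n ^ 2"
    using bcoef_times_eta[OF \<beta>(1), of m n] False n by (simp add: eta)
  have "bcoef \<beta> m n * (rate_gap m)\<^sup>2 / (rate_gap m - lam) * (exp (- lam * r) - exp (- rate_gap m * r)) =
      bcoef \<beta> m n * rate_gap m * (rate_gap m * E)"
    by (simp add: E_def power2_eq_square)
  also have "\<dots> = series_factor r * (soft_weight m * exp (- rate \<kappa> n * r) * E)"
    unfolding coeff soft_weight_eq_rate_gap series_factor_def by (simp add: power_add exp_minus)
  finally show ?thesis using False by (simp add: eta soft_term_def E_def)
qed

lemma denominator_series_eq_soft_term:
  assumes \<beta>: "\<beta> > 0" "\<kappa> = \<beta> * pi\<^sup>2 / 2"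
  shows "(if m = 0 \<or> m = n then 0 else bcoef \<beta> m n * eta \<beta> m n * (1 - exp (- eta \<beta> m n * r))) =
    series_factor r * soft_term 0 r m"
  unfolding numerator_series_eq_soft_term[OF \<beta>, symmetric] eta_eq_rate_gap[OF \<beta>(2)]
  using rate_gap_neq_0[of m] by (auto simp: power2_eq_square)

end

subsection \<open>Weak convergence from Laplace transforms\<close>

lemma polynomial_approx_unit_interval:
  assumes "continuous_on {0..1} \<phi>" "\<epsilon> > 0"
  obtains d and a :: "nat \<Rightarrow> real" where "\<And>z. z \<in> {0..1} \<Longrightarrow> \<bar>\<phi> z - (\<Sum>k\<le>d. a k * z ^ k)\<bar> < \<epsilon>"
proof -
  obtain q where q: "real_polynomial_function q" "\<And>z. z \<in> {0..1} \<Longrightarrow> \<bar>\<phi> z - q z\<bar> < \<epsilon>"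
    using Stone_Weierstrass_real_polynomial_function[OF compact_Icc assms] by blast
  from q(1) obtain a d where "q = (\<lambda>x. \<Sum>i\<le>d. a i * x ^ i)"
    unfolding real_polynomial_function_iff_sum by blast
  with q(2) show thesis by (intro that[of a d]) auto
qed

lemma (in real_distribution) expectation_polynomial_approx:
  assumes nonneg: "AE x in M. 0 \<le> x" and \<phi>: "continuous_on UNIV \<phi>"
    and approx: "\<And>z. z \<in> {0..1} \<Longrightarrow> \<bar>\<phi> z - (\<Sum>k\<le>d. a k * z ^ k)\<bar> \<le> \<epsilon>"
  shows "\<bar>expectation (\<lambda>x. \<phi> (exp (- x))) - (\<Sum>k\<le>d. a k * expectation (\<lambda>x. exp (- real k * x)))\<bar> \<le> \<epsilon>"
proof -
  let ?P = "\<lambda>x. \<Sum>k\<le>d. a k * exp (- real k * x)"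
  have [measurable]: "\<phi> \<in> borel_measurable borel" using \<phi> by (rule borel_measurable_continuous_onI)
  have exp_int: "integrable M (\<lambda>x. exp (- real k * x))" for k
    by (rule integrable_const_bound[where B = 1]) (use nonneg in auto)
  have close: "AE x in M. \<bar>\<phi> (exp (- x)) - ?P x\<bar> \<le> \<epsilon>"
    using nonneg
  proof eventually_elim
    case (elim x)
    then show ?case using approx[of "exp (- x)"] by (simp flip: exp_of_nat_mult)
  qed
  have diff_int: "integrable M (\<lambda>x. \<phi> (exp (- x)) - ?P x)"
    by (rule integrable_const_bound[where B = \<epsilon>]) (use close in auto)
  then have \<phi>_int: "integrable M (\<lambda>x. \<phi> (exp (- x)))"
    using Bochner_Integration.integrable_add[OF diff_int, of ?P] exp_int by simp
  have "\<bar>expectation (\<lambda>x. \<phi> (exp (- x)) - ?P x)\<bar> \<le> expectation (\<lambda>x. \<bar>\<phi> (exp (- x)) - ?P x\<bar>)"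
    by (rule integral_abs_bound)
  also have "\<dots> \<le> \<epsilon>"
    using diff_int close by (intro integral_le_const) auto
  finally show ?thesis using \<phi>_int exp_int by simp
qed

lemma cts_step_eq_continuous_exp_minus:
  assumes "a < b"
  obtains \<phi> where "continuous_on UNIV \<phi>" "cts_step a b = (\<lambda>x. \<phi> (exp (- x)))"
proof
  let ?\<phi> = "\<lambda>z. cts_step a b (- ln (max z (exp (- b))))"
  have clamped_ln: "continuous_on UNIV (\<lambda>z. - ln (max z (exp (- b))))"
    by (intro continuous_intros) (auto simp: max_def)
  have "continuous_on UNIV (cts_step a b)"
    by (rule uniformly_continuous_imp_continuous[OF cts_step_uniformly_continuous[OF assms]])
  then show "continuous_on UNIV ?\<phi>"
    by (rule continuous_on_compose2[OF _ clamped_ln]) auto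
  show "cts_step a b = (\<lambda>x. ?\<phi> (exp (- x)))"
    using assms by (auto simp: cts_step_def max_def fun_eq_iff)
qed

theorem laplace_convergence_imp_weak_conv_m:
  assumes M: "\<And>N. real_distribution (M N)" "\<And>N. AE x in M N. 0 \<le> x"
    and L: "real_distribution L" "AE x in L. 0 \<le> x"
    and conv: "\<And>k::nat. (\<lambda>N. \<integral>x. exp (- real k * x) \<partial>M N) \<longlonglongrightarrow> (\<integral>x. exp (- real k * x) \<partial>L)"
  shows "weak_conv_m M L"
proof (rule integral_cts_step_conv_imp_weak_conv[OF M(1) L(1)])
  fix a b :: real assume ab: "a < b"
  obtain \<phi> where \<phi>: "continuous_on UNIV \<phi>" and cts_step_eq: "cts_step a b = (\<lambda>x. \<phi> (exp (- x)))"
    using cts_step_eq_continuous_exp_minus[OF ab] .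
  show "(\<lambda>N. \<integral>x. cts_step a b x \<partial>M N) \<longlonglongrightarrow> (\<integral>x. cts_step a b x \<partial>L)"
    unfolding cts_step_eq
  proof (rule tendstoI)
    fix \<epsilon> :: real assume \<epsilon>: "\<epsilon> > 0"
    have "continuous_on {0..1} \<phi>" "\<epsilon> / 3 > 0" using continuous_on_subset[OF \<phi>] \<epsilon> by auto
    then obtain d c where approx: "\<And>z. z \<in> {0..1} \<Longrightarrow> \<bar>\<phi> z - (\<Sum>k\<le>d. c k * z ^ k)\<bar> < \<epsilon> / 3"
      using polynomial_approx_unit_interval by blast
    let ?P = "\<lambda>D. \<Sum>k\<le>d. c k * (\<integral>x. exp (- real k * x) \<partial>D)"
    have close: "\<bar>(\<integral>x. \<phi> (exp (- x)) \<partial>D) - ?P D\<bar> \<le> \<epsilon> / 3" if "real_distribution D" "AE x in D. 0 \<le> x"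
      for D
      using that approx by (intro real_distribution.expectation_polynomial_approx \<phi>)
         (auto intro: less_imp_le)
    have "(\<lambda>N. ?P (M N)) \<longlonglongrightarrow> ?P L"
      by (intro tendsto_intros conv)
    then have "eventually (\<lambda>N. dist (?P (M N)) (?P L) < \<epsilon> / 3) sequentially"
      using \<epsilon> by (intro tendstoD) auto
    then show "eventually (\<lambda>N. dist (\<integral>x. \<phi> (exp (- x)) \<partial>M N) (\<integral>x. \<phi> (exp (- x)) \<partial>L) < \<epsilon>) sequentially"
    proof eventually_elim
      case (elim N)
      then show ?case
        using close[OF M, of N] close[OF L]
        by (simp only: dist_real_def abs_le_iff abs_less_iff) linarith
    qed
  qed
qed

lemma weak_conv_m_imp_integral_atMost_conv:
  fixes f :: "real \<Rightarrow> real"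
  assumes M: "\<And>N. real_distribution (M N)" and L: "real_distribution L" and conv: "weak_conv_m M L"
    and f: "continuous_on UNIV f" "\<And>x. x \<le> c \<Longrightarrow> \<bar>f x\<bar> \<le> B" and null: "measure L {c} = 0"
  shows "(\<lambda>N. \<integral>x. indicator {..c} x * f x \<partial>M N) \<longlonglongrightarrow> (\<integral>x. indicator {..c} x * f x \<partial>L)"
proof (rule weak_conv_imp_bdd_ae_continuous_conv[OF M L conv])
  interpret L: real_distribution L by (rule L)
  have "isCont (\<lambda>x. indicator {..c} x * f x) x" if "x \<noteq> c" for x
    using that f(1) by (intro continuous_intros)
       (auto simp: continuous_on_eq_continuous_at isCont_indicator frontier_real_atMost)
  then have "{x. \<not> isCont (\<lambda>x. indicator {..c} x * f x) x} \<subseteq> {c}" by blast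
  then show "emeasure L {x. \<not> isCont (\<lambda>x. indicator {..c} x * f x) x} = 0"
    by (rule emeasure_eq_0[rotated -1]) (simp_all add: null L.emeasure_eq_measure)
  have "0 \<le> B" using f(2)[of c] by simp
  then show "norm (indicator {..c} x * f x) \<le> B" for x
    using f(2)[of x] by (cases "x \<le> c") simp_all
  have "f \<in> borel_measurable borel" using f(1) by (rule borel_measurable_continuous_onI)
  then show "(\<lambda>x. indicator {..c} x * f x) \<in> borel_measurable borel" by measurable
qed

subsection \<open>Independent geometric occupation numbers\<close>

definition mset_weight :: "('q \<Rightarrow> real) \<Rightarrow> 'q multiset \<Rightarrow> real" where
  "mset_weight p M = (\<Prod>q\<in>#M. p q)"

definition msets_over :: "'q set \<Rightarrow> 'q multiset set" where
  "msets_over Q = {M. set_mset M \<subseteq> Q}"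

lemma msets_over_mono: "Q \<subseteq> R \<Longrightarrow> msets_over Q \<subseteq> msets_over R"
  by (auto simp: msets_over_def)

lemma mset_weight_replicate_plus: "mset_weight p (replicate_mset j x + M) = p x ^ j * mset_weight p M"
  by (induction j) (auto simp: mset_weight_def)

lemma mset_weight_scale: "mset_weight (\<lambda>q. p q * z) M = mset_weight p M * z ^ size M"
  by (induction M) (auto simp: mset_weight_def)

lemma mset_weight_nonneg: "(\<And>q. q \<in> Q \<Longrightarrow> 0 \<le> p q) \<Longrightarrow> M \<in> msets_over Q \<Longrightarrow> 0 \<le> mset_weight p M"
  by (induction M) (auto simp: mset_weight_def msets_over_def)

lemma replicate_mset_plus_filter_mset: "replicate_mset (count M x) x + filter_mset (\<lambda>q. q \<noteq> x) M = M"
  by (auto intro: multiset_eqI)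

lemma filter_mset_replicate_plus:
  assumes "x \<notin># M"
  shows "filter_mset (\<lambda>q. q \<noteq> x) (replicate_mset j x + M) = M"
proof -
  have "filter_mset (\<lambda>q. q \<noteq> x) M = M" using assms by (auto simp: filter_mset_eq_conv)
  moreover have "filter_mset (\<lambda>q. q \<noteq> x) (replicate_mset j x) = {#}" by (induction j) auto
  ultimately show ?thesis by simp
qed

lemma bij_betw_split_element:
  assumes "x \<notin> Q"
  shows "bij_betw (\<lambda>(j, M). replicate_mset j x + M) (UNIV \<times> msets_over Q) (msets_over (insert x Q))"
proof (rule bij_betwI[where g = "\<lambda>M. (count M x, filter_mset (\<lambda>q. q \<noteq> x) M)"])
  fix jM assume "jM \<in> (UNIV :: nat set) \<times> msets_over Q"
  then obtain j M where jM: "jM = (j, M)" "M \<in> msets_over Q" by auto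
  then have "x \<notin># M" using assms by (auto simp: msets_over_def)
  then show "(count (case jM of (j, M) \<Rightarrow> replicate_mset j x + M) x,
      filter_mset (\<lambda>q. q \<noteq> x) (case jM of (j, M) \<Rightarrow> replicate_mset j x + M)) = jM"
    using filter_mset_replicate_plus[of x M j] by (simp add: jM not_in_iff)
qed (auto simp: msets_over_def replicate_mset_plus_filter_mset subset_iff split: if_splits)

lemma bij_betw_complete_element:
  assumes "x \<notin> Q"
  shows "bij_betw (\<lambda>M. replicate_mset (N - size M) x + M) {M \<in> msets_over Q. size M \<le> N}
    {M \<in> msets_over (insert x Q). size M = N}"
proof (rule bij_betw_byWitness[where f' = "filter_mset (\<lambda>q. q \<noteq> x)"])
  show "\<forall>M\<in>{M \<in> msets_over Q. size M \<le> N}.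
      filter_mset (\<lambda>q. q \<noteq> x) (replicate_mset (N - size M) x + M) = M"
  proof
    fix M assume "M \<in> {M \<in> msets_over Q. size M \<le> N}"
    then have "x \<notin># M" using assms by (auto simp: msets_over_def)
    then show "filter_mset (\<lambda>q. q \<noteq> x) (replicate_mset (N - size M) x + M) = M"
      by (rule filter_mset_replicate_plus)
  qed
  have size: "size M = count M x + size (filter_mset (\<lambda>q. q \<noteq> x) M)" for M
    using arg_cong[OF replicate_mset_plus_filter_mset[of M x], of size] by simp
  show "\<forall>M\<in>{M \<in> msets_over (insert x Q). size M = N}.
      replicate_mset (N - size (filter_mset (\<lambda>q. q \<noteq> x) M)) x + filter_mset (\<lambda>q. q \<noteq> x) M = M"
  proof clarify
    fix M :: "'a multiset" assume "N = size M"
    then have "N - size (filter_mset (\<lambda>q. q \<noteq> x) M) = count M x" using size[of M] by simp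
    then show "replicate_mset (size M - size (filter_mset (\<lambda>q. q \<noteq> x) M)) x +
        filter_mset (\<lambda>q. q \<noteq> x) M = M"
      using \<open>N = size M\<close> by (simp only: replicate_mset_plus_filter_mset)
  qed
qed (auto simp: msets_over_def subset_iff size_filter_mset_lesseq split: if_splits)

lemma mset_weight_has_sum_finite:
  assumes "finite Q" "\<And>q. q \<in> Q \<Longrightarrow> 0 \<le> p q" "\<And>q. q \<in> Q \<Longrightarrow> p q < 1"
  shows "(mset_weight p has_sum (\<Prod>q\<in>Q. 1 / (1 - p q))) (msets_over Q)"
  using assms
proof (induction Q rule: finite_induct)
  case empty
  have "msets_over {} = {{#} :: 'a multiset}" by (auto simp: msets_over_def)
  then show ?case by (simp add: mset_weight_def has_sum_finite_iff)
next
  case (insert x F)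
  have "((\<lambda>j. p x ^ j) has_sum 1 / (1 - p x)) UNIV"
    using insert.prems by (intro sums_nonneg_imp_has_sum geometric_sums) auto
  moreover have "(mset_weight p has_sum (\<Prod>q\<in>F. 1 / (1 - p q))) (msets_over F)"
    using insert by auto
  ultimately have "((\<lambda>(j, M). p x ^ j * mset_weight p M)
      has_sum (1 / (1 - p x) * (\<Prod>q\<in>F. 1 / (1 - p q))))
      (UNIV \<times> msets_over F)"
    using insert.prems by (intro has_sum_Times_nonneg mset_weight_nonneg[of F]) auto
  then have "((\<lambda>jM. mset_weight p ((\<lambda>(j, M). replicate_mset j x + M) jM)) has_sum
      (1 / (1 - p x) * (\<Prod>q\<in>F. 1 / (1 - p q)))) (UNIV \<times> msets_over F)"
    by (simp add: mset_weight_replicate_plus case_prod_unfold)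
  then have "(mset_weight p has_sum (1 / (1 - p x) * (\<Prod>q\<in>F. 1 / (1 - p q)))) (msets_over (insert x F))"
    using has_sum_reindex_bij_betw[OF bij_betw_split_element[OF insert.hyps(2)], of "mset_weight p"]
    by blast
  then show ?case using insert.hyps by simp
qed

lemma mset_weight_has_sum_exp_finite:
  assumes "finite Q" "\<And>q. q \<in> Q \<Longrightarrow> 0 \<le> p q" "\<And>q. q \<in> Q \<Longrightarrow> p q < 1"
  shows "(mset_weight p has_sum exp (\<Sum>q\<in>Q. - ln (1 - p q))) (msets_over Q)"
proof -
  have "exp (\<Sum>q\<in>Q. - ln (1 - p q)) = (\<Prod>q\<in>Q. 1 / (1 - p q))"
    unfolding exp_sum[OF assms(1)] using assms(3)
    by (intro prod.cong refl) (auto simp: exp_minus inverse_eq_divide)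
  then show ?thesis using mset_weight_has_sum_finite[OF assms] by simp
qed

lemma sum_mset_weight_le_exp:
  assumes p: "\<And>q. q \<in> Q \<Longrightarrow> 0 \<le> p q" "\<And>q. q \<in> Q \<Longrightarrow> p q < 1"
    and S: "((\<lambda>q. - ln (1 - p q)) has_sum S) Q" and B: "finite B" "B \<subseteq> msets_over Q"
  shows "sum (mset_weight p) B \<le> exp S"
proof -
  define F where "F = (\<Union>M\<in>B. set_mset M)"
  have F: "finite F" "F \<subseteq> Q" using B by (auto simp: F_def msets_over_def)
  have "(mset_weight p has_sum exp (\<Sum>q\<in>F. - ln (1 - p q))) (msets_over F)"
    using F p by (intro mset_weight_has_sum_exp_finite) auto
  then have "sum (mset_weight p) B \<le> exp (\<Sum>q\<in>F. - ln (1 - p q))"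
    by (rule finite_sum_le_has_sum[OF _ B(1)])
       (use msets_over_mono[OF F(2)] mset_weight_nonneg[of Q p, OF p(1)] in
        \<open>auto simp: F_def msets_over_def\<close>)
  also have "(\<Sum>q\<in>F. - ln (1 - p q)) \<le> S"
    by (rule finite_sum_le_has_sum[OF S F]) (use p in auto)
  finally show ?thesis by simp
qed

lemma mset_weight_has_sum_exp:
  assumes p: "\<And>q. q \<in> Q \<Longrightarrow> 0 \<le> p q" "\<And>q. q \<in> Q \<Longrightarrow> p q < 1"
    and S: "((\<lambda>q. - ln (1 - p q)) has_sum S) Q"
  shows "(mset_weight p has_sum exp S) (msets_over Q)"
proof -
  note nonneg = mset_weight_nonneg[of Q p, OF p(1)]
  have summable: "mset_weight p summable_on msets_over Q"
    by (rule nonneg_bdd_above_summable_on)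
       (use nonneg sum_mset_weight_le_exp[OF p S] in \<open>auto intro!: bdd_aboveI2\<close>)
  have "infsum (mset_weight p) (msets_over Q) \<le> exp S"
    by (rule infsum_le_finite_sums[OF summable]) (rule sum_mset_weight_le_exp[OF p S])
  moreover have "exp S \<le> infsum (mset_weight p) (msets_over Q)"
  proof (rule tendsto_upperbound)
    show "((\<lambda>F. exp (\<Sum>q\<in>F. - ln (1 - p q))) \<longlongrightarrow> exp S) (finite_subsets_at_top Q)"
      using S unfolding has_sum_def by (intro tendsto_exp)
    show "\<forall>\<^sub>F F in finite_subsets_at_top Q. exp (\<Sum>q\<in>F. - ln (1 - p q)) \<le>
        infsum (mset_weight p) (msets_over Q)"
    proof (rule eventually_finite_subsets_at_top_weakI)
      fix F assume F: "finite F" "F \<subseteq> Q"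
      have "(mset_weight p has_sum exp (\<Sum>q\<in>F. - ln (1 - p q))) (msets_over F)"
        using F p by (intro mset_weight_has_sum_exp_finite) auto
      from has_sum_mono2[OF this has_sum_infsum[OF summable] msets_over_mono[OF F(2)]]
      show "exp (\<Sum>q\<in>F. - ln (1 - p q)) \<le> infsum (mset_weight p) (msets_over Q)"
        using nonneg by simp
    qed
  qed auto
  ultimately show ?thesis using summable by (simp add: has_sum_iff)
qed

locale geometric_occupations =
  fixes p :: "'q \<Rightarrow> real" and Q :: "'q set"
  assumes p: "\<And>q. q \<in> Q \<Longrightarrow> 0 \<le> p q" "\<And>q. q \<in> Q \<Longrightarrow> p q < 1"
    and summable_ln: "(\<lambda>q. - ln (1 - p q)) summable_on Q"
begin

definition normalization :: real where
  "normalization = infsum (mset_weight p) (msets_over Q)"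

definition occupation_pmf :: "'q multiset pmf" where
  "occupation_pmf = embed_pmf (\<lambda>M. if M \<in> msets_over Q then mset_weight p M / normalization else 0)"

lemma mset_weight_has_sum_normalization: "(mset_weight p has_sum normalization) (msets_over Q)"
  and normalization_eq: "normalization = exp (infsum (\<lambda>q. - ln (1 - p q)) Q)"
  using mset_weight_has_sum_exp[OF p has_sum_infsum[OF summable_ln]]
  by (auto simp: normalization_def infsumI)

lemma normalization_pos: "normalization > 0"
  by (simp add: normalization_eq)

lemma mset_weight_nonneg_over: "M \<in> msets_over Q \<Longrightarrow> 0 \<le> mset_weight p M"
  using p(1) by (rule mset_weight_nonneg)

lemma pmf_occupation_pmf:
  "pmf occupation_pmf M = (if M \<in> msets_over Q then mset_weight p M / normalization else 0)"
  unfolding occupation_pmf_def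
proof (rule pmf_embed_pmf)
  let ?f = "\<lambda>M. if M \<in> msets_over Q then mset_weight p M / normalization else 0"
  show nonneg: "0 \<le> ?f M" for M
    using mset_weight_nonneg_over normalization_pos by auto
  have "((\<lambda>M. mset_weight p M / normalization) has_sum 1) (msets_over Q)"
    using has_sum_cmult_left[OF mset_weight_has_sum_normalization, of "1 / normalization"]
      normalization_pos
    by simp
  then have f_sum: "(?f has_sum 1) UNIV"
    by (rule has_sum_cong_neutral[THEN iffD1, rotated -1]) auto
  then have "(\<lambda>M. norm (?f M)) summable_on UNIV"
    using nonneg by (auto dest: has_sum_imp_summable)
  note abs_summable = abs_summable_equivalent[THEN iffD1, OF this]
  have "(\<integral>\<^sup>+M. ennreal (?f M) \<partial>count_space UNIV) = ennreal (infsetsum ?f UNIV)"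
    by (rule nn_integral_conv_infsetsum[OF abs_summable nonneg])
  then show "(\<integral>\<^sup>+M. ennreal (?f M) \<partial>count_space UNIV) = 1"
    using f_sum by (simp add: infsetsum_infsum[OF abs_summable] infsumI)
qed

lemma expectation_occupation_pmf:
  fixes f :: "'q multiset \<Rightarrow> real"
  assumes f: "\<And>M. M \<in> msets_over Q \<Longrightarrow> \<bar>f M\<bar> \<le> B"
  shows "measure_pmf.expectation occupation_pmf f =
      infsum (\<lambda>M. mset_weight p M * f M) (msets_over Q) / normalization"
proof -
  let ?g = "\<lambda>M. pmf occupation_pmf M * f M"
  have "(\<lambda>M. norm (mset_weight p M * f M)) summable_on msets_over Q"
  proof (rule summable_on_comparison_test)
    show "(\<lambda>M. B * mset_weight p M) summable_on msets_over Q"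
      by (intro summable_on_cmult_right has_sum_imp_summable[OF mset_weight_has_sum_normalization])
    show "norm (mset_weight p M * f M) \<le> B * mset_weight p M" if "M \<in> msets_over Q" for M
      using f[OF that] mset_weight_nonneg_over[OF that]
      by (simp add: abs_mult mult.commute mult_right_mono)
  qed simp
  then have "(\<lambda>M. norm (mset_weight p M * f M) * (1 / normalization)) summable_on msets_over Q"
    by (rule summable_on_cmult_left)
  then have "(\<lambda>M. norm (?g M)) summable_on UNIV"
    by (rule summable_on_cong_neutral[THEN iffD1, rotated -1])
       (use normalization_pos in \<open>auto simp: pmf_occupation_pmf abs_mult\<close>)
  then have "measure_pmf.expectation occupation_pmf f = infsum ?g UNIV"
    by (simp add: pmf_expectation_eq_infsetsum infsetsum_infsum flip: abs_summable_equivalent)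
  also have "\<dots> = infsum (\<lambda>M. mset_weight p M * f M * (1 / normalization)) (msets_over Q)"
    by (rule infsum_cong_neutral) (auto simp: pmf_occupation_pmf)
  finally show ?thesis by (subst (asm) infsum_cmult_left') simp
qed

lemma expectation_power_size:
  assumes z: "0 \<le> z" "z \<le> 1"
  shows "measure_pmf.expectation occupation_pmf (\<lambda>M. z ^ size M) =
    exp (- infsum (\<lambda>q. ln (1 + p q / (1 - p q) * (1 - z))) Q)"
proof -
  have pz: "0 \<le> p q * z" "p q * z \<le> p q" "p q * z < 1" if "q \<in> Q" for q
  proof -
    show "0 \<le> p q * z" "p q * z \<le> p q" using p[OF that] z by (auto simp: mult_left_le)
    then show "p q * z < 1" using p[OF that] by linarith
  qed
  have "(\<lambda>q. - ln (1 - p q * z)) summable_on Q"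
    by (rule summable_on_comparison_test[OF summable_ln]) (use pz p in auto)
  note ln_pz = has_sum_infsum[OF this]
  have "infsum (\<lambda>M. mset_weight p M * z ^ size M) (msets_over Q) =
      exp (infsum (\<lambda>q. - ln (1 - p q * z)) Q)"
    using infsumI[OF mset_weight_has_sum_exp[OF pz(1,3) ln_pz]]
    by (simp add: mset_weight_scale[abs_def])
  moreover have "\<bar>z ^ size M\<bar> \<le> 1" for M :: "'q multiset" using z by (simp add: power_le_one)
  ultimately have "measure_pmf.expectation occupation_pmf (\<lambda>M. z ^ size M) =
      exp (infsum (\<lambda>q. - ln (1 - p q * z)) Q) / exp (infsum (\<lambda>q. - ln (1 - p q)) Q)"
    using expectation_occupation_pmf[of "\<lambda>M. z ^ size M" 1] by (simp add: normalization_eq)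
  also have "\<dots> = exp (- (infsum (\<lambda>q. - ln (1 - p q)) Q - infsum (\<lambda>q. - ln (1 - p q * z)) Q))"
    by (simp add: exp_diff)
  also have "infsum (\<lambda>q. - ln (1 - p q)) Q - infsum (\<lambda>q. - ln (1 - p q * z)) Q =
      infsum (\<lambda>q. - ln (1 - p q) + - (- ln (1 - p q * z))) Q"
    using has_sum_add[OF has_sum_infsum[OF summable_ln] has_sum_uminusI[OF ln_pz]]
    by (simp add: infsumI)
  also have "\<dots> = infsum (\<lambda>q. ln (1 + p q / (1 - p q) * (1 - z))) Q"
  proof (rule infsum_cong)
    fix q assume q: "q \<in> Q"
    have "1 + p q / (1 - p q) * (1 - z) = (1 - p q * z) / (1 - p q)"
      using p[OF q] by (simp add: field_simps)
    then show "- ln (1 - p q) + - (- ln (1 - p q * z)) = ln (1 + p q / (1 - p q) * (1 - z))"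
      using p[OF q] pz[OF q] by (simp add: ln_div)
  qed
  finally show ?thesis .
qed

text \<open>Conditioning on the total number fixes the occupation of the additional element \<open>x\<close>.\<close>

lemma infsum_fixed_size_eq_expectation:
  fixes g :: "nat \<Rightarrow> real"
  assumes x: "x \<notin> Q"
  shows "infsum (\<lambda>M. g (count M x) * mset_weight p M) {M \<in> msets_over (insert x Q). size M = N} =
    normalization * measure_pmf.expectation occupation_pmf
      (\<lambda>M. if size M \<le> N then g (N - size M) * p x ^ (N - size M) else 0)"
proof -
  let ?f = "\<lambda>M. if size M \<le> N then g (N - size M) * p x ^ (N - size M) else 0"
  have "infsum (\<lambda>M. g (count M x) * mset_weight p M) {M \<in> msets_over (insert x Q). size M = N} =
      infsum (\<lambda>M. g (count (replicate_mset (N - size M) x + M) x) *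
          mset_weight p (replicate_mset (N - size M) x + M))
        {M \<in> msets_over Q. size M \<le> N}"
    by (rule infsum_reindex_bij_betw[OF bij_betw_complete_element[OF x], symmetric])
  also have "\<dots> = infsum (\<lambda>M. mset_weight p M * ?f M) (msets_over Q)"
  proof (rule infsum_cong_neutral)
    fix M assume M: "M \<in> {M \<in> msets_over Q. size M \<le> N} \<inter> msets_over Q"
    then have "count M x = 0" using x by (auto simp: msets_over_def count_eq_zero_iff)
    then show "g (count (replicate_mset (N - size M) x + M) x) *
        mset_weight p (replicate_mset (N - size M) x + M) =
        mset_weight p M * ?f M"
      using M by (simp add: mset_weight_replicate_plus)
  qed auto
  also have "\<dots> = normalization * measure_pmf.expectation occupation_pmf ?f"
  proof (subst expectation_occupation_pmf)
    show "\<bar>?f M\<bar> \<le> (\<Sum>j\<le>N. \<bar>g j * p x ^ j\<bar>)" for M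
      using member_le_sum[of "N - size M" "{..N}" "\<lambda>j. \<bar>g j * p x ^ j\<bar>"] by (auto intro: sum_nonneg)
  qed (use normalization_pos in auto)
  finally show ?thesis .
qed

end

subsection \<open>Theta sums\<close>

lemma sum_bounds_set_lebesgue_integral:
  fixes f :: "real \<Rightarrow> real"
  assumes antimono: "\<And>s t. 0 \<le> s \<Longrightarrow> s \<le> t \<Longrightarrow> f t \<le> f s"
    and nonneg: "\<And>t. 0 \<le> t \<Longrightarrow> 0 \<le> f t" and cont: "continuous_on {0..} f"
    and int: "set_integrable lborel {0..} f"
  defines "I \<equiv> set_lebesgue_integral lborel {0..} f"
  shows "summable (\<lambda>m. f (real (Suc m)))" "(\<Sum>m. f (real (Suc m))) \<le> I"
    "I \<le> f 0 + (\<Sum>m. f (real (Suc m)))"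
proof -
  interpret antimono_fun_sum_integral_diff f
    using antimono nonneg cont by unfold_locales
  have int_upto: "set_integrable lborel {0..t} f" for t :: real
    by (rule set_integrable_subset[OF int]) auto
  have truncated_integrals: "(\<lambda>n. integral {0..real n} f) \<longlonglongrightarrow> I"
    using filterlim_compose[OF tendsto_set_lebesgue_integral_at_top[OF _ int]
        filterlim_real_sequentially]
    unfolding I_def set_borel_integral_eq_integral(2)[OF int_upto] by auto
  have le_I: "integral {0..real n} f \<le> I" for n
    unfolding I_def set_borel_integral_eq_integral(2)[OF int]
    using set_borel_integral_eq_integral(1)[OF int] set_borel_integral_eq_integral(1)[OF int_upto]
      nonneg
    by (intro integral_subset_le) auto
  have sum_eq: "(\<Sum>m<n. f (real (Suc m))) = (\<Sum>k\<le>n. f (real k)) - f 0" for n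
    by (subst sum.atMost_shift) simp
  have upper: "(\<Sum>m<n. f (real (Suc m))) \<le> integral {0..real n} f" for n
    using sum_integral_diff_series_antimono[of 0 n] unfolding sum_eq sum_integral_diff_series_def
    by simp
  have lower: "integral {0..real n} f - f 0 \<le> (\<Sum>m<n. f (real (Suc m)))" for n
    using sum_integral_diff_series_nonneg[of n] unfolding sum_eq sum_integral_diff_series_def by simp
  show summable: "summable (\<lambda>m. f (real (Suc m)))"
    using upper le_I nonneg by (intro summableI_nonneg_bounded[where x = I]) (auto intro: order.trans)
  note partial_sums = summable_LIMSEQ[OF summable]
  show "(\<Sum>m. f (real (Suc m))) \<le> I"
    by (rule LIMSEQ_le[OF partial_sums truncated_integrals]) (use upper in auto)
  have "I - f 0 \<le> (\<Sum>m. f (real (Suc m)))"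
    by (rule LIMSEQ_le[OF tendsto_diff[OF truncated_integrals tendsto_const[of "f 0"]] partial_sums])
       (use lower in auto)
  then show "I \<le> f 0 + (\<Sum>m. f (real (Suc m)))" by simp
qed

lemma gaussian_half_line:
  assumes "x > 0"
  shows "has_bochner_integral lborel (\<lambda>t. indicator {0..} t *\<^sub>R exp (- x * t\<^sup>2)) (sqrt pi / 2 / sqrt x)"
proof -
  let ?g = "\<lambda>t::real. indicator {0..} t *\<^sub>R exp (- t\<^sup>2) :: real"
  have "has_bochner_integral lborel (\<lambda>t. ?g (0 + sqrt x * t)) ((sqrt pi / 2) /\<^sub>R \<bar>sqrt x\<bar>)"
    using gaussian_moment_0 assms by (subst lborel_has_bochner_integral_real_affine_iff[symmetric]) auto
  moreover have "?g (0 + sqrt x * t) = indicator {0..} t *\<^sub>R exp (- x * t\<^sup>2)" for t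
    using assms by (auto simp: indicator_def power_mult_distrib zero_le_mult_iff)
  moreover have "(sqrt pi / 2) /\<^sub>R \<bar>sqrt x\<bar> = sqrt pi / 2 / sqrt x"
    using assms by (simp add: field_simps)
  ultimately show ?thesis by (simp only:)
qed

definition theta :: "real \<Rightarrow> real" where
  "theta x = (\<Sum>m. exp (- x * real (Suc m) ^ 2))"

definition excess_theta :: "real \<Rightarrow> real" where
  "excess_theta x = (\<Sum>m. exp (- x * (real (m + 2) ^ 2 - 1)))"

lemma theta_bounds:
  assumes x: "x > 0"
  shows "summable (\<lambda>m. exp (- x * real (Suc m) ^ 2))"
    "theta x \<le> sqrt pi / 2 / sqrt x" "sqrt pi / 2 / sqrt x - 1 \<le> theta x"
proof -
  let ?f = "\<lambda>t::real. exp (- x * t\<^sup>2)"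
  have antimono: "?f t \<le> ?f s" if "0 \<le> s" "s \<le> t" for s t
    using that x by (auto intro!: mult_left_mono power_mono)
  have cont: "continuous_on {0..} ?f" by (intro continuous_intros)
  have int: "set_integrable lborel {0..} ?f"
    "set_lebesgue_integral lborel {0..} ?f = sqrt pi / 2 / sqrt x"
    using gaussian_half_line[OF x]
    unfolding set_integrable_def set_lebesgue_integral_def has_bochner_integral_iff by auto
  note bounds = sum_bounds_set_lebesgue_integral[of ?f, OF antimono _ cont int(1), unfolded int(2)]
  from bounds show "summable (\<lambda>m. exp (- x * real (Suc m) ^ 2))"
    "theta x \<le> sqrt pi / 2 / sqrt x" "sqrt pi / 2 / sqrt x - 1 \<le> theta x"
    by (simp_all add: theta_def)
qed

lemma theta_nonneg: "x > 0 \<Longrightarrow> theta x \<ge> 0"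
  unfolding theta_def by (intro suminf_nonneg theta_bounds(1)) auto

lemma theta_asymp: "((\<lambda>x. sqrt x * theta x) \<longlongrightarrow> sqrt pi / 2) (at_right 0)"
proof (rule tendsto_sandwich)
  have "((\<lambda>x. sqrt pi / 2 - sqrt x) \<longlongrightarrow> sqrt pi / 2 - sqrt 0) (at_right 0)"
    by (intro tendsto_intros)
  then show "((\<lambda>x. sqrt pi / 2 - sqrt x) \<longlongrightarrow> sqrt pi / 2) (at_right 0)" by simp
  have bounds: "sqrt pi / 2 - sqrt x \<le> sqrt x * theta x" "sqrt x * theta x \<le> sqrt pi / 2" if "x > 0"
    for x
    using mult_left_mono[OF theta_bounds(2)[OF that], of "sqrt x"]
      mult_left_mono[OF theta_bounds(3)[OF that], of "sqrt x"] that
    by (simp_all add: right_diff_distrib)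
  have "eventually (\<lambda>x::real. x > 0) (at_right 0)" by (simp add: eventually_at_right_less)
  then show "\<forall>\<^sub>F x in at_right 0. sqrt pi / 2 - sqrt x \<le> sqrt x * theta x"
    "\<forall>\<^sub>F x in at_right 0. sqrt x * theta x \<le> sqrt pi / 2"
    by (eventually_elim, use bounds in blast)+
qed auto

lemma excess_theta_eq:
  assumes x: "x > 0"
  shows "summable (\<lambda>m. exp (- x * (real (m + 2) ^ 2 - 1)))" "excess_theta x = exp x * theta x - 1"
proof -
  note summable = theta_bounds(1)[OF x]
  have term_eq: "exp (- x * (real (m + 2) ^ 2 - 1)) = exp x * exp (- x * real (Suc (Suc m)) ^ 2)" for m
    by (simp add: algebra_simps flip: exp_add)
  have shifted_summable: "summable (\<lambda>m. exp (- x * real (Suc (Suc m)) ^ 2))"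
    using summable by (subst (asm) summable_Suc_iff[symmetric])
  show "summable (\<lambda>m. exp (- x * (real (m + 2) ^ 2 - 1)))"
    unfolding term_eq by (intro summable_mult shifted_summable)
  have "theta x = exp (- x) + (\<Sum>m. exp (- x * real (Suc (Suc m)) ^ 2))"
    unfolding theta_def using suminf_split_head[OF summable] by simp
  moreover have "excess_theta x = exp x * (\<Sum>m. exp (- x * real (Suc (Suc m)) ^ 2))"
    unfolding excess_theta_def term_eq by (rule suminf_mult[OF shifted_summable])
  ultimately show "excess_theta x = exp x * theta x - 1"
    by (simp add: algebra_simps flip: exp_add)
qed

lemma excess_theta_nonneg: "x > 0 \<Longrightarrow> excess_theta x \<ge> 0"
  unfolding excess_theta_def by (intro suminf_nonneg excess_theta_eq(1)) auto

lemma excess_theta_le: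
  assumes x: "x > 0"
  shows "excess_theta x \<le> sqrt pi / 2 / sqrt x"
proof -
  have "excess_theta x \<le> theta x"
    unfolding excess_theta_def theta_def
  proof (rule suminf_le[OF _ excess_theta_eq(1)[OF x] theta_bounds(1)[OF x]])
    fix m
    have "real (Suc m) ^ 2 \<le> real (m + 2) ^ 2 - 1" by (simp add: power2_eq_square algebra_simps)
    then show "exp (- x * (real (m + 2) ^ 2 - 1)) \<le> exp (- x * real (Suc m) ^ 2)" using x by simp
  qed
  then show ?thesis using theta_bounds(2)[OF x] by simp
qed

lemma exp_minus_le_powr:
  fixes p y :: real
  assumes "p > 0" "y > 0"
  shows "exp (- y) \<le> p powr p * y powr (- p)"
proof -
  have "y / p \<le> exp (y / p)" using exp_ge_add_one_self[of "y / p"] by linarith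
  then have "(y / p) powr p \<le> exp (y / p) powr p" using assms by (intro powr_mono2) auto
  also have "\<dots> = exp y" using assms by (simp add: powr_def)
  finally have "y powr p / p powr p \<le> exp y" using assms by (simp add: powr_divide)
  then have "inverse (exp y) \<le> inverse (y powr p / p powr p)"
    using assms by (intro le_imp_inverse_le) auto
  then show ?thesis by (simp add: exp_minus powr_minus field_simps)
qed

lemma excess_theta_le_powr:
  assumes p: "p > 1 / 2"
  obtains C where "\<And>x. x > 0 \<Longrightarrow> excess_theta x \<le> C * x powr (- p)"
proof -
  define b where "b m = (real (m + 2) ^ 2 - 1) powr (- p)" for m
  have "summable (\<lambda>m. real m powr (- (2 * p)))" using p by (simp add: summable_real_powr_iff)
  then have "summable (\<lambda>m. norm (real m powr (- (2 * p))))" by simp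
  moreover have "b \<in> O(\<lambda>m. real m powr (- (2 * p)))" unfolding b_def[abs_def] using p by real_asymp
  ultimately have b: "summable b" by (rule summable_comparison_test_bigo)
  define C where "C = p powr p * (\<Sum>m. b m)"
  have "excess_theta x \<le> C * x powr (- p)" if x: "x > 0" for x
  proof -
    have "excess_theta x \<le> (\<Sum>m. (p powr p * x powr (- p)) * b m)"
      unfolding excess_theta_def
    proof (rule suminf_le[OF _ excess_theta_eq(1)[OF x] summable_mult[OF b]])
      fix m
      have pos: "real (m + 2) ^ 2 - 1 > 0" by (simp add: power2_eq_square algebra_simps add_pos_nonneg)
      then have "exp (- (x * (real (m + 2) ^ 2 - 1))) \<le>
          p powr p * (x * (real (m + 2) ^ 2 - 1)) powr (- p)"
        using x p by (intro exp_minus_le_powr) auto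
      then show "exp (- x * (real (m + 2) ^ 2 - 1)) \<le> (p powr p * x powr (- p)) * b m"
        using x pos by (simp add: b_def powr_mult)
    qed
    also have "\<dots> = C * x powr (- p)" by (subst suminf_mult[OF b]) (simp add: C_def mult_ac)
    finally show ?thesis .
  qed
  then show thesis by (rule that)
qed

lemma excess_theta_asymp: "((\<lambda>x. sqrt x * excess_theta x) \<longlongrightarrow> sqrt pi / 2) (at_right 0)"
proof -
  have "((\<lambda>x. exp x * (sqrt x * theta x) - sqrt x) \<longlongrightarrow> exp 0 * (sqrt pi / 2) - sqrt 0) (at_right 0)"
    by (intro tendsto_intros theta_asymp)
  moreover have "eventually (\<lambda>x::real. x > 0) (at_right 0)" by (simp add: eventually_at_right_less)
  then have "eventually (\<lambda>x. exp x * (sqrt x * theta x) - sqrt x =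
      sqrt x * excess_theta x) (at_right 0)"
    by eventually_elim (simp add: excess_theta_eq(2) algebra_simps)
  ultimately show ?thesis by (auto intro: Lim_transform_eventually)
qed

lemma theta_has_sum:
  assumes "x > 0"
  shows "((\<lambda>m. exp (- x * real m ^ 2)) has_sum theta x) {1..}"
proof -
  have "((\<lambda>m. exp (- x * real (Suc m) ^ 2)) has_sum theta x) UNIV"
    unfolding theta_def by (intro sums_nonneg_imp_has_sum summable_sums theta_bounds(1) assms) auto
  moreover have "bij_betw Suc UNIV {1..}"
    by (rule bij_betw_byWitness[where f' = "\<lambda>m. m - 1"]) auto
  ultimately show ?thesis
    using has_sum_reindex_bij_betw[of Suc UNIV "{1..}" "\<lambda>m. exp (- x * real m ^ 2)"] by blast
qed

lemma excess_theta_has_sum: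
  assumes "x > 0"
  shows "((\<lambda>m. exp (- x * (real m ^ 2 - 1))) has_sum (1 + excess_theta x)) {1..}"
proof -
  have "((\<lambda>m. exp x * exp (- x * real m ^ 2)) has_sum (exp x * theta x)) {1..}"
    by (intro has_sum_cmult_right theta_has_sum assms)
  then show ?thesis
    by (simp add: excess_theta_eq(2)[OF assms] algebra_simps flip: exp_add)
qed

text \<open>A side of length \<open>V powr b\<close> contributes one factor \<open>V powr (- b)\<close> of the density and levels
  in units of \<open>V powr (- 2 * b)\<close>.\<close>

definition box_scaled :: "(real \<Rightarrow> real) \<Rightarrow> real \<Rightarrow> real \<Rightarrow> real \<Rightarrow> real" where
  "box_scaled F b c V = V powr (- b) * F (c * V powr (- 2 * b))"

lemma box_scaled_nonneg:
  "(\<And>x. x > 0 \<Longrightarrow> 0 \<le> F x) \<Longrightarrow> c > 0 \<Longrightarrow> V > 0 \<Longrightarrow> 0 \<le> box_scaled F b c V"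
  by (simp add: box_scaled_def)

lemma sqrt_box_level:
  "V > 0 \<Longrightarrow> sqrt (c * V powr (- 2 * b)) = sqrt c * V powr (- b)"
  by (simp add: real_sqrt_mult powr_half_sqrt[symmetric] powr_powr)

lemma box_scaled_le:
  assumes "\<And>x. x > 0 \<Longrightarrow> F x \<le> l / sqrt x" "c > 0" "V > 0"
  shows "box_scaled F b c V \<le> l / sqrt c"
proof -
  have "V powr (- b) * F (c * V powr (- 2 * b)) \<le> V powr (- b) * (l / sqrt (c * V powr (- 2 * b)))"
    using assms by (intro mult_left_mono) auto
  also have "\<dots> = l / sqrt c" unfolding sqrt_box_level[OF assms(3)] using assms(3) by simp
  finally show ?thesis by (simp only: box_scaled_def)
qed

lemma box_scaled_tendsto:
  assumes F: "((\<lambda>x. sqrt x * F x) \<longlongrightarrow> l) (at_right 0)" and c: "c > 0" and b: "b > 0"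
  shows "(box_scaled F b c \<longlongrightarrow> l / sqrt c) at_top"
proof -
  have "filterlim (\<lambda>V. c * V powr (- 2 * b)) (at_right 0) at_top"
    using c b by real_asymp
  from filterlim_compose[OF F this] c
  have "((\<lambda>V. sqrt (c * V powr (- 2 * b)) * F (c * V powr (- 2 * b)) / sqrt c) \<longlongrightarrow> l / sqrt c) at_top"
    by (intro tendsto_divide) auto
  moreover have "eventually (\<lambda>V. sqrt (c * V powr (- 2 * b)) * F (c * V powr (- 2 * b)) / sqrt c =
      box_scaled F b c V) at_top"
    using eventually_gt_at_top[of 0]
    by eventually_elim (use c in \<open>simp only: sqrt_box_level box_scaled_def, simp\<close>)
  ultimately show ?thesis by (rule Lim_transform_eventually)
qed

text \<open>The exponent of \<open>c\<close> is the one for which the powers of \<open>V\<close> cancel.\<close>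

lemma box_scaled_excess_theta_le_powr:
  assumes b: "0 < b" "b < 1 / 2"
  shows "\<exists>C. \<forall>c>0. \<forall>V>0. V powr (b - 1/2) * box_scaled excess_theta b c V \<le>
      C * c powr (- (1 / (4 * b)))"
proof -
  define p where "p = 1 / (4 * b)"
  have p: "p > 1 / 2" using b by (simp add: p_def field_simps)
  obtain C where C: "\<And>x. x > 0 \<Longrightarrow> excess_theta x \<le> C * x powr (- p)"
    using excess_theta_le_powr[OF p] by blast
  have "V powr (b - 1/2) * box_scaled excess_theta b c V \<le> C * c powr (- p)" if cV: "c > 0" "V > 0"
    for c V
  proof -
    have "V powr (b - 1/2) * box_scaled excess_theta b c V =
        V powr (- 1/2) * excess_theta (c * V powr (-2 * b))"
      by (simp add: box_scaled_def flip: powr_add mult.assoc)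
    also have "\<dots> \<le> V powr (- 1/2) * (C * (c * V powr (-2 * b)) powr (- p))"
      using cV by (intro mult_left_mono C) auto
    also have "(c * V powr (-2 * b)) powr (- p) = c powr (- p) * V powr (1/2)"
      using cV b by (simp add: powr_mult powr_powr p_def)
    also have "V powr (- 1/2) * (C * (c powr (- p) * V powr (1/2))) =
        C * c powr (- p) * (V powr (- 1/2) * V powr (1/2))"
      by (simp only: mult_ac)
    also have "V powr (- 1/2) * V powr (1/2) = 1" using cV by (simp flip: powr_add)
    finally show ?thesis by simp
  qed
  then show ?thesis unfolding p_def by blast
qed

subsection \<open>Excited transverse modes\<close>

definition bose_factor :: "real \<Rightarrow> real" where
  "bose_factor x = 1 / (exp x - 1)"

lemma bose_factor_eq: "x > 0 \<Longrightarrow> exp (- x) / (1 - exp (- x)) = bose_factor x"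
  by (simp add: bose_factor_def exp_minus field_simps)

lemma bose_factor_bounds:
  assumes "x > 0"
  shows "0 < bose_factor x" "bose_factor x \<le> 1 / x"
proof -
  have "x \<le> exp x - 1" using exp_ge_add_one_self[of x] by linarith
  then show "0 < bose_factor x" "bose_factor x \<le> 1 / x"
    using assms by (auto simp: bose_factor_def intro!: divide_left_mono mult_pos_pos)
qed

lemma bose_factor_sums:
  assumes "x > 0"
  shows "(\<lambda>k. exp (- real (Suc k) * x)) sums bose_factor x"
proof -
  have "(\<lambda>k. exp (- x) * exp (- x) ^ k) sums (exp (- x) * (1 / (1 - exp (- x))))"
    using assms by (intro sums_mult geometric_sums) auto
  also have "exp (- x) * (1 / (1 - exp (- x))) = bose_factor x"
    using assms by (simp add: bose_factor_def exp_minus field_simps)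
  also have "(\<lambda>k. exp (- x) * exp (- x) ^ k) = (\<lambda>k. exp (- real (Suc k) * x))"
    by (simp add: fun_eq_iff algebra_simps flip: exp_of_nat_mult exp_add)
  finally show ?thesis .
qed

lemma diff_square_le_ln_one_plus:
  fixes y :: real
  assumes "y \<ge> 0"
  shows "y - y\<^sup>2 \<le> ln (1 + y)"
proof (cases "y \<le> 1")
  case True
  then show ?thesis using ln_one_plus_pos_lower_bound[OF assms] by simp
next
  case False
  then have "y * 1 \<le> y * y" by (intro mult_left_mono) auto
  moreover have "0 \<le> ln (1 + y)" using assms by simp
  ultimately show ?thesis by (simp add: power2_eq_square)
qed

lemma infsum_ln_one_plus_bounds:
  fixes u :: "'a \<Rightarrow> real"
  assumes u: "(u has_sum U) A" "\<And>q. q \<in> A \<Longrightarrow> 0 \<le> u q" "\<And>q. q \<in> A \<Longrightarrow> u q \<le> m"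
  shows "infsum (\<lambda>q. ln (1 + u q)) A \<le> U" "(1 - m) * U \<le> infsum (\<lambda>q. ln (1 + u q)) A"
proof -
  have upper: "ln (1 + u q) \<le> u q" if "q \<in> A" for q
    using ln_add_one_self_le_self u(2)[OF that] by blast
  have lower: "(1 - m) * u q \<le> ln (1 + u q)" if "q \<in> A" for q
  proof -
    have "(1 - m) * u q \<le> (1 - u q) * u q" using u(2,3)[OF that] by (intro mult_right_mono) auto
    then show ?thesis using diff_square_le_ln_one_plus[OF u(2)[OF that]]
      by (simp add: power2_eq_square algebra_simps)
  qed
  have "(\<lambda>q. ln (1 + u q)) summable_on A"
    by (rule summable_on_comparison_test[OF has_sum_imp_summable[OF u(1)]]) (use u(2) upper in auto)
  note ln_sum = has_sum_infsum[OF this]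
  show "infsum (\<lambda>q. ln (1 + u q)) A \<le> U"
    by (rule has_sum_mono[OF ln_sum u(1)]) (rule upper)
  show "(1 - m) * U \<le> infsum (\<lambda>q. ln (1 + u q)) A"
    by (rule has_sum_mono[OF has_sum_cmult_right[OF u(1)] ln_sum]) (rule lower)
qed

definition excited :: "(nat \<times> nat \<times> nat) set" where
  "excited = {1..} \<times> ({1..} \<times> {1..} - {(1, 1)})"

locale slab_box = energy_scale +
  fixes a2 a3 :: real
  assumes a3: "a3 > 0" and a3_le_a2: "a3 \<le> a2" and a2_add_a3: "a2 + a3 = 1 / 2"
begin

lemma a2: "a2 > 0" "a2 < 1 / 2" and a3_less: "a3 < 1 / 2"
  using a3 a3_le_a2 a2_add_a3 by auto

text \<open>\<open>\<beta>\<close> times the one-particle energy without the transverse ground state energy, where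
  \<open>\<kappa> = \<beta> \<pi>\<^sup>2 / 2\<close>.\<close>

definition excess_energy :: "real \<Rightarrow> nat \<times> nat \<times> nat \<Rightarrow> real" where
  "excess_energy V = (\<lambda>(n1, n2, n3). rate \<kappa> n1 / V +
     \<kappa> * ((real n2 ^ 2 - 1) * V powr (-2 * a2) + (real n3 ^ 2 - 1) * V powr (-2 * a3)))"

lemma excess_energy_soft: "excess_energy V (m, 1, 1) = rate \<kappa> m / V"
  by (simp add: excess_energy_def)

lemma excess_energy_excited_ge:
  assumes "V \<ge> 1" "q \<in> excited"
  shows "3 * \<kappa> * V powr (- 2 * a2) \<le> excess_energy V q"
proof -
  obtain n1 n2 n3 where q: "q = (n1, n2, n3)" by (cases q)
  have n: "n2 \<ge> 1" "n3 \<ge> 1" "n2 \<ge> 2 \<or> n3 \<ge> 2" using assms(2) by (auto simp: q excited_def)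
  have nonneg: "real m ^ 2 - 1 \<ge> 0" if "m \<ge> 1" for m using that by simp
  have ge3: "real m ^ 2 - 1 \<ge> 3" if "m \<ge> 2" for m
    using power_mono[of 2 "real m" 2] that by simp
  have V: "V powr (- 2 * a2) \<le> V powr (- 2 * a3)" using assms(1) a3_le_a2 by (intro powr_mono) auto
  have "3 * V powr (- 2 * a2) \<le>
      (real n2 ^ 2 - 1) * V powr (- 2 * a2) + (real n3 ^ 2 - 1) * V powr (- 2 * a3)"
  proof (cases "n2 \<ge> 2")
    case True
    then have "3 * V powr (- 2 * a2) \<le> (real n2 ^ 2 - 1) * V powr (- 2 * a2)"
      by (intro mult_right_mono ge3) auto
    moreover have "0 \<le> (real n3 ^ 2 - 1) * V powr (- 2 * a3)" using nonneg[OF n(2)] by simp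
    ultimately show ?thesis by linarith
  next
    case False
    then have "3 * V powr (- 2 * a2) \<le> (real n3 ^ 2 - 1) * V powr (- 2 * a3)"
      using n V ge3[of n3] by (intro mult_mono) auto
    moreover have "0 \<le> (real n2 ^ 2 - 1) * V powr (- 2 * a2)" using nonneg[OF n(1)] by simp
    ultimately show ?thesis by linarith
  qed
  then have "\<kappa> * (3 * V powr (- 2 * a2)) \<le>
      \<kappa> * ((real n2 ^ 2 - 1) * V powr (- 2 * a2) + (real n3 ^ 2 - 1) * V powr (- 2 * a3))"
    using \<kappa> by (intro mult_left_mono) auto
  moreover have "0 \<le> rate \<kappa> n1 / V" using \<kappa> assms(1) by (simp add: rate_def)
  ultimately show ?thesis by (simp add: excess_energy_def q)
qed

lemma excess_energy_pos:
  assumes "V > 0" "q \<in> modes"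
  shows "excess_energy V q > 0"
proof -
  obtain n1 n2 n3 where q: "q = (n1, n2, n3)" by (cases q)
  have n: "n1 \<ge> 1" "n2 \<ge> 1" "n3 \<ge> 1" using assms(2) by (auto simp: q modes_def)
  have "0 \<le> \<kappa> * ((real n2 ^ 2 - 1) * V powr (- 2 * a2) + (real n3 ^ 2 - 1) * V powr (- 2 * a3))"
    using \<kappa> n by (intro mult_nonneg_nonneg add_nonneg_nonneg) auto
  moreover have "0 < rate \<kappa> n1 / V" using rate_pos[OF \<kappa> n(1)] assms(1) by simp
  ultimately show ?thesis by (simp add: excess_energy_def q)
qed

lemma excess_energy_excited_pos: "V > 0 \<Longrightarrow> q \<in> excited \<Longrightarrow> excess_energy V q > 0"
  by (rule excess_energy_pos) (auto simp: excited_def modes_def)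

definition bose_scale :: "nat \<Rightarrow> real" where
  "bose_scale k = real (Suc k) * \<kappa>"

text \<open>The \<open>k\<close>-th term of the geometric expansion of the mean density of the excited modes.\<close>

definition excited_term :: "nat \<Rightarrow> real \<Rightarrow> real" where
  "excited_term k V =
     box_scaled theta (1/2) (bose_scale k) V *
     (V powr (a2 - 1/2) * box_scaled excess_theta a2 (bose_scale k) V
      + V powr (a3 - 1/2) * box_scaled excess_theta a3 (bose_scale k) V
      + box_scaled excess_theta a2 (bose_scale k) V * box_scaled excess_theta a3 (bose_scale k) V)"

definition excited_limit :: "nat \<Rightarrow> real" where
  "excited_limit k = (sqrt pi / 2 / sqrt (bose_scale k)) ^ 3"

definition excited_density :: "real \<Rightarrow> real" where
  "excited_density V = (\<Sum>k. excited_term k V)"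

definition critical_density :: real where
  "critical_density = (\<Sum>k. excited_limit k)"

lemma bose_scale_pos: "bose_scale k > 0"
  using \<kappa> by (simp add: bose_scale_def)

lemma excited_limit_nonneg: "excited_limit k \<ge> 0"
  using bose_scale_pos[of k] by (simp add: excited_limit_def)

lemma excited_term_nonneg: "V > 0 \<Longrightarrow> 0 \<le> excited_term k V"
  unfolding excited_term_def
  by (intro mult_nonneg_nonneg add_nonneg_nonneg box_scaled_nonneg theta_nonneg excess_theta_nonneg
      bose_scale_pos) auto

lemma volume_times_excited_term:
  assumes "V > 0"
  shows "V * excited_term k V = theta (bose_scale k / V) *
    ((1 + excess_theta (bose_scale k * V powr (-2 * a2))) *
      (1 + excess_theta (bose_scale k * V powr (-2 * a3))) - 1)"
proof -
  let ?\<theta> = "theta (bose_scale k / V)"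
  let ?y = "excess_theta (bose_scale k * V powr (-2 * a2))"
    and ?z = "excess_theta (bose_scale k * V powr (-2 * a3))"
  have powr_cancel: "V powr a * V powr b * V powr d = V powr (- 1)" if "a + b + d = - 1" for a b d
    by (simp only: powr_add[symmetric] that)
  have powr: "V powr (- (1/2)) * V powr (a2 - 1/2) * V powr (- a2) = V powr (- 1)"
    "V powr (- (1/2)) * V powr (a3 - 1/2) * V powr (- a3) = V powr (- 1)"
    "V powr (- (1/2)) * V powr (- a2) * V powr (- a3) = V powr (- 1)"
    using a2_add_a3 by (intro powr_cancel; simp)+
  have theta_box: "box_scaled theta (1/2) (bose_scale k) V = V powr (- (1/2)) * ?\<theta>"
    using assms by (simp add: box_scaled_def powr_minus_divide)
  have "excited_term k V = ?\<theta> *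
      (V powr (- (1/2)) * V powr (a2 - 1/2) * V powr (- a2) * ?y
       + V powr (- (1/2)) * V powr (a3 - 1/2) * V powr (- a3) * ?z
       + V powr (- (1/2)) * V powr (- a2) * V powr (- a3) * (?y * ?z))"
    unfolding excited_term_def theta_box by (simp only: box_scaled_def algebra_simps)
  also have "\<dots> = ?\<theta> * ((1 + ?y) * (1 + ?z) - 1) * V powr (- 1)"
    unfolding powr by (simp only: algebra_simps)
  finally show ?thesis using assms by (simp add: powr_minus_divide)
qed

lemma exp_excess_energy_has_sum:
  assumes "V > 0"
  shows "((\<lambda>q. exp (- real (Suc k) * excess_energy V q)) has_sum (V * excited_term k V)) excited"
proof -
  let ?x = "bose_scale k / V" and ?y = "bose_scale k * V powr (-2 * a2)"
    and ?z = "bose_scale k * V powr (-2 * a3)"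
  have pos: "?x > 0" "?y > 0" "?z > 0" using assms bose_scale_pos[of k] by auto
  let ?g = "\<lambda>(n2, n3). exp (- ?y * (real n2 ^ 2 - 1)) * exp (- ?z * (real n3 ^ 2 - 1))"
  have "(?g has_sum ((1 + excess_theta ?y) * (1 + excess_theta ?z))) ({1..} \<times> {1..})"
    using pos by (intro has_sum_Times_nonneg excess_theta_has_sum) auto
  moreover have "(?g has_sum 1) {(1, 1)}" by (rule has_sum_finiteI) auto
  ultimately have transverse:
    "(?g has_sum ((1 + excess_theta ?y) * (1 + excess_theta ?z) - 1)) ({1..} \<times> {1..} - {(1, 1)})"
    by (rule has_sum_Diff) auto
  have "((\<lambda>(n1, r). exp (- ?x * real n1 ^ 2) * ?g r) has_sum (V * excited_term k V)) excited"
    unfolding excited_def volume_times_excited_term[OF assms]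
    by (rule has_sum_Times_nonneg[OF theta_has_sum[OF pos(1)] _ transverse]) auto
  then show ?thesis
    by (rule has_sum_cong[THEN iffD1, rotated])
       (auto simp: excess_energy_def rate_def bose_scale_def add_divide_distrib algebra_simps
         simp flip: exp_add)
qed

lemma excited_term_tendsto: "(excited_term k \<longlongrightarrow> excited_limit k) at_top"
proof -
  let ?l = "sqrt pi / 2 / sqrt (bose_scale k)"
  have vanish: "((\<lambda>V::real. V powr (a2 - 1/2)) \<longlongrightarrow> 0) at_top" "((\<lambda>V::real. V powr (a3 - 1/2)) \<longlongrightarrow> 0) at_top"
    using a2 a3_less by real_asymp+
  have "(excited_term k \<longlongrightarrow> ?l * (0 * ?l + 0 * ?l + ?l * ?l)) at_top"
    unfolding excited_term_def[abs_def] using a2 a3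
    by (intro tendsto_mult tendsto_add vanish box_scaled_tendsto theta_asymp excess_theta_asymp
       bose_scale_pos) auto
  then show ?thesis by (simp add: excited_limit_def power3_eq_cube mult_ac)
qed

lemma excited_term_le:
  assumes V: "V > 0"
    and bound2: "V powr (a2 - 1/2) * box_scaled excess_theta a2 (bose_scale k) V \<le> B2"
    and bound3: "V powr (a3 - 1/2) * box_scaled excess_theta a3 (bose_scale k) V \<le> B3"
  shows "excited_term k V \<le> sqrt pi / 2 * bose_scale k powr (- (1/2)) *
      (B2 + B3 + pi / 4 * bose_scale k powr (- 1))"
proof -
  define c where "c = bose_scale k"
  let ?h = "sqrt pi / 2 / sqrt c"
  have c: "c > 0" unfolding c_def by (rule bose_scale_pos)
  have scaled_le: "box_scaled theta b c V \<le> ?h" "box_scaled excess_theta b c V \<le> ?h" for b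
    by (intro box_scaled_le theta_bounds(2) excess_theta_le c V; simp)+
  have nonneg: "0 \<le> box_scaled theta b c V" "0 \<le> box_scaled excess_theta b c V" for b
    using c V by (intro box_scaled_nonneg theta_nonneg excess_theta_nonneg; simp)+
  have "excited_term k V \<le> ?h * (B2 + B3 + ?h * ?h)"
    unfolding excited_term_def c_def[symmetric]
    by (intro mult_mono[OF scaled_le(1)] mult_mono[OF scaled_le(2) scaled_le(2)] add_mono
        bound2[folded c_def] bound3[folded c_def])
       (use nonneg c in \<open>auto intro!: add_nonneg_nonneg mult_nonneg_nonneg\<close>)
  also have "?h * ?h = pi / 4 * c powr (- 1)" using c by (simp add: powr_minus_divide)
  also have "?h = sqrt pi / 2 * c powr (- (1/2))"
    using c by (simp add: powr_minus_divide powr_half_sqrt)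
  finally show ?thesis by (simp only: c_def)
qed

lemma summable_bose_scale_powr:
  assumes "q > 1"
  shows "summable (\<lambda>k. bose_scale k powr (- q))"
proof -
  have "summable (\<lambda>k. real k powr (- q))" using assms by (simp add: summable_real_powr_iff)
  then have "summable (\<lambda>k. real (Suc k) powr (- q))" by (subst summable_Suc_iff)
  then show ?thesis using \<kappa> by (simp add: bose_scale_def powr_mult summable_mult2)
qed

lemma excited_term_dominated:
  obtains B where "summable B" "\<And>k V. V > 0 \<Longrightarrow> excited_term k V \<le> B k"
proof -
  define p2 p3 where "p2 = 1 / (4 * a2)" and "p3 = 1 / (4 * a3)"
  have p: "p2 > 1 / 2" "p3 > 1 / 2"
    using a2 a3 a3_less by (simp_all add: p2_def p3_def field_simps)
  obtain C2 where C2: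
    "\<forall>c>0. \<forall>V>0. V powr (a2 - 1/2) * box_scaled excess_theta a2 c V \<le> C2 * c powr (- p2)"
    unfolding p2_def using box_scaled_excess_theta_le_powr[OF a2] ..
  obtain C3 where C3:
    "\<forall>c>0. \<forall>V>0. V powr (a3 - 1/2) * box_scaled excess_theta a3 c V \<le> C3 * c powr (- p3)"
    unfolding p3_def using box_scaled_excess_theta_le_powr[OF a3 a3_less] ..
  define B where "B k = sqrt pi / 2 * bose_scale k powr (- (1/2)) *
    (C2 * bose_scale k powr (- p2) + C3 * bose_scale k powr (- p3)
     + pi / 4 * bose_scale k powr (- 1))" for k
  have powr_split: "c powr (- (1/2 + p)) = c powr (- (1/2)) * c powr (- p)" for c p :: real
    by (simp flip: powr_add)
  have B_eq: "B = (\<lambda>k. sqrt pi / 2 * (C2 * bose_scale k powr (- (1/2 + p2))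
      + C3 * bose_scale k powr (- (1/2 + p3)) + pi / 4 * bose_scale k powr (- (1/2 + 1))))"
    unfolding B_def[abs_def] powr_split by (simp only: distrib_left mult_ac)
  have "summable B"
    unfolding B_eq using p
    by (intro summable_mult summable_add summable_bose_scale_powr) auto
  moreover have "excited_term k V \<le> B k" if "V > 0" for k V
    unfolding B_def using that C2 C3 bose_scale_pos[of k] by (intro excited_term_le) auto
  ultimately show thesis by (rule that)
qed

lemma summable_excited_term:
  assumes "V > 0"
  shows "summable (\<lambda>k. excited_term k V)"
proof -
  obtain B where dominated: "summable B" "\<And>k V. V > 0 \<Longrightarrow> excited_term k V \<le> B k"
    using excited_term_dominated by blast
  show ?thesis
    by (rule summable_comparison_test'[OF dominated(1)])
       (use assms dominated(2) excited_term_nonneg in simp)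
qed

lemma summable_excited_limit: "summable excited_limit"
proof -
  obtain B where dominated: "summable B" "\<And>k V. V > 0 \<Longrightarrow> excited_term k V \<le> B k"
    using excited_term_dominated by blast
  have "excited_limit k \<le> B k" for k
    by (rule tendsto_upperbound[OF excited_term_tendsto eventually_mono[OF eventually_gt_at_top[of 0]]])
       (use dominated(2) in auto)
  then show ?thesis
    by (intro summable_comparison_test'[OF dominated(1)]) (use excited_limit_nonneg in simp)
qed

lemma critical_density_nonneg: "critical_density \<ge> 0"
  unfolding critical_density_def by (intro suminf_nonneg summable_excited_limit excited_limit_nonneg)

lemma excited_density_tendsto: "(excited_density \<longlongrightarrow> critical_density) at_top"
proof -
  obtain B where dominated: "summable B" "\<And>k V. V > 0 \<Longrightarrow> excited_term k V \<le> B k"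
    using excited_term_dominated by blast
  show ?thesis
    unfolding excited_density_def[abs_def] critical_density_def
  proof (rule tendsto_suminf_dominated[OF excited_term_tendsto _ dominated(1)])
    show "\<forall>\<^sub>F V in at_top. \<forall>k. \<bar>excited_term k V\<bar> \<le> B k"
      using eventually_gt_at_top[of 0] by eventually_elim (use dominated(2) excited_term_nonneg in auto)
  qed auto
qed

lemma bose_factor_excited_has_sum:
  assumes V: "V > 0"
  shows "((\<lambda>q. bose_factor (excess_energy V q)) has_sum (V * excited_density V)) excited"
proof -
  let ?f = "\<lambda>(k, q). exp (- real (Suc k) * excess_energy V q)"
  have sum_modes: "((\<lambda>q. ?f (k, q)) has_sum (V * excited_term k V)) excited" for k
    using exp_excess_energy_has_sum[OF V] by simp
  have "(\<lambda>k. V * excited_term k V) sums (V * excited_density V)"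
    unfolding excited_density_def by (intro sums_mult summable_sums summable_excited_term V)
  then have sum_terms: "((\<lambda>k. V * excited_term k V) has_sum (V * excited_density V)) UNIV"
    using excited_term_nonneg V by (intro sums_nonneg_imp_has_sum) auto
  have "(?f has_sum (V * excited_density V)) (UNIV \<times> excited)"
  proof (rule has_sum_SigmaI[OF sum_modes sum_terms])
    show "?f summable_on UNIV \<times> excited"
      by (rule summable_on_SigmaI[OF sum_modes]) (use sum_terms in \<open>auto dest: has_sum_imp_summable\<close>)
  qed
  then have "((\<lambda>(q, k). ?f (k, q)) has_sum (V * excited_density V)) (excited \<times> UNIV)"
    by (rule has_sum_swap[THEN iffD1])
  then show ?thesis
  proof (rule has_sum_SigmaD)
    fix q assume "q \<in> excited"
    then have "excess_energy V q > 0" by (rule excess_energy_excited_pos[OF V])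
    then show "((\<lambda>k. (\<lambda>(q, k). ?f (k, q)) (q, k)) has_sum bose_factor (excess_energy V q)) UNIV"
      using bose_factor_sums by (auto intro: sums_nonneg_imp_has_sum)
  qed
qed

definition ln_factor :: "real \<Rightarrow> real \<Rightarrow> nat \<times> nat \<times> nat \<Rightarrow> real" where
  "ln_factor s V q = ln (1 + bose_factor (excess_energy V q) * (1 - exp (- s / V)))"

text \<open>No excited mode is macroscopically occupied, since \<open>2 * a2 < 1\<close>.\<close>

lemma bose_factor_excited_le:
  assumes "V \<ge> 1" "q \<in> excited"
  shows "bose_factor (excess_energy V q) \<le> V powr (2 * a2) / (3 * \<kappa>)"
proof -
  have pos: "excess_energy V q > 0" using assms by (intro excess_energy_excited_pos) auto
  then have "bose_factor (excess_energy V q) \<le> 1 / excess_energy V q"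
    by (rule bose_factor_bounds(2))
  also have "\<dots> \<le> 1 / (3 * \<kappa> * V powr (- 2 * a2))"
    using excess_energy_excited_ge[OF assms] \<kappa> assms(1) pos
    by (intro divide_left_mono mult_pos_pos) auto
  also have "\<dots> = V powr (2 * a2) / (3 * \<kappa>)" using assms(1) by (simp add: powr_minus_divide)
  finally show ?thesis .
qed

lemma infsum_ln_factor_excited_bounds:
  assumes V: "V \<ge> 1" and s: "s \<ge> 0"
  defines "z \<equiv> 1 - exp (- s / V)"
  shows "infsum (ln_factor s V) excited \<le> V * z * excited_density V"
    "(1 - V powr (2 * a2) / (3 * \<kappa>) * z) * (V * z * excited_density V) \<le> infsum (ln_factor s V) excited"
proof -
  have z: "z \<ge> 0" using V s by (simp add: z_def)
  have nonneg: "0 \<le> bose_factor (excess_energy V q) * z" if "q \<in> excited" for q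
    using bose_factor_bounds(1)[OF excess_energy_excited_pos[OF _ that], of V] V z by simp
  have upper: "bose_factor (excess_energy V q) * z \<le> V powr (2 * a2) / (3 * \<kappa>) * z" if "q \<in> excited"
    for q
    using bose_factor_excited_le[OF V that] z by (rule mult_right_mono)
  have "((\<lambda>q. bose_factor (excess_energy V q) * z) has_sum (V * excited_density V * z)) excited"
    using V by (intro has_sum_cmult_left bose_factor_excited_has_sum) simp
  from infsum_ln_one_plus_bounds[OF this nonneg upper]
  show "infsum (ln_factor s V) excited \<le> V * z * excited_density V"
    "(1 - V powr (2 * a2) / (3 * \<kappa>) * z) * (V * z * excited_density V) \<le> infsum (ln_factor s V) excited"
    by (simp_all add: ln_factor_def[abs_def] z_def mult_ac)
qed

lemma infsum_ln_factor_excited_tendsto: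
  assumes s: "s \<ge> 0"
  shows "((\<lambda>V. infsum (ln_factor s V) excited) \<longlongrightarrow> s * critical_density) at_top"
proof -
  let ?z = "\<lambda>V. 1 - exp (- s / V)"
  have "((\<lambda>V. V * ?z V) \<longlongrightarrow> s) at_top"
    using s by (cases "s = 0") (simp, real_asymp)
  then have upper: "((\<lambda>V. V * ?z V * excited_density V) \<longlongrightarrow> s * critical_density) at_top"
    by (rule tendsto_mult[OF _ excited_density_tendsto])
  have small: "((\<lambda>V. V powr (2 * a2) / (3 * \<kappa>) * ?z V) \<longlongrightarrow> 0) at_top"
    using s \<kappa> a2 by (cases "s = 0") (simp, real_asymp)
  have large_volume: "eventually (\<lambda>V::real. V \<ge> 1) at_top" by (rule eventually_ge_at_top)
  show ?thesis
  proof (rule tendsto_sandwich[OF _ _ _ upper])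
    show "((\<lambda>V. (1 - V powr (2 * a2) / (3 * \<kappa>) * ?z V) * (V * ?z V * excited_density V))
        \<longlongrightarrow> s * critical_density) at_top"
      using tendsto_mult[OF tendsto_diff[OF tendsto_const[of 1] small] upper] by simp
  qed (use large_volume in \<open>eventually_elim, use infsum_ln_factor_excited_bounds s in blast\<close>)+
qed

end

subsection \<open>The critical density\<close>

lemma emeasure_density_Ioc_eq_diff:
  fixes F f :: "real \<Rightarrow> real"
  assumes deriv: "\<And>x. (F has_real_derivative f x) (at x)" and nonneg: "\<And>x. 0 \<le> f x"
    and [measurable]: "f \<in> borel_measurable borel" and "a \<le> b"
  shows "emeasure (density lborel (\<lambda>x. ennreal (f x))) {a<..b} = ennreal (F b - F a)"
proof -
  have "emeasure (density lborel (\<lambda>x. ennreal (f x))) {a<..b} =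
      (\<integral>\<^sup>+t. ennreal (f t) * indicator {a<..b} t \<partial>lborel)"
    by (subst emeasure_density) auto
  also have "\<dots> = (\<integral>\<^sup>+t. ennreal (f t) * indicator {a..b} t \<partial>lborel)"
  proof (rule nn_integral_cong_AE)
    show "AE t in lborel. ennreal (f t) * indicator {a<..b} t = ennreal (f t) * indicator {a..b} t"
      using AE_lborel_singleton[of a] by eventually_elim (auto split: split_indicator)
  qed
  also have "\<dots> = ennreal (F b - F a)"
    by (rule nn_integral_FTC_Icc) (use assms in \<open>auto intro: has_field_derivative_at_within\<close>)
  finally show ?thesis .
qed

lemma interval_measure_eq_density:
  fixes F f :: "real \<Rightarrow> real"
  assumes deriv: "\<And>x. (F has_real_derivative f x) (at x)" and nonneg: "\<And>x. 0 \<le> f x"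
    and [measurable]: "f \<in> borel_measurable borel"
  shows "interval_measure F = density lborel (\<lambda>x. ennreal (f x))"
proof (rule measure_eqI_generator_eq[where E = "range (\<lambda>(i, j). {i<..j::real})" and \<Omega> = UNIV
      and A = "\<lambda>i. {- real i<..real i}"])
  have mono: "F x \<le> F y" if "x \<le> y" for x y
    using that deriv nonneg by (intro DERIV_nonneg_imp_nondecreasing[of x y F]) auto
  have cont: "continuous (at_right x) F" for x
    using DERIV_isCont[OF deriv[of x]] continuous_within_subset[of x UNIV F "{x<..}"] by auto
  have measure_Ioc: "emeasure (interval_measure F) {x<..y} = ennreal (F y - F x)" if "x \<le> y" for x y
    by (rule emeasure_interval_measure_Ioc[OF that]) (use mono cont in auto)
  show "emeasure (interval_measure F) X = emeasure (density lborel (\<lambda>x. ennreal (f x))) X"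
    if "X \<in> range (\<lambda>(i, j). {i<..j::real})" for X
  proof -
    from that obtain i j where "X = {i<..j}" by auto
    then show ?thesis
      by (cases "i \<le> j") (simp_all add: measure_Ioc emeasure_density_Ioc_eq_diff[OF assms])
  qed
  show "Int_stable (range (\<lambda>(i, j). {i<..j::real}))"
    by (auto simp: Int_stable_def Int_greaterThanAtMost)
  show "sets (interval_measure F) = sigma_sets UNIV (range (\<lambda>(i, j). {i<..j::real}))"
    "sets (density lborel (\<lambda>x. ennreal (f x))) = sigma_sets UNIV (range (\<lambda>(i, j). {i<..j::real}))"
    by (simp_all add: borel_sigma_sets_Ioc)
  have "x \<in> (\<Union>i. {- real i<..real i})" for x :: real
  proof -
    obtain n :: nat where "\<bar>x\<bar> < real n" using reals_Archimedean2 by blast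
    then show ?thesis by (intro UN_I[of n]) auto
  qed
  then show "(\<Union>i. {- real i<..real i}) = (UNIV :: real set)" by blast
  show "emeasure (interval_measure F) {- real i<..real i} \<noteq> \<infinity>" for i by (subst measure_Ioc) auto
qed auto

lemma has_real_derivative_max_0_powr:
  fixes p x :: real
  assumes p: "p > 1"
  shows "((\<lambda>x. max 0 x powr p) has_real_derivative p * max 0 x powr (p - 1)) (at x)"
proof (cases x "0 :: real" rule: linorder_cases)
  case less
  have "((\<lambda>x. max 0 x powr p) has_real_derivative 0) (at x)"
    by (rule has_field_derivative_transform_within_open[where f = "\<lambda>x. 0" and S = "{..<0}"])
       (use less in auto)
  then show ?thesis using less p by simp
next
  case equal
  have "((\<lambda>h. max 0 h powr p / h) \<longlongrightarrow> 0) (at 0)"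
  proof (rule Lim_null_comparison)
    have "norm (max 0 h powr p / h) \<le> \<bar>h\<bar> powr (p - 1)" for h :: real
    proof (cases "h > 0")
      case True
      then show ?thesis by (simp add: powr_diff)
    qed simp
    then show "\<forall>\<^sub>F h in at 0. norm (max 0 h powr p / h) \<le> \<bar>h\<bar> powr (p - 1)"
      by (auto simp: eventually_at_filter)
    have "((\<lambda>h. \<bar>h :: real\<bar> powr (p - 1)) \<longlongrightarrow> \<bar>0\<bar> powr (p - 1)) (at 0)"
      by (rule tendsto_powr') (use p tendsto_rabs[OF tendsto_ident_at, of 0] in auto)
    then show "((\<lambda>h. \<bar>h :: real\<bar> powr (p - 1)) \<longlongrightarrow> 0) (at 0)" using p by simp
  qed
  then show ?thesis using equal p by (simp add: DERIV_def)
next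
  case greater
  have "((\<lambda>x. x powr p) has_real_derivative p * x powr (p - 1)) (at x)"
    by (rule has_real_derivative_powr[OF greater])
  then have "((\<lambda>x. max 0 x powr p) has_real_derivative p * x powr (p - 1)) (at x)"
    by (rule has_field_derivative_transform_within_open[where S = "{0<..}"]) (use greater in auto)
  then show ?thesis using greater by simp
qed

lemma nn_integral_powr_exp:
  fixes p a :: real
  assumes p: "p > 0" and a: "a > 0"
  shows "(\<integral>\<^sup>+x. ennreal (indicator {0..} x * x powr (p - 1) * exp (- a * x)) \<partial>lborel) =
      ennreal (Gamma p / a powr p)"
proof -
  let ?g = "\<lambda>t. indicator {0..} t * t powr (p - 1) / exp t"
  have scaled: "1 / a powr p * (a * ?g (a * x)) = indicator {0..} x * x powr (p - 1) * exp (- a * x)"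
    for x
  proof (cases "x \<ge> 0")
    case True
    then show ?thesis using a by (simp add: powr_mult powr_diff exp_minus field_simps)
  next
    case False
    then have "\<not> 0 \<le> a * x" using a by (simp add: zero_le_mult_iff)
    then show ?thesis using False by simp
  qed
  have ennreal_mult_scaled: "ennreal (1 / a powr p) * (ennreal a * ennreal y) =
      ennreal (1 / a powr p * (a * y))" for y
    using a by (simp only: ennreal_mult'[symmetric] less_imp_le zero_le_divide_1_iff powr_ge_zero)
  have "ennreal (Gamma p) = (\<integral>\<^sup>+t. ennreal (?g t) \<partial>lborel)"
    using Gamma_conv_nn_integral_real[OF p] by simp
  also have "\<dots> = ennreal \<bar>a\<bar> * (\<integral>\<^sup>+x. ennreal (?g (0 + a * x)) \<partial>lborel)"
    using a by (intro nn_integral_real_affine) auto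
  finally have "ennreal (1 / a powr p) * ennreal (Gamma p) =
      (\<integral>\<^sup>+x. ennreal (1 / a powr p) * (ennreal a * ennreal (?g (a * x))) \<partial>lborel)"
    using a by (simp add: nn_integral_cmult)
  also have "\<dots> = (\<integral>\<^sup>+x. ennreal (indicator {0..} x * x powr (p - 1) * exp (- a * x)) \<partial>lborel)"
    unfolding ennreal_mult_scaled scaled ..
  finally show ?thesis by (simp add: ennreal_mult'[symmetric])
qed

lemma Gamma_three_halves: "Gamma (3 / 2 :: real) = sqrt pi / 2"
proof -
  have "(1 / 2 :: real) \<notin> \<int>\<^sub>\<le>\<^sub>0" using nonpos_Ints_nonpos[of "1 / 2 :: real"] by auto
  from Gamma_plus1[OF this] show ?thesis by (simp add: Gamma_one_half_real)
qed

definition dos :: "real \<Rightarrow> real" where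
  "dos x = sqrt 2 / (2 * pi\<^sup>2) * max 0 x powr (1 / 2)"

lemma dos_nonneg: "0 \<le> dos x"
  by (simp add: dos_def)

lemma dos_measurable [measurable]: "dos \<in> borel_measurable borel"
  unfolding dos_def[abs_def] by measurable

lemma interval_measure_Fdos: "interval_measure Fdos = density lborel (\<lambda>x. ennreal (dos x))"
proof (rule interval_measure_eq_density)
  show "(Fdos has_real_derivative dos x) (at x)" for x
    unfolding Fdos_def[abs_def]
    using DERIV_cmult[OF has_real_derivative_max_0_powr[of "3 / 2" x], of "sqrt 2 / (3 * pi\<^sup>2)"]
    by (simp add: dos_def mult.commute)
qed (auto simp: dos_nonneg)

lemma nn_integral_dos_exp:
  assumes a: "a > 0"
  shows "(\<integral>\<^sup>+x. ennreal (indicator {0<..} x * dos x * exp (- a * x)) \<partial>lborel) =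
    ennreal (sqrt 2 / (2 * pi\<^sup>2) * (sqrt pi / 2) / a powr (3 / 2))"
proof -
  let ?c = "sqrt 2 / (2 * pi\<^sup>2)"
  have "(\<integral>\<^sup>+x. ennreal (indicator {0<..} x * dos x * exp (- a * x)) \<partial>lborel) =
      (\<integral>\<^sup>+x. ennreal ?c * ennreal (indicator {0..} x * x powr (3 / 2 - 1) * exp (- a * x)) \<partial>lborel)"
    by (intro nn_integral_cong)
       (auto simp: dos_def indicator_def ennreal_mult'[symmetric] split: if_splits)
  also have "\<dots> = ennreal ?c * ennreal (Gamma (3 / 2) / a powr (3 / 2))"
    using nn_integral_powr_exp[of "3 / 2" a] a by (simp add: nn_integral_cmult)
  finally show ?thesis by (simp add: Gamma_three_halves ennreal_mult'[symmetric])
qed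

lemma rho_c_eq_nn_integral:
  assumes "\<beta> > 0"
  shows "rho_c \<beta> = enn2real (\<integral>\<^sup>+x. ennreal (indicator {0<..} x * dos x * bose_factor (\<beta> * x)) \<partial>lborel)"
proof -
  have "rho_c \<beta> = (\<integral>x. indicator {0<..} x *\<^sub>R inverse (exp (\<beta> * x) - 1)
      \<partial>density lborel (\<lambda>x. ennreal (dos x)))"
    by (simp add: rho_c_def set_lebesgue_integral_def interval_measure_Fdos)
  also have "\<dots> = (\<integral>x. dos x *\<^sub>R (indicator {0<..} x *\<^sub>R inverse (exp (\<beta> * x) - 1)) \<partial>lborel)"
    by (rule integral_density) (use dos_nonneg in auto)
  also have "\<dots> = (\<integral>x. indicator {0<..} x * dos x * bose_factor (\<beta> * x) \<partial>lborel)"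
    by (intro Bochner_Integration.integral_cong) (auto simp: bose_factor_def inverse_eq_divide)
  also have "\<dots> = enn2real (\<integral>\<^sup>+x. ennreal (indicator {0<..} x * dos x * bose_factor (\<beta> * x)) \<partial>lborel)"
    by (rule integral_eq_nn_integral)
       (use dos_nonneg assms in \<open>auto simp: bose_factor_def[abs_def] indicator_def\<close>)
  finally show ?thesis .
qed

context slab_box
begin

lemma excited_limit_eq:
  assumes "\<beta> > 0" "\<kappa> = \<beta> * pi\<^sup>2 / 2"
  shows "excited_limit k = sqrt 2 / (2 * pi\<^sup>2) * (sqrt pi / 2) / (real (Suc k) * \<beta>) powr (3 / 2)"
proof -
  define a where "a = real (Suc k) * \<beta>"
  have a: "a > 0" using assms(1) by (simp add: a_def)
  have cube: "(p * t / (2 * (q * c))) ^ 3 = (p * (p * p) * (t * (t * t))) / (8 * (q * (q * q) * c ^ 3))"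
    for p t q c :: real
    by (simp add: power_divide power_mult_distrib power3_eq_cube mult_ac)
  have powr: "a powr (3 / 2) = a * sqrt a"
    using a powr_add[of a 1 "1 / 2"] by (simp add: powr_half_sqrt)
  have "real (Suc k) * \<kappa> = a * pi\<^sup>2 / 2" by (simp add: a_def assms(2))
  then have "sqrt (bose_scale k) = sqrt (a * pi\<^sup>2 / 2)" by (simp only: bose_scale_def)
  also have "\<dots> = sqrt a * pi / sqrt 2" by (simp add: real_sqrt_mult real_sqrt_divide)
  finally have "excited_limit k = (sqrt pi * sqrt 2 / (2 * (sqrt a * pi))) ^ 3"
    by (simp add: excited_limit_def)
  also have "\<dots> = (sqrt pi * (sqrt pi * sqrt pi) * (sqrt 2 * (sqrt 2 * sqrt 2))) /
      (8 * (sqrt a * (sqrt a * sqrt a) * pi ^ 3))"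
    by (rule cube)
  also have "\<dots> = (sqrt pi * pi * (sqrt 2 * 2)) / (8 * (sqrt a * a * pi ^ 3))" using a by simp
  also have "\<dots> = sqrt 2 / (2 * pi\<^sup>2) * (sqrt pi / 2) / (a * sqrt a)"
    using a by (simp add: field_simps power2_eq_square power3_eq_cube)
  finally show ?thesis unfolding a_def[symmetric] powr .
qed

lemma rho_c_eq:
  assumes \<beta>: "\<beta> > 0" "\<kappa> = \<beta> * pi\<^sup>2 / 2"
  shows "rho_c \<beta> = critical_density"
proof -
  let ?t = "\<lambda>k x. indicator {0<..} x * dos x * exp (- (real (Suc k) * \<beta>) * x)"
  have expansion: "ennreal (indicator {0<..} x * dos x * bose_factor (\<beta> * x)) = (\<Sum>k. ennreal (?t k x))"
    for x
  proof (cases "x > 0")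
    case True
    have "(\<lambda>k. dos x * exp (- real (Suc k) * (\<beta> * x))) sums (dos x * bose_factor (\<beta> * x))"
      using True \<beta>(1) by (intro sums_mult bose_factor_sums) auto
    moreover have "- real (Suc k) * (\<beta> * x) = - (real (Suc k) * \<beta>) * x" for k
      by (simp add: algebra_simps)
    ultimately have "(\<lambda>k. ?t k x) sums (dos x * bose_factor (\<beta> * x))"
      using True by (simp only: indicator_simps greaterThan_iff mult_1)
    then have "(\<lambda>k. ennreal (?t k x)) sums ennreal (dos x * bose_factor (\<beta> * x))"
      using dos_nonneg bose_factor_bounds(1)[of "\<beta> * x"] \<beta>(1) True by (subst sums_ennreal) auto
    then show ?thesis using True by (simp add: sums_iff)
  qed simp
  have "(\<integral>\<^sup>+x. ennreal (indicator {0<..} x * dos x * bose_factor (\<beta> * x)) \<partial>lborel) =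
      (\<Sum>k. \<integral>\<^sup>+x. ennreal (?t k x) \<partial>lborel)"
    unfolding expansion by (rule nn_integral_suminf) auto
  also have "\<dots> = (\<Sum>k. ennreal (excited_limit k))"
    unfolding excited_limit_eq[OF \<beta>] using \<beta>(1) by (intro suminf_cong nn_integral_dos_exp) simp
  also have "\<dots> = ennreal critical_density"
    unfolding critical_density_def
    by (intro suminf_ennreal2 excited_limit_nonneg summable_excited_limit)
  finally show ?thesis
    by (simp add: rho_c_eq_nn_integral[OF \<beta>(1)] critical_density_nonneg)
qed

end

subsection \<open>The grand canonical particle density\<close>

locale observed_mode = slab_box \<kappa> a2 a3 + soft_modes \<kappa> n
  for \<kappa> a2 a3 :: real and n :: nat
begin

definition other_modes :: "(nat \<times> nat \<times> nat) set" where
  "other_modes = modes - {(n, 1, 1)}"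

definition fugacity :: "real \<Rightarrow> nat \<times> nat \<times> nat \<Rightarrow> real" where
  "fugacity V q = exp (- excess_energy V q)"

lemma other_modes_eq: "other_modes = (\<lambda>m. (m, 1, 1)) ` ({1..} - {n}) \<union> excited"
  by (auto simp: other_modes_def modes_def excited_def)

lemma soft_disjoint_excited: "(\<lambda>m. (m, 1, 1)) ` ({1..} - {n}) \<inter> excited = {}"
  by (auto simp: excited_def)

lemma excess_energy_other_pos: "V > 0 \<Longrightarrow> q \<in> other_modes \<Longrightarrow> excess_energy V q > 0"
  by (rule excess_energy_pos) (auto simp: other_modes_def)

lemma bose_factor_summable_on_other_modes:
  assumes V: "V > 0"
  shows "(\<lambda>q. bose_factor (excess_energy V q)) summable_on other_modes"
  unfolding other_modes_eq
proof (rule summable_on_Un_disjoint[OF _ _ soft_disjoint_excited])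
  let ?u = "\<lambda>q. bose_factor (excess_energy V q)"
  have "summable (\<lambda>m. V / \<kappa> * (1 / real m ^ 2))"
    by (rule summable_mult[OF summable_inverse_squares_real])
  then have "(\<lambda>m. V / \<kappa> * (1 / real m ^ 2)) summable_on UNIV"
    using V \<kappa> by (intro summable_nonneg_imp_summable_on) auto
  then have "(\<lambda>m. V / \<kappa> * (1 / real m ^ 2)) summable_on {1..} - {n}"
    by (rule summable_on_subset_banach) auto
  then have "(\<lambda>m. ?u (m, 1, 1)) summable_on {1..} - {n}"
  proof (rule summable_on_comparison_test)
    fix m assume "m \<in> {1..} - {n}"
    then have pos: "rate \<kappa> m / V > 0" using rate_pos[OF \<kappa>] V by simp
    show "?u (m, 1, 1) \<le> V / \<kappa> * (1 / real m ^ 2)" "0 \<le> ?u (m, 1, 1)"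
      using bose_factor_bounds[OF pos] unfolding excess_energy_soft by (simp_all add: rate_def)
  qed
  then show "?u summable_on (\<lambda>m. (m, 1, 1)) ` ({1..} - {n})"
    by (subst summable_on_reindex) (auto simp: inj_on_def o_def)
  show "?u summable_on excited" using bose_factor_excited_has_sum[OF V] by (rule has_sum_imp_summable)
qed

lemma geometric_occupations_fugacity:
  assumes V: "V > 0"
  shows "geometric_occupations (fugacity V) other_modes"
proof
  fix q assume q: "q \<in> other_modes"
  show "0 \<le> fugacity V q" "fugacity V q < 1"
    using excess_energy_other_pos[OF V q] by (auto simp: fugacity_def)
next
  show "(\<lambda>q. - ln (1 - fugacity V q)) summable_on other_modes"
  proof (rule summable_on_comparison_test[OF bose_factor_summable_on_other_modes[OF V]])
    fix q assume "q \<in> other_modes"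
    note pos = excess_energy_other_pos[OF V this]
    have "1 + bose_factor (excess_energy V q) = 1 / (1 - fugacity V q)"
      unfolding fugacity_def bose_factor_eq[OF pos, symmetric] using pos by (simp add: field_simps)
    then have "- ln (1 - fugacity V q) = ln (1 + bose_factor (excess_energy V q))"
      using pos by (simp add: ln_div fugacity_def)
    then show "- ln (1 - fugacity V q) \<le> bose_factor (excess_energy V q)" "0 \<le> - ln (1 - fugacity V q)"
      using ln_add_one_self_le_self[of "bose_factor (excess_energy V q)"] bose_factor_bounds(1)[OF pos]
      by auto
  qed
qed

definition density_law :: "real \<Rightarrow> real measure" where
  "density_law V =
     distr (measure_pmf (geometric_occupations.occupation_pmf (fugacity V) other_modes)) borel
       (\<lambda>M. real (size M) / V)"

lemma real_distribution_density_law: "real_distribution (density_law V)"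
  unfolding density_law_def
  by (intro prob_space.real_distribution_distr measure_pmf.prob_space_axioms) simp

lemma AE_density_law_nonneg: "V > 0 \<Longrightarrow> AE x in density_law V. 0 \<le> x"
  unfolding density_law_def by (subst AE_distr_iff) auto

lemma density_law_laplace:
  assumes V: "V > 0" and s: "s \<ge> 0"
  shows "(\<integral>x. exp (- s * x) \<partial>density_law V) = exp (- infsum (ln_factor s V) other_modes)"
proof -
  interpret geometric_occupations "fugacity V" other_modes
    by (rule geometric_occupations_fugacity[OF V])
  have "(\<integral>x. exp (- s * x) \<partial>density_law V) =
      measure_pmf.expectation occupation_pmf (\<lambda>M. exp (- s / V) ^ size M)"
    unfolding density_law_def by (subst integral_distr) (simp_all add: mult_ac flip: exp_of_nat_mult)
  also have "\<dots> = exp (- infsum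
      (\<lambda>q. ln (1 + fugacity V q / (1 - fugacity V q) * (1 - exp (- s / V)))) other_modes)"
    using V s by (intro expectation_power_size) auto
  also have "infsum (\<lambda>q. ln (1 + fugacity V q / (1 - fugacity V q) * (1 - exp (- s / V)))) other_modes =
      infsum (ln_factor s V) other_modes"
    using V by (intro infsum_cong)
       (simp add: ln_factor_def fugacity_def bose_factor_eq excess_energy_other_pos)
  finally show ?thesis .
qed

subsection \<open>Limit of the particle density\<close>

definition soft_ln_term :: "real \<Rightarrow> real \<Rightarrow> nat \<Rightarrow> real" where
  "soft_ln_term s V m = (if m = 0 \<or> m = n then 0 else ln_factor s V (m, 1, 1))"

lemma soft_ln_term_bounds:
  assumes V: "V > 0" and s: "s \<ge> 0"
  shows "0 \<le> soft_ln_term s V m" "soft_ln_term s V m \<le> s / \<kappa> * (1 / real m ^ 2)"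
proof -
  let ?z = "1 - exp (- s / V)"
  have "0 \<le> ln_factor s V (m, 1, 1) \<and> ln_factor s V (m, 1, 1) \<le> s / \<kappa> * (1 / real m ^ 2)" if "m \<ge> 1"
  proof -
    have pos: "rate \<kappa> m / V > 0" using rate_pos[OF \<kappa> that] V by simp
    have z: "0 \<le> ?z" "?z \<le> s / V"
      using exp_ge_add_one_self[of "- s / V"] s V by auto
    have nonneg: "0 \<le> bose_factor (rate \<kappa> m / V) * ?z" using bose_factor_bounds(1)[OF pos] z by simp
    have "bose_factor (rate \<kappa> m / V) * ?z \<le> 1 / (rate \<kappa> m / V) * (s / V)"
      using bose_factor_bounds[OF pos] z pos by (intro mult_mono) auto
    also have "\<dots> = s / \<kappa> * (1 / real m ^ 2)" using V by (simp add: rate_def)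
    finally show ?thesis
      using nonneg ln_add_one_self_le_self[OF nonneg] unfolding ln_factor_def excess_energy_soft by auto
  qed
  then show "0 \<le> soft_ln_term s V m" "soft_ln_term s V m \<le> s / \<kappa> * (1 / real m ^ 2)"
    using s \<kappa> by (auto simp: soft_ln_term_def)
qed

lemma summable_soft_ln_term:
  assumes "V > 0" "s \<ge> 0"
  shows "summable (soft_ln_term s V)"
  by (rule summable_comparison_test'[OF summable_mult[OF summable_inverse_squares_real, of "s / \<kappa>"]])
     (use soft_ln_term_bounds[OF assms] in simp)

lemma soft_ln_term_tendsto:
  assumes s: "s \<ge> 0"
  shows "((\<lambda>V. soft_ln_term s V m) \<longlongrightarrow> soft_exponent_term s m) at_top"
proof (cases "m = 0 \<or> m = n")
  case True
  then show ?thesis by (auto simp: soft_ln_term_def soft_exponent_term_def)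
next
  case False
  then have pos: "rate \<kappa> m > 0" using rate_pos[OF \<kappa>] by simp
  have "((\<lambda>V. bose_factor (c / V) * (1 - exp (- s / V))) \<longlongrightarrow> s / c) at_top" if "c > 0" for c
  proof (cases "s = 0")
    case False
    then have "((\<lambda>V. 1 / (exp (c / V) - 1) * (1 - exp (- s / V))) \<longlongrightarrow> inverse c * s) at_top"
      using s that by real_asymp
    then show ?thesis unfolding bose_factor_def by (simp add: divide_inverse mult.commute)
  qed simp
  from tendsto_ln[OF tendsto_add[OF tendsto_const[of 1] this[OF pos]]]
  have "((\<lambda>V. ln (1 + bose_factor (rate \<kappa> m / V) * (1 - exp (- s / V)))) \<longlongrightarrow>
      ln (1 + s / rate \<kappa> m)) at_top"
    using s pos by (simp add: add_pos_nonneg less_imp_neq[THEN not_sym])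
  then show ?thesis
    using False
    by (simp add: soft_ln_term_def soft_exponent_term_def ln_factor_def excess_energy_soft[simplified])
qed

lemma suminf_soft_ln_term_tendsto:
  assumes s: "s \<ge> 0"
  shows "((\<lambda>V. \<Sum>m. soft_ln_term s V m) \<longlongrightarrow> soft_exponent s) at_top"
  unfolding soft_exponent_def
proof (rule tendsto_suminf_dominated[OF soft_ln_term_tendsto[OF s]])
  show "\<forall>\<^sub>F V in at_top. \<forall>m. \<bar>soft_ln_term s V m\<bar> \<le> s / \<kappa> * (1 / real m ^ 2)"
    using eventually_gt_at_top[of 0] by eventually_elim (use soft_ln_term_bounds s in simp)
  show "summable (\<lambda>m. s / \<kappa> * (1 / real m ^ 2))"
    by (rule summable_mult[OF summable_inverse_squares_real])
qed simp

lemma infsum_ln_factor_eq: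
  assumes V: "V > 0" and s: "s \<ge> 0"
  shows "infsum (ln_factor s V) other_modes = (\<Sum>m. soft_ln_term s V m) + infsum (ln_factor s V) excited"
proof -
  let ?soft = "(\<lambda>m. (m, 1, 1)) ` ({1..} - {n})"
  have "ln_factor s V summable_on other_modes"
  proof (rule summable_on_comparison_test[OF bose_factor_summable_on_other_modes[OF V]])
    fix q assume "q \<in> other_modes"
    note bose = bose_factor_bounds(1)[OF excess_energy_other_pos[OF V this]]
    have "0 \<le> bose_factor (excess_energy V q) * (1 - exp (- s / V))"
      "bose_factor (excess_energy V q) * (1 - exp (- s / V)) \<le> bose_factor (excess_energy V q)"
      using bose s V by (auto simp: mult_left_le)
    then show "ln_factor s V q \<le> bose_factor (excess_energy V q)" "0 \<le> ln_factor s V q"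
      using ln_add_one_self_le_self[of "bose_factor (excess_energy V q) * (1 - exp (- s / V))"]
      by (auto simp: ln_factor_def)
  qed
  then have "ln_factor s V summable_on ?soft" "ln_factor s V summable_on excited"
    by (rule summable_on_subset_banach; auto simp: other_modes_eq)+
  then have "infsum (ln_factor s V) other_modes =
      infsum (ln_factor s V) ?soft + infsum (ln_factor s V) excited"
    unfolding other_modes_eq by (rule infsum_Un_disjoint[OF _ _ soft_disjoint_excited])
  also have "infsum (ln_factor s V) ?soft = infsum (\<lambda>m. ln_factor s V (m, 1, 1)) ({1..} - {n})"
    by (subst infsum_reindex) (auto simp: inj_on_def o_def)
  also have "\<dots> = infsum (soft_ln_term s V) UNIV"
    by (rule infsum_cong_neutral) (auto simp: soft_ln_term_def)
  also have "\<dots> = (\<Sum>m. soft_ln_term s V m)"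
    by (intro infsumI sums_nonneg_imp_has_sum summable_sums summable_soft_ln_term
        soft_ln_term_bounds V s)
  finally show ?thesis .
qed

lemma infsum_ln_factor_tendsto:
  assumes s: "s \<ge> 0"
  shows "((\<lambda>V. infsum (ln_factor s V) other_modes) \<longlongrightarrow> soft_exponent s + s * critical_density) at_top"
proof (rule Lim_transform_eventually)
  show "((\<lambda>V. (\<Sum>m. soft_ln_term s V m) + infsum (ln_factor s V) excited) \<longlongrightarrow>
      soft_exponent s + s * critical_density) at_top"
    by (intro tendsto_add suminf_soft_ln_term_tendsto infsum_ln_factor_excited_tendsto s)
  show "\<forall>\<^sub>F V in at_top. (\<Sum>m. soft_ln_term s V m) + infsum (ln_factor s V) excited =
      infsum (ln_factor s V) other_modes"
    using eventually_gt_at_top[of 0] by eventually_elim (use infsum_ln_factor_eq s in simp)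
qed

definition limit_law :: "real measure" where
  "limit_law = distr soft_law borel (\<lambda>y. y + critical_density)"

lemma real_distribution_limit_law: "real_distribution limit_law"
  unfolding limit_law_def by (intro soft_law.real_distribution_distr) simp

lemma AE_limit_law_nonneg: "AE x in limit_law. 0 \<le> x"
  unfolding limit_law_def using AE_soft_law_pos critical_density_nonneg
  by (subst AE_distr_iff) (auto elim: eventually_mono)

lemma limit_law_laplace:
  assumes "s \<ge> 0"
  shows "(\<integral>x. exp (- s * x) \<partial>limit_law) = exp (- (soft_exponent s + s * critical_density))"
proof -
  have "(\<integral>x. exp (- s * x) \<partial>limit_law) =
      (\<integral>y. exp (- s * critical_density) * exp (- s * y) \<partial>soft_law)"
    unfolding limit_law_def by (subst integral_distr) (simp_all add: algebra_simps flip: exp_add)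
  also have "\<dots> = exp (- s * critical_density) * exp (- soft_exponent s)"
    using soft_law_laplace[OF assms] by (simp add: has_bochner_integral_iff)
  finally show ?thesis by (simp add: algebra_simps flip: exp_add)
qed

lemma measure_limit_law_singleton: "measure limit_law {c} = 0"
proof -
  have "emeasure soft_law {d} = 0" for d
    unfolding soft_law_def
    by (subst emeasure_density) (auto intro!: nn_integral_null_set simp: null_sets_def)
  moreover have "(\<lambda>y. y + critical_density) -` {c} = {c - critical_density}" by auto
  ultimately show ?thesis
    unfolding limit_law_def measure_def by (subst emeasure_distr) auto
qed

theorem density_law_weak_conv:
  assumes "\<And>N. V N > 0" "filterlim V at_top sequentially"
  shows "weak_conv_m (\<lambda>N. density_law (V N)) limit_law"
proof (rule laplace_convergence_imp_weak_conv_m)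
  fix k :: nat
  have "(\<lambda>N. exp (- infsum (ln_factor (real k) (V N)) other_modes)) \<longlonglongrightarrow>
      exp (- (soft_exponent (real k) + real k * critical_density))"
    by (intro tendsto_exp tendsto_minus filterlim_compose[OF infsum_ln_factor_tendsto assms(2)]) simp
  then show "(\<lambda>N. \<integral>x. exp (- real k * x) \<partial>density_law (V N)) \<longlonglongrightarrow> (\<integral>x. exp (- real k * x) \<partial>limit_law)"
    by (simp only: density_law_laplace[OF assms(1) of_nat_0_le_iff]
       limit_law_laplace[OF of_nat_0_le_iff])
qed (intro real_distribution_density_law AE_density_law_nonneg assms
    real_distribution_limit_law AE_limit_law_nonneg)+

subsection \<open>The canonical expectation\<close>

lemma truncated_exp_limit_law:
  "truncated_exp limit_law c lam = truncated_exp soft_law (c - critical_density) lam"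
  unfolding truncated_exp_def limit_law_def
  by (subst integral_distr)
     (auto intro!: Bochner_Integration.integral_cong simp: indicator_def algebra_simps)

lemma truncated_exp_density_law_tendsto:
  assumes "\<And>N. V N > 0" "filterlim V at_top sequentially" "lam \<ge> 0"
  shows "(\<lambda>N. truncated_exp (density_law (V N)) c lam) \<longlonglongrightarrow> truncated_exp limit_law c lam"
  unfolding truncated_exp_def
proof (rule weak_conv_m_imp_integral_atMost_conv)
  show "weak_conv_m (\<lambda>N. density_law (V N)) limit_law"
    using assms(1,2) by (rule density_law_weak_conv)
  show "\<bar>exp (- (lam + rate \<kappa> n) * (c - x))\<bar> \<le> 1" if "x \<le> c" for x
    using truncated_exp_integrand_le_1[OF assms(3) that] by simp
qed (auto intro!: continuous_intros real_distribution_density_law real_distribution_limit_law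
    measure_limit_law_singleton)

definition transverse_ground_factor :: "real \<Rightarrow> real" where
  "transverse_ground_factor V = exp (- \<kappa> * (V powr (-2 * a2) + V powr (-2 * a3)))"

lemma gibbs_eq_mset_weight:
  assumes \<beta>: "\<kappa> = \<beta> * pi\<^sup>2 / 2" and V: "V > 0"
  shows "gibbs \<beta> (1/2) a2 a3 V M = transverse_ground_factor V ^ size M * mset_weight (fugacity V) M"
proof (induction M)
  case empty
  then show ?case by (simp add: gibbs_def energy_def mset_weight_def)
next
  case (add q M)
  let ?d = "V powr (-2 * a2) + V powr (-2 * a3)"
  obtain n1 n2 n3 where q: "q = (n1, n2, n3)" by (cases q)
  have scale: "\<beta> * (pi\<^sup>2 / 2 * x) = \<kappa> * x" for x by (simp add: \<beta>)
  have "\<beta> * eps_box (1/2) a2 a3 V q = \<kappa> * ?d + excess_energy V q"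
    unfolding q eps_box_def excess_energy_def prod.case scale
    using V
    by (simp add: rate_def powr_minus_divide algebra_simps add_divide_distrib diff_divide_distrib)
  then have "exp (- \<beta> * eps_box (1/2) a2 a3 V q) = transverse_ground_factor V * fugacity V q"
    by (simp add: fugacity_def transverse_ground_factor_def flip: exp_add)
  moreover have "gibbs \<beta> (1/2) a2 a3 V (add_mset q M) =
      exp (- \<beta> * eps_box (1/2) a2 a3 V q) * gibbs \<beta> (1/2) a2 a3 V M"
    by (simp add: gibbs_def energy_def algebra_simps flip: exp_add)
  ultimately show ?case using add by (simp add: mset_weight_def mult_ac)
qed

lemma nstates_eq: "nstates N = {M \<in> msets_over (insert (n, 1, 1) other_modes). size M = N}"
  using n by (auto simp: nstates_def msets_over_def other_modes_def modes_def)

lemma expectation_completion_eq_truncated_exp: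
  assumes V: "V > 0"
  shows "measure_pmf.expectation (geometric_occupations.occupation_pmf (fugacity V) other_modes)
      (\<lambda>M. if size M \<le> N
        then exp (- lam * real (N - size M) / V) * fugacity V (n, 1, 1) ^ (N - size M) else 0) =
    truncated_exp (density_law V) (real N / V) lam"
proof -
  have power: "fugacity V (n, 1, 1) ^ j = exp (- rate \<kappa> n * real j / V)" for j
    unfolding fugacity_def excess_energy_soft by (simp add: mult.commute flip: exp_of_nat_mult)
  have "(if k \<le> N then exp (- lam * real (N - k) / V) * fugacity V (n, 1, 1) ^ (N - k) else 0) =
      indicator {..real N / V} (real k / V) *
        exp (- (lam + rate \<kappa> n) * (real N / V - real k / V))" for k
    unfolding power using V
    by (auto simp: indicator_def divide_right_mono divide_le_cancel of_nat_diff algebra_simps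
        add_divide_distrib diff_divide_distrib simp flip: exp_add)
  then show ?thesis
    unfolding truncated_exp_def density_law_def by (subst integral_distr) simp_all
qed

lemma canonical_sum_eq_truncated_exp:
  assumes \<beta>: "\<kappa> = \<beta> * pi\<^sup>2 / 2" and V: "V > 0"
  shows "infsum (\<lambda>M. exp (- lam * real (count M (n, 1, 1)) / V) * gibbs \<beta> (1/2) a2 a3 V M) (nstates N) =
    transverse_ground_factor V ^ N *
      (geometric_occupations.normalization (fugacity V) other_modes *
       truncated_exp (density_law V) (real N / V) lam)"
proof -
  interpret geometric_occupations "fugacity V" other_modes
    by (rule geometric_occupations_fugacity[OF V])
  let ?c = "transverse_ground_factor V ^ N"
  let ?g = "\<lambda>j. exp (- lam * real j / V)"
  have "infsum (\<lambda>M. ?g (count M (n, 1, 1)) * gibbs \<beta> (1/2) a2 a3 V M) (nstates N) =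
      infsum (\<lambda>M. ?c * (?g (count M (n, 1, 1)) * mset_weight (fugacity V) M)) (nstates N)"
    by (intro infsum_cong) (auto simp: gibbs_eq_mset_weight[OF \<beta> V] nstates_def)
  also have "\<dots> = ?c * infsum (\<lambda>M. ?g (count M (n, 1, 1)) * mset_weight (fugacity V) M) (nstates N)"
    by (rule infsum_cmult_right')
  also have "infsum (\<lambda>M. ?g (count M (n, 1, 1)) * mset_weight (fugacity V) M) (nstates N) =
      normalization * measure_pmf.expectation occupation_pmf
        (\<lambda>M. if size M \<le> N then ?g (N - size M) * fugacity V (n, 1, 1) ^ (N - size M) else 0)"
    unfolding nstates_eq by (rule infsum_fixed_size_eq_expectation) (simp add: other_modes_def)
  finally show ?thesis by (simp only: expectation_completion_eq_truncated_exp[OF V])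
qed

lemma canon_state_eq_truncated_exp:
  assumes \<beta>: "\<kappa> = \<beta> * pi\<^sup>2 / 2" and V: "V > 0"
  shows "canon_state \<beta> (1/2) a2 a3 V N (\<lambda>M. exp (- lam * real (count M (n, 1, 1)) / V)) =
    truncated_exp (density_law V) (real N / V) lam / truncated_exp (density_law V) (real N / V) 0"
proof -
  have "canon_Z \<beta> (1/2) a2 a3 V N = transverse_ground_factor V ^ N *
      (geometric_occupations.normalization (fugacity V) other_modes *
       truncated_exp (density_law V) (real N / V) 0)"
    using canonical_sum_eq_truncated_exp[OF assms, of 0] by (simp add: canon_Z_def)
  moreover have "transverse_ground_factor V \<noteq> 0" by (simp add: transverse_ground_factor_def)
  moreover have "geometric_occupations.normalization (fugacity V) other_modes \<noteq> 0"
    using geometric_occupations.normalization_pos[OF geometric_occupations_fugacity[OF V]] by simp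
  ultimately show ?thesis
    unfolding canon_state_def canonical_sum_eq_truncated_exp[OF assms] by simp
qed

theorem canon_at_density_tendsto:
  assumes \<beta>: "\<beta> > 0" "\<kappa> = \<beta> * pi\<^sup>2 / 2" and \<rho>: "\<rho> > rho_c \<beta>" and lam: "lam \<ge> 0"
  shows "(\<lambda>N. canon_at_density \<beta> (1/2) a2 a3 \<rho> N
      (\<lambda>M. exp (- lam * real (count M (n, 1, 1)) / (real N / \<rho>)))) \<longlonglongrightarrow>
    truncated_exp soft_law (\<rho> - rho_c \<beta>) lam / truncated_exp soft_law (\<rho> - rho_c \<beta>) 0"
proof (rule LIMSEQ_imp_Suc)
  define V where "V N = real (Suc N) / \<rho>" for N
  have \<rho>0: "\<rho> > 0" using \<rho> critical_density_nonneg by (simp add: rho_c_eq[OF \<beta>])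
  then have V: "V N > 0" for N by (simp add: V_def)
  have Vlim: "filterlim V at_top sequentially" unfolding V_def[abs_def] using \<rho>0 by real_asymp
  have limit: "truncated_exp limit_law \<rho> l = truncated_exp soft_law (\<rho> - rho_c \<beta>) l" for l
    unfolding truncated_exp_limit_law rho_c_eq[OF \<beta>] ..
  have "truncated_exp soft_law (\<rho> - rho_c \<beta>) 0 \<noteq> 0"
    using truncated_exp_soft_law_pos[of "\<rho> - rho_c \<beta>" 0] \<rho> by simp
  then have "(\<lambda>N. truncated_exp (density_law (V N)) \<rho> lam / truncated_exp (density_law (V N)) \<rho> 0) \<longlonglongrightarrow>
      truncated_exp soft_law (\<rho> - rho_c \<beta>) lam / truncated_exp soft_law (\<rho> - rho_c \<beta>) 0"
    unfolding limit[symmetric] using lam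
    by (intro tendsto_divide truncated_exp_density_law_tendsto V Vlim) auto
  moreover have "canon_at_density \<beta> (1/2) a2 a3 \<rho> (Suc N)
      (\<lambda>M. exp (- lam * real (count M (n, 1, 1)) / (real (Suc N) / \<rho>))) =
      truncated_exp (density_law (V N)) \<rho> lam / truncated_exp (density_law (V N)) \<rho> 0" for N
  proof -
    have "real (Suc N) / V N = \<rho>" using \<rho>0 by (simp add: V_def)
    then show ?thesis
      using canon_state_eq_truncated_exp[OF \<beta>(2) V, of N "Suc N" lam]
      by (simp only: canon_at_density_def V_def[symmetric])
  qed
  ultimately show "(\<lambda>N. canon_at_density \<beta> (1/2) a2 a3 \<rho> (Suc N)
      (\<lambda>M. exp (- lam * real (count M (n, 1, 1)) / (real (Suc N) / \<rho>)))) \<longlonglongrightarrow>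
    truncated_exp soft_law (\<rho> - rho_c \<beta>) lam / truncated_exp soft_law (\<rho> - rho_c \<beta>) 0"
    by (simp only:)
qed

end

theorem theorem3p10:
  fixes \<alpha>2 \<alpha>3 \<beta> \<rho> lam :: real and n :: nat
  assumes "\<alpha>2 \<le> 1/2" and "\<alpha>3 \<le> \<alpha>2" and "0 < \<alpha>3" and "1/2 + \<alpha>2 + \<alpha>3 = 1"
    and "0 < \<beta>" and "\<rho> > rho_c \<beta>" and "1 \<le> n" and "0 < lam"
    and "\<forall>m. 1 \<le> m \<and> m \<noteq> n \<longrightarrow> eta \<beta> m n \<noteq> lam"
  shows "\<exists>Num Den.
    abel_sums (\<lambda>m. if m = 0 \<or> m = n then 0 else
        bcoef \<beta> m n * (eta \<beta> m n)^2 / (eta \<beta> m n - lam) *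
        (exp (- lam * (\<rho> - rho_c \<beta>)) - exp (- eta \<beta> m n * (\<rho> - rho_c \<beta>)))) Num \<and>
    abel_sums (\<lambda>m. if m = 0 \<or> m = n then 0 else
        bcoef \<beta> m n * eta \<beta> m n * (1 - exp (- eta \<beta> m n * (\<rho> - rho_c \<beta>)))) Den \<and>
    ((\<lambda>N. canon_at_density \<beta> (1/2) \<alpha>2 \<alpha>3 \<rho> N
            (\<lambda>M. exp (- lam * real (count M (n, 1, 1)) / (real N / \<rho>))))
       \<longlonglongrightarrow> Num / Den)"
proof -
  define \<kappa> where "\<kappa> = \<beta> * pi\<^sup>2 / 2"
  interpret observed_mode \<kappa> \<alpha>2 \<alpha>3 n
    by unfold_locales (use assms in \<open>auto simp: \<kappa>_def\<close>)
  define r where "r = \<rho> - rho_c \<beta>"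
  have r: "r > 0" using assms by (simp add: r_def)
  let ?Num = "series_factor r * truncated_exp soft_law r lam"
  let ?Den = "series_factor r * truncated_exp soft_law r 0"
  have num: "abel_sums (\<lambda>m. series_factor r * soft_term lam r m) ?Num"
    using assms r
    by (intro abel_sums_cmult truncated_exp_soft_law_abel_sums) (auto simp flip: eta_eq_rate_gap[OF \<kappa>_def])
  have den: "abel_sums (\<lambda>m. series_factor r * soft_term 0 r m) ?Den"
    using r rate_gap_neq_0 by (intro abel_sums_cmult truncated_exp_soft_law_abel_sums) auto
  have "series_factor r \<noteq> 0" by (simp add: series_factor_def)
  then have "(\<lambda>N. canon_at_density \<beta> (1/2) \<alpha>2 \<alpha>3 \<rho> N
      (\<lambda>M. exp (- lam * real (count M (n, 1, 1)) / (real N / \<rho>)))) \<longlonglongrightarrow> ?Num / ?Den"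
    using canon_at_density_tendsto[OF \<open>0 < \<beta>\<close> \<kappa>_def \<open>\<rho> > rho_c \<beta>\<close>, of lam] \<open>0 < lam\<close>
    by (simp add: r_def)
  then show ?thesis
    using num[folded numerator_series_eq_soft_term[OF \<open>0 < \<beta>\<close> \<kappa>_def]]
      den[folded denominator_series_eq_soft_term[OF \<open>0 < \<beta>\<close> \<kappa>_def]]
    unfolding r_def by blast
qed

end
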